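(* Let $\mathcal{L}$ be a class of compact convex sets in $\mathbb{R}^n$ stable under any linear transformations. The following are equivalent: 1. $|A|\,|\partial(A+[0,u])|\le|\partial A|\,|A+[0,u]|$ for any $A\in\mathcal{L}$ and any $u\in\mathbb{R}^n$. 2. $|A|\,|\partial(P_{u^\perp}A)|\le|\partial A|\,|P_{u^\perp}A|_{n-1}$ for any $A\in\mathcal{L}$ and any $u\in S^{n-1}$. 3. $|A|\,|P_{[u,v]^\perp}A|_{n-2}\sqrt{1-\langle u,v\rangle^2}\le|P_{u^\perp}A|_{n-1}\,|P_{v^\perp}A|_{n-1}$ for any $A\in\mathcal{L}$ and any $u,v\in S^{n-1}$. 4. $|A+[0,u]+[0,v]|\,|A|\le|A+[0,u]|\,|A+[0,v]|$ for any $A\in\mathcal{L}$ and any $u,v\in\mathbb{R}^n$. 5. $|A|\,V(A[n-2],Z_1,Z_2)\le\frac{n}{n-1}V(A[n-1],Z_1)\,V(A[n-1],Z_2)$ for any $A\in\mathcal{L}$ and any zonoids $Z_1,Z_2$. 6. For any $A\in\mathcal{L}$ and any $u,v\in\mathbb{R}^n$, define $P(t)=|A+t([0,u]+[0,v])|$ for $t>0$. Then $P(t)$ is the restriction to $\mathbb{R}_+$ of a polynomial on $\mathbb{R}$ which has only real roots.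
   Context: $|\cdot|$ is $n$-dimensional volume in $\mathbb{R}^n$, $|\cdot|_m$ is $m$-dimensional volume, $+$ is Minkowski sum, $[0,u]$ is the segment from $0$ to $u$, $S^{n-1}$ is the Euclidean unit sphere. $V$ is the mixed volume, normalized by $V(K,\dots,K)=|K|$; $K[j]$ means $K$ repeated $j$ times. $P_E$ is the orthogonal projection onto a subspace $E$; $u^\perp$ is the hyperplane orthogonal to $u$; $[u,v]^\perp$ is the orthogonal complement of the span of $u,v$. $|\partial K|$ is the surface area of a compact convex set $K$ in $\mathbb{R}^n$, given by $|\partial K|=nV(K[n-1],B_2^n)$, where $B_2^n$ is the closed Euclidean unit ball; $|\partial(P_{u^\perp}A)|$ is the surface area of $P_{u^\perp}A$ inside the $(n-1)$-dimensional space $u^\perp$, which equals $n(n-1)V(A[n-2],[0,u],B_2^n)$. A zonotope is a finite Minkowski sum of segments; a zonoid is a Hausdorff limit of zonotopes. *)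

theory Defs
  imports
    "HOL-Analysis.Analysis"
    "HOL-Library.Set_Algebras"
    "HOL-Library.Multiset"
    "HOL-Computational_Algebra.Polynomial"
begin

text \<open>
  Minkowski sums are written with the pointwise \<open>+\<close> on sets of \<open>HOL-Library.Set_Algebras\<close>, so that
  \<open>\<Sum>\<close> of sets is an iterated Minkowski sum, the empty sum being \<open>{0}\<close>. The segment from 0 to u is
  \<open>closed_segment 0 u\<close>, and the dilate \<open>c K\<close> is \<open>(*\<^sub>R) c ` K\<close>.
\<close>

section \<open>Lebesgue measure of a linear subspace\<close>

text \<open>
  The construction of \<^const>\<open>lborel\<close> with an orthonormal basis \<open>B\<close> of the subspace \<open>E\<close> in place of
  \<^const>\<open>Basis\<close>. The measure does not depend on \<open>B\<close>; for \<open>E = {0}\<close> it is the point mass at 0.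
\<close>

definition orthonormal_basis_of :: "'a::euclidean_space set \<Rightarrow> 'a set \<Rightarrow> bool" where
  "orthonormal_basis_of E B \<longleftrightarrow>
     B \<subseteq> E \<and> pairwise orthogonal B \<and> (\<forall>b\<in>B. norm b = 1) \<and> span B = E"

definition lborel_in :: "'a::euclidean_space set \<Rightarrow> 'a measure" where
  "lborel_in E =
     (let B = (SOME B. orthonormal_basis_of E B)
      in distr (\<Pi>\<^sub>M b\<in>B. lborel) borel (\<lambda>f. \<Sum>b\<in>B. f b *\<^sub>R b))"

definition volume_in :: "'a::euclidean_space set \<Rightarrow> 'a set \<Rightarrow> real" where
  "volume_in E K = measure (lborel_in E) K"

lemma orthonormal_basis_of_exists:
  assumes "subspace E"
  shows "orthonormal_basis_of E (SOME B. orthonormal_basis_of E B)"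
proof -
  obtain B where "B \<subseteq> E" "pairwise orthogonal B" "\<And>x. x \<in> B \<Longrightarrow> norm x = 1" "span B = E"
    using orthonormal_basis_subspace [OF assms] by metis
  then have "orthonormal_basis_of E B"
    by (simp add: orthonormal_basis_of_def)
  then show ?thesis
    by (rule someI)
qed

lemma nn_integral_lborel_translation:
  fixes f :: "'a::euclidean_space \<Rightarrow> ennreal"
  assumes [measurable]: "f \<in> borel_measurable borel"
  shows "(\<integral>\<^sup>+x. f (x + c) \<partial>lborel) = (\<integral>\<^sup>+x. f x \<partial>lborel)"
proof -
  have "(\<integral>\<^sup>+x. f x \<partial>lborel) = (\<integral>\<^sup>+x. f x \<partial>distr lborel borel ((+) c))"
    by (simp only: lborel_distr_plus)
  also have "\<dots> = (\<integral>\<^sup>+x. f (c + x) \<partial>lborel)"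
    by (rule nn_integral_distr) auto
  finally show ?thesis by (simp add: add.commute)
qed

lemma distr_orthogonal_lborel:
  fixes T :: "'a::euclidean_space \<Rightarrow> 'a"
  assumes T: "orthogonal_transformation T"
  shows "distr lborel borel T = lborel"
proof (rule measure_eqI)
  have lin: "linear T" using T by (rule orthogonal_transformation_linear)
  have [measurable]: "T \<in> borel_measurable borel"
    by (intro borel_measurable_continuous_onI linear_continuous_on) (simp add: lin linear_linear)
  define b :: "'a \<Rightarrow> ennreal" where "b = indicator (ball 0 1)"
  have [measurable]: "b \<in> borel_measurable borel" unfolding b_def by (intro borel_measurable_indicator) simp
  have bT: "b (T x) = b x" for x
    using T by (simp add: b_def indicator_def orthogonal_transformation_norm)
  have bm: "b (z - y) = b (y - z)" for y z
    by (simp add: b_def indicator_def norm_minus_commute)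
  define c where "c = (\<integral>\<^sup>+x. b x \<partial>lborel)"
  have c: "c = emeasure lborel (ball (0::'a) 1)" by (simp add: c_def b_def)
  have fin: "c \<noteq> 0" "c \<noteq> \<infinity>"
    using emeasure_lborel_ball_finite[of "0::'a" 1] open_not_negligible[of "ball (0::'a) 1"]
    by (auto simp: c negligible_iff_emeasure0)
  fix S :: "'a set" assume "S \<in> sets (distr lborel borel T)"
  then have [measurable]: "S \<in> sets borel" by simp
  define g :: "'a \<Rightarrow> ennreal" where "g = indicator S"
  have [measurable]: "g \<in> borel_measurable borel" unfolding g_def by (intro borel_measurable_indicator) simp
  have "c * (\<integral>\<^sup>+y. g y \<partial>lborel) = (\<integral>\<^sup>+x. b (T x) * (\<integral>\<^sup>+y. g (y + T x) \<partial>lborel) \<partial>lborel)"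
    by (simp add: nn_integral_lborel_translation bT c_def nn_integral_multc)
  also have "\<dots> = (\<integral>\<^sup>+x. (\<integral>\<^sup>+y. b (T x) * g (y + T x) \<partial>lborel) \<partial>lborel)"
    by (simp add: nn_integral_cmult)
  also have "\<dots> = (\<integral>\<^sup>+y. (\<integral>\<^sup>+x. b (T x) * g (y + T x) \<partial>lborel) \<partial>lborel)"
    by (rule lborel_pair.Fubini') simp
  also have "\<dots> = (\<integral>\<^sup>+y. (\<integral>\<^sup>+x. b (T x - y) * g (T x) \<partial>lborel) \<partial>lborel)"
  proof (rule nn_integral_cong)
    fix y
    obtain w where w: "y = T w"
      using orthogonal_transformation_surj [OF T] by (metis surjD)
    have "(\<integral>\<^sup>+x. b (T x) * g (y + T x) \<partial>lborel)
        = (\<integral>\<^sup>+x. b (T (x + w) - y) * g (T (x + w)) \<partial>lborel)"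
      by (simp add: w linear_add [OF lin] add.commute)
    also have "\<dots> = (\<integral>\<^sup>+x. b (T x - y) * g (T x) \<partial>lborel)"
      by (rule nn_integral_lborel_translation) measurable
    finally show "(\<integral>\<^sup>+x. b (T x) * g (y + T x) \<partial>lborel) = (\<integral>\<^sup>+x. b (T x - y) * g (T x) \<partial>lborel)" .
  qed
  also have "\<dots> = (\<integral>\<^sup>+x. (\<integral>\<^sup>+y. b (T x - y) * g (T x) \<partial>lborel) \<partial>lborel)"
    by (rule lborel_pair.Fubini') simp
  also have "\<dots> = (\<integral>\<^sup>+x. c * g (T x) \<partial>lborel)"
  proof (rule nn_integral_cong)
    fix x
    have "(\<integral>\<^sup>+y. b (T x - y) \<partial>lborel) = c"
      using nn_integral_lborel_translation [of b "- T x"] by (simp add: c_def bm)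
    then show "(\<integral>\<^sup>+y. b (T x - y) * g (T x) \<partial>lborel) = c * g (T x)"
      by (simp add: nn_integral_multc)
  qed
  also have "\<dots> = c * (\<integral>\<^sup>+x. g (T x) \<partial>lborel)"
    by (simp add: nn_integral_cmult)
  finally have "(\<integral>\<^sup>+y. g y \<partial>lborel) = (\<integral>\<^sup>+x. g (T x) \<partial>lborel)"
    using fin by (simp add: ennreal_mult_cancel_left)
  also have "\<dots> = (\<integral>\<^sup>+x. g x \<partial>distr lborel borel T)"
    by (rule nn_integral_distr [symmetric]) auto
  finally show "emeasure (distr lborel borel T) S = emeasure lborel S"
    by (simp add: g_def)
qed simp

lemma lborel_in_UNIV: "lborel_in UNIV = (lborel :: 'a::euclidean_space measure)"
proof -
  define B :: "'a set" where "B = (SOME B. orthonormal_basis_of UNIV B)"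
  have "orthonormal_basis_of UNIV B"
    unfolding B_def by (rule orthonormal_basis_of_exists) simp
  then have orth: "pairwise orthogonal B" and n1: "\<And>b. b \<in> B \<Longrightarrow> norm b = 1" and sp: "span B = UNIV"
    by (auto simp: orthonormal_basis_of_def)
  have "0 \<notin> B" using n1 by force
  with orth have ind: "independent B" by (rule pairwise_orthogonal_independent)
  then have fin: "finite B" by (rule independent_imp_finite)
  have card: "card B = card (Basis :: 'a set)"
    using ind sp by (metis dim_UNIV dim_span dim_eq_card_independent)
  obtain g where g: "bij_betw g (Basis :: 'a set) B"
    using finite_same_card_bij [OF finite_Basis fin] card by metis
  define h where "h = inv_into Basis g"
  have gB: "g b \<in> B" if "b \<in> Basis" for b using g that by (auto simp: bij_betw_def)
  have hB: "h b \<in> Basis" "g (h b) = b" if "b \<in> B" for b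
    using g that by (auto simp: h_def bij_betw_def inv_into_into f_inv_into_f)
  have hg: "h (g b) = b" if "b \<in> Basis" for b
    using g that by (simp add: h_def bij_betw_def)
  define T where "T x = (\<Sum>b\<in>Basis. (x \<bullet> b) *\<^sub>R g b)" for x
  have lin: "linear T"
    unfolding T_def by (intro linear_compose_sum ballI linearI)
      (auto simp: inner_left_distrib scaleR_left_distrib)
  have gg: "g b \<bullet> g c = (if b = c then 1 else 0)" if "b \<in> Basis" "c \<in> Basis" for b c
  proof (cases "b = c")
    case True then show ?thesis using n1[OF gB[OF that(1)]] by (simp add: norm_eq_1)
  next
    case False
    then have "g b \<noteq> g c" using hg that by metis
    then show ?thesis using orth gB that False by (auto simp: pairwise_def orthogonal_def)
  qed
  have "T x \<bullet> T y = x \<bullet> y" for x y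
  proof -
    have "T x \<bullet> T y = (\<Sum>b\<in>Basis. \<Sum>c\<in>Basis. (x \<bullet> b) * ((y \<bullet> c) * (g b \<bullet> g c)))"
      unfolding T_def inner_sum_left inner_sum_right by (subst sum.swap) (simp add: ac_simps)
    also have "\<dots> = (\<Sum>b\<in>Basis. \<Sum>c\<in>Basis. if b = c then (x \<bullet> b) * (y \<bullet> b) else 0)"
      by (intro sum.cong refl) (simp add: gg)
    also have "\<dots> = x \<bullet> y" by (simp add: euclidean_inner[of x y])
    finally show ?thesis .
  qed
  with lin have T: "orthogonal_transformation T" by (simp add: orthogonal_transformation_def)
  interpret product_sigma_finite "\<lambda>_::'a. lborel :: real measure" ..
  let ?r = "\<lambda>f::'a \<Rightarrow> real. \<lambda>b\<in>B. f (h b)"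
  have r: "?r \<in> measurable (\<Pi>\<^sub>M b\<in>Basis. lborel) (\<Pi>\<^sub>M b\<in>B. lborel)"
    by (intro measurable_restrict measurable_component_singleton hB)
  have "distr (\<Pi>\<^sub>M b\<in>Basis. lborel) (\<Pi>\<^sub>M b\<in>B. lborel) ?r = (\<Pi>\<^sub>M b\<in>B. lborel)"
  proof (rule PiM_eqI [OF fin])
    fix A :: "'a \<Rightarrow> real set" assume A: "\<And>i. i \<in> B \<Longrightarrow> A i \<in> sets lborel"
    have "?r -` (Pi\<^sub>E B A) \<inter> space (\<Pi>\<^sub>M b\<in>Basis. lborel) = Pi\<^sub>E Basis (\<lambda>b. A (g b))"
      using gB hB hg by (auto simp: space_PiM PiE_iff extensional_def) metis+
    then have "emeasure (distr (\<Pi>\<^sub>M b\<in>Basis. lborel) (\<Pi>\<^sub>M b\<in>B. lborel) ?r) (Pi\<^sub>E B A)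
        = emeasure (\<Pi>\<^sub>M b\<in>Basis. lborel) (Pi\<^sub>E Basis (\<lambda>b. A (g b)))"
      using A fin by (subst emeasure_distr [OF r]) (auto intro!: sets_PiM_I_finite)
    also have "\<dots> = (\<Prod>b\<in>Basis. emeasure lborel (A (g b)))"
      using A gB by (intro emeasure_PiM) auto
    also have "\<dots> = (\<Prod>b\<in>B. emeasure lborel (A b))"
      by (rule prod.reindex_bij_betw [OF g])
    finally show "emeasure (distr (\<Pi>\<^sub>M b\<in>Basis. lborel) (\<Pi>\<^sub>M b\<in>B. lborel) ?r) (Pi\<^sub>E B A)
        = (\<Prod>b\<in>B. emeasure lborel (A b))" .
  qed simp
  then have "lborel_in UNIV = distr (distr (\<Pi>\<^sub>M b\<in>Basis. lborel) (\<Pi>\<^sub>M b\<in>B. lborel) ?r)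
      borel (\<lambda>f. \<Sum>b\<in>B. f b *\<^sub>R b)"
    by (simp add: lborel_in_def B_def Let_def)
  also have "\<dots> = distr (\<Pi>\<^sub>M b\<in>Basis. lborel) borel (\<lambda>f. \<Sum>b\<in>B. f (h b) *\<^sub>R b)"
    by (subst distr_distr [OF _ r]) (auto simp: o_def intro!: distr_cong sum.cong)
  also have "\<dots> = distr (\<Pi>\<^sub>M b\<in>Basis. lborel) borel (\<lambda>f. T (\<Sum>b\<in>Basis. f b *\<^sub>R b))"
  proof (intro distr_cong refl)
    fix f :: "'a \<Rightarrow> real"
    have "(\<Sum>b\<in>B. f (h b) *\<^sub>R b) = (\<Sum>b\<in>Basis. f (h (g b)) *\<^sub>R g b)"
      by (rule sum.reindex_bij_betw [OF g, symmetric])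
    also have "\<dots> = T (\<Sum>b\<in>Basis. f b *\<^sub>R b)"
      by (simp add: T_def hg cong: sum.cong)
    finally show "(\<Sum>b\<in>B. f (h b) *\<^sub>R b) = T (\<Sum>b\<in>Basis. f b *\<^sub>R b)" .
  qed
  also have "\<dots> = distr (distr (\<Pi>\<^sub>M b\<in>Basis. lborel) borel (\<lambda>f. \<Sum>b\<in>Basis. f b *\<^sub>R b)) borel T"
  proof -
    have "T \<in> borel_measurable borel"
      by (intro borel_measurable_continuous_onI linear_continuous_on) (simp add: lin linear_linear)
    then show ?thesis by (subst distr_distr) (auto simp: o_def)
  qed
  also have "\<dots> = distr lborel borel T" by (simp only: lborel_eq [symmetric])
  also have "\<dots> = lborel" by (rule distr_orthogonal_lborel [OF T])
  finally show ?thesis .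
qed

lemma volume_in_UNIV: "volume_in UNIV K = measure lborel K"
  by (simp add: volume_in_def lborel_in_UNIV)

section \<open>Orthogonal projection\<close>

definition orth_proj :: "'a::euclidean_space set \<Rightarrow> 'a \<Rightarrow> 'a" where
  "orth_proj E x = (THE y. y \<in> E \<and> x - y \<in> E\<^sup>\<bottom>)"

section \<open>Mixed volumes\<close>

text \<open>
  Minkowski's theorem: for an \<open>m\<close>-dimensional subspace \<open>E\<close> there is a symmetric functional \<open>V\<close> of
  \<open>m\<close> nonempty compact convex subsets of \<open>E\<close> with
  \<open>|c\<^sub>1 K\<^sub>1 + \<dots> + c\<^sub>r K\<^sub>r| = \<Sum> V(K\<^sub>j\<^sub>1, \<dots>, K\<^sub>j\<^sub>m) c\<^sub>j\<^sub>1 \<dots> c\<^sub>j\<^sub>m\<close> for all \<open>c\<^sub>i \<ge> 0\<close>, the sum being over all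
  index tuples. The case of one body gives \<open>V(K, \<dots>, K) = |K|\<close>. These conditions determine \<open>V\<close> on all
  \<open>m\<close>-tuples of nonempty compact convex subsets of \<open>E\<close> (take \<open>r = m\<close> and compare the coefficients of
  \<open>c\<^sub>1 \<dots> c\<^sub>m\<close>); on other lists only symmetry and the convention for the empty set are required.
\<close>

definition is_mixed_volume :: "'a::euclidean_space set \<Rightarrow> ('a set list \<Rightarrow> real) \<Rightarrow> bool" where
  "is_mixed_volume E V \<longleftrightarrow>
     (\<forall>Ks Ls. mset Ks = mset Ls \<longrightarrow> V Ks = V Ls) \<and>
     (\<forall>Ks. {} \<in> set Ks \<longrightarrow> V Ks = 0) \<and>
     (\<forall>(r::nat) K c.
        (\<forall>i<r. compact (K i) \<and> convex (K i) \<and> K i \<noteq> {} \<and> K i \<subseteq> E \<and> 0 \<le> c i) \<longrightarrow>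
        volume_in E (\<Sum>i<r. (*\<^sub>R) (c i) ` K i) =
          (\<Sum>js | length js = dim E \<and> set js \<subseteq> {..<r}.
             V (map K js) * prod_list (map c js)))"

definition mixed_volume_in :: "'a::euclidean_space set \<Rightarrow> 'a set list \<Rightarrow> real" where
  "mixed_volume_in E = (SOME V. is_mixed_volume E V)"

abbreviation mixed_volume :: "'a::euclidean_space set list \<Rightarrow> real" where
  "mixed_volume \<equiv> mixed_volume_in UNIV"

definition surface_area_in :: "'a::euclidean_space set \<Rightarrow> 'a set \<Rightarrow> real" where
  "surface_area_in E K =
     real (dim E) * mixed_volume_in E (replicate (dim E - 1) K @ [cball 0 1 \<inter> E])"

abbreviation surface_area :: "'a::euclidean_space set \<Rightarrow> real" where
  "surface_area \<equiv> surface_area_in UNIV"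

section \<open>Zonoids\<close>

definition zonotope :: "'a::euclidean_space set \<Rightarrow> bool" where
  "zonotope Z \<longleftrightarrow> (\<exists>(r::nat) a b. Z = (\<Sum>i<r. closed_segment (a i) (b i)))"

text \<open>Only meaningful for nonempty bounded sets.\<close>

definition hausdorff_dist :: "'a::metric_space set \<Rightarrow> 'a set \<Rightarrow> real" where
  "hausdorff_dist A B = max (SUP a\<in>A. infdist a B) (SUP b\<in>B. infdist b A)"

definition zonoid :: "'a::euclidean_space set \<Rightarrow> bool" where
  "zonoid Z \<longleftrightarrow> compact Z \<and> Z \<noteq> {} \<and>
     (\<exists>Y. (\<forall>k::nat. zonotope (Y k)) \<and> (\<lambda>k. hausdorff_dist (Y k) Z) \<longlonglongrightarrow> 0)"

section \<open>Real-rooted polynomials\<close>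

text \<open>
  All complex roots are real. The zero polynomial counts as real-rooted, as is usual; it arises as
  the volume polynomial of sets of small dimension.
\<close>

definition real_rooted :: "real poly \<Rightarrow> bool" where
  "real_rooted p \<longleftrightarrow> p = 0 \<or> (\<forall>z. poly (map_poly complex_of_real p) z = 0 \<longrightarrow> z \<in> \<real>)"

section \<open>Equivalence of a list of statements\<close>

definition all_equivalent :: "bool list \<Rightarrow> bool" where
  "all_equivalent Ps \<longleftrightarrow> (\<forall>P\<in>set Ps. \<forall>Q\<in>set Ps. P \<longleftrightarrow> Q)"

end

theory Submission
  imports Defs
begin

text \<open>
  For a fixed convex body \<open>A\<close> put \<open>w = |A|\<close>, \<open>a(u) = |A + [0,u]| - |A|\<close> and let \<open>c(u,v)\<close> be the mixed second
  difference of the volume along \<open>[0,u]\<close> and \<open>[0,v]\<close>. Since \<open>|A + s[0,u]|\<close> is affine in \<open>s\<close>,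
  \<open>|A + s[0,u] + t[0,v]| = w + s a(u) + t a(v) + s t c(u,v)\<close>, and comparing growth for large \<open>s\<close>, \<open>t\<close>
  identifies \<open>a(u)\<close> and \<open>c(u,v)\<close> with volumes of projections. Thus (3), (4) and (6) all say that
  \<open>w c(u,v) \<le> a(u) a(v)\<close>; for (6), rescaling \<open>u\<close> and \<open>v\<close> turns the discriminant condition into this
  product inequality. Bilinearity and continuity of mixed volumes extend it from segments to zonoids,
  which is (5), and to the ball, a limit of zonotopes, which gives (1) and (2). Conversely (1) for all
  linear images of \<open>A\<close> is the same inequality with an ellipsoid in place of the ball, and ellipsoids can
  shrink to the segment \<open>[-v,v]\<close>.

  Mixed volumes exist because \<open>|c\<^sub>1 K\<^sub>1 + \<dots> + c\<^sub>r K\<^sub>r|\<close> is a polynomial in \<open>c\<close>: for polytopes a generic linear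
  programme cuts the Minkowski sum into cells whose volumes are monomials in \<open>c\<close>, polarization
  writes the coefficients in terms of volumes, and this form survives the limit to convex bodies.
\<close>

section \<open>Convex bodies and Minkowski sums\<close>

text \<open>Mixed volumes are given by \<open>SOME\<close>, so nothing is known about them until a
  functional with the required expansion is exhibited and shown to be forced. Afterwards they are
  handled as coefficients: \<open>mixed_linear A K\<close> is the coefficient of t in |A + tK| and
  \<open>mixed_bilinear A K K\<close> is twice that of t^2. Additivity, monotonicity, the effect of
  linear maps and the surface area of A + [0,su] all come from comparing expansions of volumes. The
  mixed volumes of a hyperplane orthogonal to u are obtained from those of the whole space by
  differentiating |M + t[0,u]| at t = 0.

  Limits of volumes are taken from outside: if M lies in the approximants, monotonicity bounds their
  volumes from below and continuity of measure along a decreasing sequence bounds them from above,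
  even when M has no interior.

  Statements (1) and (2) agree for each single A, and so do (3) to (6), but the passage from the
  first group to the second uses the whole class: the ball is rigid, and only a linear image of A
  can make it act like a segment.\<close>

abbreviation vol :: "'a::euclidean_space set \<Rightarrow> real" where
  "vol \<equiv> measure lborel"

definition body :: "'a::euclidean_space set \<Rightarrow> bool" where
  "body K \<longleftrightarrow> compact K \<and> convex K \<and> K \<noteq> {}"

lemma bodyD: "body K \<Longrightarrow> compact K" "body K \<Longrightarrow> convex K" "body K \<Longrightarrow> K \<noteq> {}"
  by (auto simp: body_def)

lemma compact_set_plus: "compact (A + B)" if "compact A" "compact B"
  for A B :: "'a::real_normed_vector set"
proof -
  have "A + B = {x + y | x y. x \<in> A \<and> y \<in> B}"
    by (auto simp: set_plus_def)
  then show ?thesis using compact_sums[OF that] by simp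
qed

lemma body_plus: "body A \<Longrightarrow> body B \<Longrightarrow> body (A + B)"
  unfolding body_def using compact_set_plus convex_set_plus by (auto simp: set_plus_def)

lemma body_zero: "body {0}"
  by (simp add: body_def)

lemma body_sum: "(\<And>i. i \<in> I \<Longrightarrow> body (K i)) \<Longrightarrow> body (\<Sum>i\<in>I. K i)"
  by (induction I rule: infinite_finite_induct) (auto intro: body_plus body_zero)

lemma body_scale: "body A \<Longrightarrow> body ((*\<^sub>R) c ` A)"
  by (simp add: body_def compact_scaling convex_scaling)

lemma body_linear_image: "body A \<Longrightarrow> linear f \<Longrightarrow> body (f ` A)"
  by (auto simp: body_def convex_linear_image linear_continuous_on linear_linear intro: compact_continuous_image)

lemma body_segment: "body (closed_segment a b)"
  by (simp add: body_def)

lemma body_singleton: "body {a}"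
  by (simp add: body_def)

lemma body_cball: "0 \<le> r \<Longrightarrow> body (cball a r)"
  by (simp add: body_def)

lemma body_borel [measurable_dest]: "body A \<Longrightarrow> A \<in> sets borel"
  by (simp add: body_def borel_compact)

text \<open>Convexity makes dilates additive: s x + t y is s + t times a weighted mean of x and y.
  Merging the coefficients of repeated summands rests on this.\<close>

lemma scale_add:
  fixes K :: "'a::real_vector set"
  assumes "convex K" "0 \<le> s" "0 \<le> t"
  shows "(*\<^sub>R) (s + t) ` K = (*\<^sub>R) s ` K + (*\<^sub>R) t ` K"
proof
  show "(*\<^sub>R) (s + t) ` K \<subseteq> (*\<^sub>R) s ` K + (*\<^sub>R) t ` K"
    by (auto simp: scaleR_add_left intro!: set_plus_intro)
  show "(*\<^sub>R) s ` K + (*\<^sub>R) t ` K \<subseteq> (*\<^sub>R) (s + t) ` K"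
  proof
    fix z assume "z \<in> (*\<^sub>R) s ` K + (*\<^sub>R) t ` K"
    then obtain x y where z: "x \<in> K" "y \<in> K" "z = s *\<^sub>R x + t *\<^sub>R y"
      by (auto elim!: set_plus_elim)
    show "z \<in> (*\<^sub>R) (s + t) ` K"
    proof (cases "s + t = 0")
      case True
      with assms have "s = 0" "t = 0" by linarith+
      with z show ?thesis by auto
    next
      case False
      with assms have "s + t > 0" by linarith
      have "(s / (s + t)) *\<^sub>R x + (t / (s + t)) *\<^sub>R y \<in> K"
        using assms z \<open>s + t > 0\<close> by (intro convexD) (auto simp: add_divide_distrib[symmetric])
      moreover have "z = (s + t) *\<^sub>R ((s / (s + t)) *\<^sub>R x + (t / (s + t)) *\<^sub>R y)"
        using False by (simp add: z scaleR_add_right)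
      ultimately show ?thesis by blast
    qed
  qed
qed

lemma scale_zero: "K \<noteq> {} \<Longrightarrow> (*\<^sub>R) 0 ` (K :: 'a::real_vector set) = {0}"
  by auto

lemma scale_scale: "(*\<^sub>R) s ` (*\<^sub>R) t ` K = (*\<^sub>R) (s * t) ` (K :: 'a::real_vector set)"
  by (simp add: image_image)

lemma linear_image_plus: "linear f \<Longrightarrow> f ` (A + B) = f ` A + f ` B"
  by (auto simp: set_plus_def linear_add image_iff) (metis linear_add)+

lemma linear_image_sum: "linear f \<Longrightarrow> f ` (\<Sum>i\<in>I. K i) = (\<Sum>i\<in>I. f ` K i)"
  by (induction I rule: infinite_finite_induct) (auto simp: linear_image_plus linear_0)

lemma scale_plus: "(*\<^sub>R) c ` (A + B) = (*\<^sub>R) c ` A + (*\<^sub>R) c ` (B :: 'a::real_vector set)"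
  by (rule linear_image_plus) (simp add: linear_iff scaleR_add_right)

lemma scale_sum: "(*\<^sub>R) c ` (\<Sum>i\<in>I. K i) = (\<Sum>i\<in>I. (*\<^sub>R) c ` (K i :: 'a::real_vector set))"
  by (rule linear_image_sum) (simp add: linear_iff scaleR_add_right)

lemma linear_image_scale: "linear f \<Longrightarrow> f ` (*\<^sub>R) c ` K = (*\<^sub>R) c ` f ` K"
  by (auto simp: image_image linear_cmul)

lemma scale_sum_coeff:
  fixes K :: "'a::real_vector set"
  assumes "convex K" "K \<noteq> {}" "\<And>i. i \<in> I \<Longrightarrow> 0 \<le> c i"
  shows "(*\<^sub>R) (\<Sum>i\<in>I. c i) ` K = (\<Sum>i\<in>I. (*\<^sub>R) (c i) ` K)"
  using assms(3)
proof (induction I rule: infinite_finite_induct)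
  case (insert x F)
  then show ?case by (simp add: scale_add[OF assms(1)] sum_nonneg)
qed (use assms(2) in auto)

lemma set_sum_mono: "(\<And>i. i \<in> I \<Longrightarrow> A i \<subseteq> B i) \<Longrightarrow> (\<Sum>i\<in>I. A i) \<subseteq> (\<Sum>i\<in>I. B i :: 'a::comm_monoid_add set)"
  by (induction I rule: infinite_finite_induct) (simp_all add: set_plus_mono2)

lemma scale_cball:
  assumes "0 \<le> r" "0 \<le> s"
  shows "(*\<^sub>R) r ` cball 0 s = (cball 0 (r * s) :: 'a::euclidean_space set)"
proof (cases "r = 0")
  case True
  have "cball (0::'a) s \<noteq> {}" using assms by simp
  from scale_zero[OF this] True show ?thesis by (simp only: True mult_zero_left cball_trivial)
qed (use assms in \<open>simp add: cball_scale\<close>)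

lemma cball_plus_cball:
  "0 \<le> r \<Longrightarrow> 0 \<le> s \<Longrightarrow> cball 0 r + cball 0 s = (cball 0 (r + s) :: 'a::euclidean_space set)"
  using scale_add[of "cball (0::'a) 1" r s] by (simp add: scale_cball)

lemma scale_segment: "(*\<^sub>R) c ` closed_segment a b = closed_segment (c *\<^sub>R a) (c *\<^sub>R b)"
  by (rule closed_segment_linear_image[symmetric]) (simp add: linear_iff scaleR_add_right)

section \<open>Volume under inclusion, translation and linear maps\<close>

lemma vol_mono: "body A \<Longrightarrow> body B \<Longrightarrow> A \<subseteq> B \<Longrightarrow> vol A \<le> vol B"
  by (rule measure_mono_fmeasurable) (auto simp: fmeasurable_compact bodyD body_borel)

lemma vol_translation: "vol ({a} + A) = vol A" if "body A" for A :: "'a::euclidean_space set"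
proof -
  have "{a} + A = (+) a ` A" by (auto simp: set_plus_def)
  moreover have "vol A = measure lebesgue A" "vol ((+) a ` A) = measure lebesgue ((+) a ` A)"
    using that compact_translation[of A a] by (auto simp: body_def borel_compact)
  ultimately show ?thesis by (simp add: measure_translation)
qed

lemma vol_lebesgue: "body A \<Longrightarrow> measure lebesgue A = vol A"
  by (simp add: body_borel)

lemma body_lmeasurable: "body A \<Longrightarrow> A \<in> lmeasurable"
  by (simp add: bodyD lmeasurable_compact)

text \<open>The factor k is the modulus of the determinant, obtained here as the volume of T(ball)
  divided by that of the ball. Integrating b(x) g(T' y + x) over both variables in two ways, with b
  the indicator of the unit ball and g that of S, compares the pair S, T(S) with the pair ball,
  T(ball).\<close>

lemma lborel_linear_image:
  fixes T :: "'a::euclidean_space \<Rightarrow> 'a"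
  assumes lin: "linear T" and inj: "inj T"
  obtains k where "k > 0" "\<And>S. S \<in> sets borel \<Longrightarrow> T ` S \<in> sets borel \<and> vol (T ` S) = k * vol S"
proof -
  obtain T' where T': "linear T'" "T' \<circ> T = id" "T \<circ> T' = id"
    using linear_injective_isomorphism[OF lin inj] by (auto simp: fun_eq_iff)
  have T'T: "T' (T x) = x" and TT': "T (T' x) = x" for x
    using T'(2,3) by (auto simp: fun_eq_iff)
  have [measurable]: "T' \<in> borel_measurable borel"
    by (intro borel_measurable_continuous_onI linear_continuous_on) (simp add: T' linear_linear)
  define b :: "'a \<Rightarrow> ennreal" where "b = indicator (ball 0 1)"
  have [measurable]: "b \<in> borel_measurable borel"
    unfolding b_def by (intro borel_measurable_indicator) simp
  have bm: "b (z - y) = b (y - z)" for y z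
    by (simp add: b_def indicator_def norm_minus_commute)
  define c where "c = (\<integral>\<^sup>+x. b x \<partial>lborel)"
  have c: "c = emeasure lborel (ball (0::'a) 1)" by (simp add: c_def b_def)
  have fin: "c \<noteq> 0" "c \<noteq> \<infinity>"
    using emeasure_lborel_ball_finite[of "0::'a" 1] open_not_negligible[of "ball (0::'a) 1"]
    by (auto simp: c negligible_iff_emeasure0)
  define d where "d = (\<integral>\<^sup>+x. b (T' x) \<partial>lborel)"
  have Tball: "open (T ` ball 0 1)" "bounded (T ` ball 0 1)"
    using open_surjective_linear_image[OF open_ball lin] linear_injective_imp_surjective[OF lin inj]
      bounded_linear_image[OF bounded_ball] lin by (auto simp: linear_conv_bounded_linear)
  have "b (T' x) = indicator (T ` ball 0 1) x" for x
  proof -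
    have "T' x \<in> ball 0 1 \<longleftrightarrow> x \<in> T ` ball 0 1" by (metis TT' T'T image_iff)
    then show ?thesis by (simp add: b_def indicator_def)
  qed
  then have d: "d = emeasure lborel (T ` ball 0 1)"
    using Tball(1) by (simp add: d_def)
  have "T ` ball 0 1 \<noteq> {}" by simp
  then have dfin: "d \<noteq> 0" "d \<noteq> \<infinity>"
    using emeasure_bounded_finite[OF Tball(2)] open_not_negligible[OF Tball(1)] Tball(1)
    by (auto simp: d negligible_iff_emeasure0)
  have key: "c * emeasure lborel (T ` S) = d * emeasure lborel S" "T ` S \<in> sets borel"
    if S[measurable]: "S \<in> sets borel" for S
  proof -
    have TS: "T ` S = T' -` S \<inter> space borel" by (auto simp: T'T) (metis TT' image_eqI)
    show [measurable]: "T ` S \<in> sets borel" unfolding TS by measurable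
    define g :: "'a \<Rightarrow> ennreal" where "g = indicator S"
    have [measurable]: "g \<in> borel_measurable borel"
      unfolding g_def by (intro borel_measurable_indicator) simp
    have "c * emeasure lborel (T ` S) = c * (\<integral>\<^sup>+y. g (T' y) \<partial>lborel)"
      by (subst nn_integral_indicator[symmetric], simp, intro arg_cong2[where f="(*)"] nn_integral_cong refl)
        (auto simp: g_def TS indicator_def)
    \<comment> \<open>By translation invariance the inner integral does not depend on x; the shift T
      x is inserted so that T' turns it into a shift by x.\<close>
    also have "\<dots> = (\<integral>\<^sup>+x. b x * (\<integral>\<^sup>+y. g (T' (y + T x)) \<partial>lborel) \<partial>lborel)"
      using nn_integral_lborel_translation[of "\<lambda>y. g (T' y)"] by (simp add: c_def nn_integral_multc)
    also have "\<dots> = (\<integral>\<^sup>+x. (\<integral>\<^sup>+y. b x * g (T' y + x) \<partial>lborel) \<partial>lborel)"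
      by (simp add: nn_integral_cmult linear_add[OF T'(1)] T'T)
    also have "\<dots> = (\<integral>\<^sup>+y. (\<integral>\<^sup>+x. b x * g (T' y + x) \<partial>lborel) \<partial>lborel)"
      by (rule lborel_pair.Fubini') simp
    also have "\<dots> = (\<integral>\<^sup>+y. (\<integral>\<^sup>+x. b (x - T' y) * g x \<partial>lborel) \<partial>lborel)"
    proof (rule nn_integral_cong)
      fix y
      have "(\<integral>\<^sup>+x. b x * g (T' y + x) \<partial>lborel)
          = (\<integral>\<^sup>+x. b ((x + T' y) - T' y) * g (x + T' y) \<partial>lborel)"
        by (simp add: add.commute)
      also have "\<dots> = (\<integral>\<^sup>+x. b (x - T' y) * g x \<partial>lborel)"
        by (rule nn_integral_lborel_translation) measurable
      finally show "(\<integral>\<^sup>+x. b x * g (T' y + x) \<partial>lborel) = (\<integral>\<^sup>+x. b (x - T' y) * g x \<partial>lborel)" .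
    qed
    also have "\<dots> = (\<integral>\<^sup>+x. (\<integral>\<^sup>+y. b (x - T' y) * g x \<partial>lborel) \<partial>lborel)"
      by (rule lborel_pair.Fubini') simp
    also have "\<dots> = (\<integral>\<^sup>+x. d * g x \<partial>lborel)"
    proof (rule nn_integral_cong)
      fix x
      have "b (x - T' y) = b (T' (y - T x))" for y
        by (simp add: linear_diff[OF T'(1)] T'T bm)
      then have "(\<integral>\<^sup>+y. b (x - T' y) \<partial>lborel) = d"
        using nn_integral_lborel_translation [of "\<lambda>y. b (T' y)" "- T x"] by (simp add: d_def)
      then show "(\<integral>\<^sup>+y. b (x - T' y) * g x \<partial>lborel) = d * g x"
        by (simp add: nn_integral_multc)
    qed
    also have "\<dots> = d * emeasure lborel S"
      by (simp add: nn_integral_cmult g_def)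
    finally show "c * emeasure lborel (T ` S) = d * emeasure lborel S" .
  qed
  have pos: "0 < enn2real c" "0 < enn2real d"
    using fin dfin by (auto simp: enn2real_positive_iff top.not_eq_extremum zero_less_iff_neq_zero)
  show thesis
  proof
    show "0 < enn2real d / enn2real c" using pos by simp
    fix S :: "'a set" assume S: "S \<in> sets borel"
    have "enn2real c * vol (T ` S) = enn2real d * vol S"
      using arg_cong[OF key(1)[OF S], of enn2real] by (simp add: measure_def enn2real_mult)
    with key(2)[OF S] pos show "T ` S \<in> sets borel \<and> vol (T ` S) = enn2real d / enn2real c * vol S"
      by (simp add: field_simps)
  qed
qed

text \<open>The factor left open by \<open>lborel_linear_image\<close> is found by testing on the
  unit cube, whose image is a box with edges c b.\<close>

lemma vol_stretch:
  fixes S :: "'a::euclidean_space set"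
  assumes S: "S \<in> sets borel" and c: "\<And>b. b \<in> Basis \<Longrightarrow> c b > 0"
  shows "vol ((\<lambda>x. \<Sum>b\<in>Basis. (c b * (x \<bullet> b)) *\<^sub>R b) ` S) = (\<Prod>b\<in>Basis. c b) * vol S"
proof -
  let ?T = "\<lambda>x::'a. \<Sum>b\<in>Basis. (c b * (x \<bullet> b)) *\<^sub>R b"
  have inner: "?T x \<bullet> b = c b * (x \<bullet> b)" if "b \<in> Basis" for x b
    using that by (simp add: inner_sum_left inner_Basis if_distrib sum.delta cong: if_cong)
  have lin: "linear ?T"
    by (intro linear_compose_sum ballI linearI) (auto simp: inner_left_distrib algebra_simps)
  have injT: "inj ?T"
  proof (rule injI)
    fix x y assume "?T x = ?T y"
    show "x = y"
    proof (rule euclidean_eqI)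
      fix b :: 'a assume b: "b \<in> Basis"
      have "c b * (x \<bullet> b) = c b * (y \<bullet> b)"
        using arg_cong[OF \<open>?T x = ?T y\<close>, of "\<lambda>z. z \<bullet> b"] unfolding inner[OF b] .
      with less_imp_neq[OF c[OF b]] show "x \<bullet> b = y \<bullet> b" by auto
    qed
  qed
  obtain k where k: "k > 0" "\<And>S. S \<in> sets borel \<Longrightarrow> ?T ` S \<in> sets borel \<and> vol (?T ` S) = k * vol S"
    using lborel_linear_image[OF lin injT] by blast
  have "?T ` cbox 0 One = cbox 0 (\<Sum>b\<in>Basis. c b *\<^sub>R b)"
  proof
    show "?T ` cbox 0 One \<subseteq> cbox 0 (\<Sum>b\<in>Basis. c b *\<^sub>R b)"
    proof
      fix y assume "y \<in> ?T ` cbox 0 One"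
      then obtain x where x: "x \<in> cbox 0 One" "y = ?T x" by blast
      show "y \<in> cbox 0 (\<Sum>b\<in>Basis. c b *\<^sub>R b)"
        unfolding mem_box x(2)
      proof (intro ballI conjI)
        fix b :: 'a assume b: "b \<in> Basis"
        have "0 \<le> x \<bullet> b" "x \<bullet> b \<le> 1" using x(1) b by (auto simp: mem_box)
        then show "0 \<bullet> b \<le> ?T x \<bullet> b" "?T x \<bullet> b \<le> (\<Sum>b\<in>Basis. c b *\<^sub>R b) \<bullet> b"
          unfolding inner[OF b] using b c[OF b] mult_left_le[of "x \<bullet> b" "c b"] by simp_all
      qed
    qed
    show "cbox 0 (\<Sum>b\<in>Basis. c b *\<^sub>R b) \<subseteq> ?T ` cbox 0 One"
    proof
      fix y assume y: "y \<in> cbox 0 (\<Sum>b\<in>Basis. c b *\<^sub>R b)"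
      have "y = ?T (\<Sum>b\<in>Basis. ((y \<bullet> b) / c b) *\<^sub>R b)"
      proof (rule euclidean_eqI)
        fix b :: 'a assume b: "b \<in> Basis"
        show "y \<bullet> b = ?T (\<Sum>b\<in>Basis. ((y \<bullet> b) / c b) *\<^sub>R b) \<bullet> b"
          unfolding inner[OF b] using c[OF b] b by simp
      qed
      moreover have "(\<Sum>b\<in>Basis. ((y \<bullet> b) / c b) *\<^sub>R b) \<in> cbox 0 One"
        using y c by (auto simp: mem_box less_imp_le)
      ultimately show "y \<in> ?T ` cbox 0 One" by blast
    qed
  qed
  moreover have "vol (cbox 0 (\<Sum>b\<in>Basis. c b *\<^sub>R b)) = (\<Prod>b\<in>Basis. c b)"
    using c by (simp add: measure_lborel_cbox_eq less_imp_le)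
  moreover have "vol (cbox 0 (One::'a)) = 1" by (simp add: measure_lborel_cbox_eq)
  ultimately have "k = (\<Prod>b\<in>Basis. c b)" using k(2)[of "cbox 0 One"] by simp
  with k(2)[OF S] show ?thesis by simp
qed

section \<open>Outer continuity of the volume\<close>

text \<open>A compact set is the intersection of its closed neighbourhoods, which have finite
  volume, so continuity from above applies.\<close>

lemma vol_thicken_tendsto:
  assumes "compact (M :: 'a::euclidean_space set)"
  shows "(\<lambda>k. vol (M + cball 0 (1 / real (Suc k)))) \<longlonglongrightarrow> vol M"
proof -
  let ?A = "\<lambda>k. M + cball 0 (1 / real (Suc k))"
  have c: "compact (?A k)" for k using assms by (simp add: compact_set_plus)
  have "(\<Inter>k. ?A k) = M"
  proof
    show "M \<subseteq> (\<Inter>k. ?A k)"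
    proof
      fix x assume "x \<in> M"
      then have "x + 0 \<in> ?A k" for k by (intro set_plus_intro) auto
      then show "x \<in> (\<Inter>k. ?A k)" by simp
    qed
    show "(\<Inter>k. ?A k) \<subseteq> M"
    proof
      fix x assume x: "x \<in> (\<Inter>k. ?A k)"
      have "\<exists>y\<in>M. dist y x \<le> 1 / real (Suc k)" for k
      proof -
        have "x \<in> ?A k" using x by blast
        then obtain y z where "y \<in> M" "z \<in> cball 0 (1 / real (Suc k))" "x = y + z"
          by (elim set_plus_elim)
        then show ?thesis by (intro bexI[of _ y]) (auto simp: dist_norm)
      qed
      then obtain y where y: "\<And>k. y k \<in> M" "\<And>k. dist (y k) x \<le> 1 / real (Suc k)" by metis
      have "(\<lambda>k. dist (y k) x) \<longlonglongrightarrow> 0"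
        by (rule tendsto_sandwich[OF _ _ tendsto_const LIMSEQ_inverse_real_of_nat])
          (use y in \<open>auto simp: inverse_eq_divide\<close>)
      then have "y \<longlonglongrightarrow> x" by (rule tendsto_dist_iff[THEN iffD2])
      then show "x \<in> M"
        using compact_imp_closed[OF assms] y(1) closed_sequentially by blast
    qed
  qed
  moreover have "(\<lambda>k. vol (?A k)) \<longlonglongrightarrow> vol (\<Inter>k. ?A k)"
  proof (rule Lim_measure_decseq)
    show "range ?A \<subseteq> sets lborel" using c by (auto simp: borel_compact)
    show "decseq ?A"
      unfolding decseq_def by (intro allI impI set_plus_mono2 order_refl subset_cball) (simp add: frac_le)
    show "emeasure lborel (?A i) \<noteq> \<infinity>" for i
      using emeasure_compact_finite[OF c[of i]] by simp
  qed
  ultimately show ?thesis by simp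
qed

text \<open>The inclusion of M in L k gives the lower bound by monotonicity; for the upper bound, L
  k eventually lies in any prescribed neighbourhood of M.\<close>

lemma vol_outer_tendsto:
  fixes M :: "'a::euclidean_space set"
  assumes M: "body M" and L: "\<And>k. body (L k)" and sub: "\<And>k. M \<subseteq> L k"
    "\<And>k. L k \<subseteq> M + cball 0 (e k)" and e: "e \<longlonglongrightarrow> 0"
  shows "(\<lambda>k. vol (L k)) \<longlonglongrightarrow> vol M"
proof (rule order_tendstoI)
  fix a assume "a < vol M"
  then show "\<forall>\<^sub>F k in sequentially. a < vol (L k)"
    using vol_mono[OF M L sub(1)] by (intro always_eventually) (meson less_le_trans)
next
  fix a assume "vol M < a"
  then have "\<forall>\<^sub>F k in sequentially. vol (M + cball 0 (1 / real (Suc k))) < a"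
    using vol_thicken_tendsto[OF bodyD(1)[OF M]] by (simp add: order_tendsto_iff)
  then obtain m where m: "vol (M + cball 0 (1 / real (Suc m))) < a"
    using eventually_happens trivial_limit_sequentially by blast
  have "\<forall>\<^sub>F k in sequentially. e k < 1 / real (Suc m)"
    using e by (simp add: order_tendsto_iff)
  then show "\<forall>\<^sub>F k in sequentially. vol (L k) < a"
  proof eventually_elim
    case (elim k)
    have "L k \<subseteq> M + cball 0 (1 / real (Suc m))"
      by (rule order_trans[OF sub(2) set_plus_mono2[OF order_refl subset_cball]]) (use elim in simp)
    then have "vol (L k) \<le> vol (M + cball 0 (1 / real (Suc m)))"
      using L M by (intro vol_mono body_plus body_cball) auto
    with m show ?case by simp
  qed
qed

lemma outer_sum:
  fixes K L :: "'i \<Rightarrow> 'a::euclidean_space set"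
  assumes "finite I" "\<And>i. i \<in> I \<Longrightarrow> L i \<subseteq> K i + cball 0 (e i)" "\<And>i. i \<in> I \<Longrightarrow> 0 \<le> e i"
  shows "(\<Sum>i\<in>I. L i) \<subseteq> (\<Sum>i\<in>I. K i) + cball 0 (\<Sum>i\<in>I. e i)"
proof -
  have "(\<Sum>i\<in>I. L i) \<subseteq> (\<Sum>i\<in>I. K i + cball 0 (e i))"
    by (intro set_sum_mono assms)
  also have "\<dots> = (\<Sum>i\<in>I. K i) + (\<Sum>i\<in>I. cball 0 (e i))"
    by (simp add: sum.distrib)
  also have "(\<Sum>i\<in>I. cball 0 (e i)) = (cball 0 (\<Sum>i\<in>I. e i) :: 'a set)"
    using assms(1,3) by (induction I rule: finite_induct) (auto simp: cball_plus_cball sum_nonneg)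
  finally show ?thesis .
qed

lemma scale_mono: "A \<subseteq> B \<Longrightarrow> (*\<^sub>R) c ` A \<subseteq> (*\<^sub>R) c ` (B :: 'a::real_vector set)"
  by (rule image_mono)

lemma outer_scale:
  fixes K :: "'a::euclidean_space set"
  assumes "L \<subseteq> K + cball 0 e" "0 \<le> c" "0 \<le> e"
  shows "(*\<^sub>R) c ` L \<subseteq> (*\<^sub>R) c ` K + cball 0 (c * e)"
  using scale_mono[OF assms(1), of c] by (simp add: scale_plus scale_cball assms(2,3))

section \<open>Volume polynomials of polytopes\<close>

text \<open>The costs are h j = t ^ e j, a point of the moment curve. Each \<mu> becomes a nonzero
  polynomial in t, because e is injective on J, and t is chosen outside the finitely many roots of
  all of them.\<close>

lemma generic_functional:
  fixes M :: "('j \<Rightarrow> real) set"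
  assumes "finite J" "finite M" "\<And>\<mu>. \<mu> \<in> M \<Longrightarrow> \<exists>j\<in>J. \<mu> j \<noteq> 0"
  obtains h where "\<And>\<mu>. \<mu> \<in> M \<Longrightarrow> (\<Sum>j\<in>J. h j * \<mu> j) \<noteq> (0::real)"
proof -
  obtain e :: "'j \<Rightarrow> nat" where e: "inj_on e J"
    using finite_imp_inj_to_nat_seg[OF assms(1)] by blast
  define P where "P \<mu> = (\<Sum>j\<in>J. monom (\<mu> j) (e j))" for \<mu> :: "'j \<Rightarrow> real"
  have "P \<mu> \<noteq> 0" if \<mu>: "\<mu> \<in> M" for \<mu>
  proof -
    obtain j where j: "j \<in> J" "\<mu> j \<noteq> 0" using assms(3)[OF \<mu>] by blast
    have "coeff (P \<mu>) (e j) = (\<Sum>i\<in>J. if i = j then \<mu> j else 0)"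
      unfolding P_def coeff_sum using e j by (intro sum.cong) (auto simp: inj_on_def)
    also have "\<dots> = \<mu> j" using j assms(1) by simp
    finally show ?thesis using j by auto
  qed
  then have "finite (\<Union>\<mu>\<in>M. {t. poly (P \<mu>) t = 0})"
    using assms(2) by (intro finite_UN_I poly_roots_finite)
  then obtain t where t: "t \<notin> (\<Union>\<mu>\<in>M. {t. poly (P \<mu>) t = 0})"
    using ex_new_if_finite[OF infinite_UNIV_char_0] by blast
  show thesis
  proof
    fix \<mu> assume "\<mu> \<in> M"
    then have "poly (P \<mu>) t \<noteq> 0" using t by blast
    then show "(\<Sum>j\<in>J. t ^ e j * \<mu> j) \<noteq> 0"
      by (simp add: P_def poly_sum poly_monom mult.commute)
  qed
qed

text \<open>
  A point of \<open>\<Sum>\<^sub>i c\<^sub>i conv {p\<^sub>j | \<iota> j = i}\<close> is given by weights on the index set \<open>J\<close>; among them the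
  linear programme with a generic cost vector singles out one. The supports of the optimal weights
  do not depend on \<open>c\<close>, which yields a subdivision of the Minkowski sum into cells whose volumes
  are monomials in \<open>c\<close>.
\<close>

locale labelled_points =
  fixes J :: "'j set" and lab :: "'j \<Rightarrow> nat" and p :: "'j \<Rightarrow> 'a::euclidean_space" and r :: nat
  assumes finJ: "finite J" and lab_less: "\<And>j. j \<in> J \<Longrightarrow> lab j < r"
begin

definition class_sum :: "('j \<Rightarrow> real) \<Rightarrow> nat \<Rightarrow> real" where
  "class_sum l i = (\<Sum>j\<in>J. if lab j = i then l j else 0)"

definition comb :: "('j \<Rightarrow> real) \<Rightarrow> 'a" where
  "comb l = (\<Sum>j\<in>J. l j *\<^sub>R p j)"

definition supp :: "('j \<Rightarrow> real) \<Rightarrow> 'j set" where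
  "supp l = {j. l j \<noteq> 0}"

definition feas :: "(nat \<Rightarrow> real) \<Rightarrow> 'a \<Rightarrow> ('j \<Rightarrow> real) \<Rightarrow> bool" where
  "feas c x l \<longleftrightarrow> (\<forall>j. 0 \<le> l j) \<and> supp l \<subseteq> J \<and> comb l = x \<and> (\<forall>i<r. class_sum l i = c i)"

text \<open>Differences of feasible weights for one x and one c, that is, the directions in which a
  feasible point of the linear programme can move.\<close>

definition ker :: "('j \<Rightarrow> real) \<Rightarrow> bool" where
  "ker m \<longleftrightarrow> supp m \<subseteq> J \<and> comb m = 0 \<and> (\<forall>i<r. class_sum m i = 0)"

text \<open>For given x and c at most one feasible point is supported in such a set, as for a basis
  in linear programming.\<close>

definition indep :: "'j set \<Rightarrow> bool" where
  "indep S \<longleftrightarrow> (\<forall>m. ker m \<longrightarrow> supp m \<subseteq> S \<longrightarrow> m = (\<lambda>_. 0))"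

definition cost :: "('j \<Rightarrow> real) \<Rightarrow> ('j \<Rightarrow> real) \<Rightarrow> real" where
  "cost h l = (\<Sum>j\<in>J. h j * l j)"

definition dirs :: "'j set \<Rightarrow> 'a set" where
  "dirs S = {p j - p j' | j j'. j \<in> S \<and> j' \<in> S \<and> lab j = lab j'}"

definition full :: "'j set \<Rightarrow> bool" where
  "full S \<longleftrightarrow> S \<subseteq> J \<and> (\<forall>i<r. \<exists>j\<in>S. lab j = i)"

definition spanning :: "'j set \<Rightarrow> bool" where
  "spanning S \<longleftrightarrow> full S \<and> indep S \<and> span (dirs S) = UNIV"

text \<open>The direction of the simplex method in which the weight of q enters at rate 1 and only
  weights in S adjust; \<open>cost h (red S q)\<close> is the reduced cost of q. It involves neither
  c nor x.\<close>

definition red :: "'j set \<Rightarrow> 'j \<Rightarrow> 'j \<Rightarrow> real" where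
  "red S q = (SOME m. ker m \<and> m q = 1 \<and> supp m \<subseteq> insert q S)"

definition generic :: "('j \<Rightarrow> real) \<Rightarrow> bool" where
  "generic h \<longleftrightarrow> (\<forall>S q. spanning S \<longrightarrow> q \<in> J - S \<longrightarrow> cost h (red S q) \<noteq> 0)"

text \<open>The optimality test for the basis S by reduced costs. Since it mentions neither c nor x,
  one collection of sets S serves all Minkowski combinations.\<close>

definition good :: "('j \<Rightarrow> real) \<Rightarrow> 'j set \<Rightarrow> bool" where
  "good h S \<longleftrightarrow> spanning S \<and> (\<forall>q\<in>J - S. 0 < cost h (red S q))"

definition cell :: "(nat \<Rightarrow> real) \<Rightarrow> 'j set \<Rightarrow> 'a set" where
  "cell c S = {x. \<exists>l. feas c x l \<and> supp l = S}"

section \<open>Linear programming with a generic cost vector\<close>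

lemma class_sum_add: "class_sum (\<lambda>j. l j + t * m j) i = class_sum l i + t * class_sum m i"
  unfolding class_sum_def sum_distrib_left sum.distrib[symmetric] by (intro sum.cong) auto

lemma comb_add: "comb (\<lambda>j. l j + t * m j) = comb l + t *\<^sub>R comb m"
  by (simp add: comb_def scaleR_add_left sum.distrib scaleR_sum_right)

lemma cost_add: "cost h (\<lambda>j. l j + t * m j) = cost h l + t * cost h m"
  by (simp add: cost_def algebra_simps sum.distrib sum_distrib_left)

lemma supp_add: "supp l \<subseteq> S \<Longrightarrow> supp m \<subseteq> S \<Longrightarrow> supp (\<lambda>j. l j + t * m j) \<subseteq> S"
  by (auto simp: supp_def) force

lemma feas_add: "feas c x l \<Longrightarrow> ker m \<Longrightarrow> (\<And>j. 0 \<le> l j + t * m j) \<Longrightarrow> feas c x (\<lambda>j. l j + t * m j)"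
  by (auto simp: feas_def ker_def class_sum_add comb_add dest: supp_add[THEN subsetD])

lemma ker_add: "ker l \<Longrightarrow> ker m \<Longrightarrow> ker (\<lambda>j. l j + t * m j)"
  by (auto simp: ker_def class_sum_add comb_add dest: supp_add[THEN subsetD])

lemma feas_diff: "feas c x l \<Longrightarrow> feas c x l' \<Longrightarrow> ker (\<lambda>j. l j + (-1) * l' j)"
  using supp_add[of l J l' "-1"]
  by (simp only: feas_def ker_def class_sum_add comb_add) simp

lemma class_sum_zero [simp]: "class_sum (\<lambda>_. 0) i = 0"
  by (simp add: class_sum_def)

lemma comb_zero [simp]: "comb (\<lambda>_. 0) = 0"
  by (simp add: comb_def)

lemma ker_zero: "ker (\<lambda>_. 0)"
  by (simp add: ker_def supp_def)

lemma ker_scale: "ker m \<Longrightarrow> ker (\<lambda>j. t * m j)"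
  using ker_add[OF ker_zero, of m t] by simp

lemma ker_sum: "(\<And>q. q \<in> Q \<Longrightarrow> ker (f q)) \<Longrightarrow> ker (\<lambda>j. \<Sum>q\<in>Q. f q j)"
proof (induction Q rule: infinite_finite_induct)
  case (insert x F)
  then show ?case using ker_add[of "\<lambda>j. \<Sum>q\<in>F. f q j" "f x" 1] by (simp add: add.commute)
qed (auto simp: ker_zero)

lemma cost_sum: "cost h (\<lambda>j. \<Sum>q\<in>Q. f q j) = (\<Sum>q\<in>Q. cost h (f q))"
  unfolding cost_def sum_distrib_left by (rule sum.swap)

lemma cost_scale: "cost h (\<lambda>j. t * m j) = t * cost h m"
  by (simp add: cost_def sum_distrib_left mult.left_commute)

lemma finite_supp: "supp l \<subseteq> J \<Longrightarrow> finite (supp l)"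
  using finJ finite_subset by blast

text \<open>Moving along a kernel vector of cost at most 0 until some weight vanishes shrinks the
  support, so induction on its size ends at an independent one.\<close>

lemma basic_reduction:
  "feas c x l \<Longrightarrow> \<exists>l'. feas c x l' \<and> indep (supp l') \<and> cost h l' \<le> cost h l"
proof (induction "card (supp l)" arbitrary: l rule: less_induct)
  case less
  show ?case
  proof (cases "indep (supp l)")
    case False
    then obtain m0 where m0: "ker m0" "supp m0 \<subseteq> supp l" "m0 \<noteq> (\<lambda>_. 0)"
      by (auto simp: indep_def)
    define m where "m = (if cost h m0 \<le> 0 then m0 else (\<lambda>j. (-1) * m0 j))"
    have m: "ker m" "supp m \<subseteq> supp l" "m \<noteq> (\<lambda>_. 0)" "cost h m \<le> 0"
      using m0 ker_scale[OF m0(1), of "-1"] cost_scale[of h "-1" m0]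
      by (auto simp: m_def fun_eq_iff supp_def)
    obtain j0 where j0: "m j0 \<noteq> 0" using m(3) by auto
    have j0J: "j0 \<in> J" using j0 m(1) by (auto simp: ker_def supp_def)
    \<comment> \<open>The class sums of m vanish, so the class of j0, where m is nonzero, contains a
      negative entry; hence the motion does reach the boundary.\<close>
    have "\<exists>j\<in>J. m j < 0"
    proof (rule ccontr)
      assume "\<not> ?thesis"
      then have nn: "0 \<le> m j" if "j \<in> J" for j using that by force
      have "class_sum m (lab j0) = 0" using m(1) lab_less[OF j0J] by (simp add: ker_def)
      then have "(if lab j0 = lab j0 then m j0 else 0) = 0"
        unfolding class_sum_def using nn j0J finJ
        by (subst (asm) sum_nonneg_eq_0_iff) auto
      with j0 show False by simp
    qed
    define N where "N = {j \<in> J. m j < 0}"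
    have N: "finite N" "N \<noteq> {}" using \<open>\<exists>j\<in>J. m j < 0\<close> finJ by (auto simp: N_def)
    \<comment> \<open>Ratio test: the largest step that keeps all weights nonnegative. It is
      attained at j1, whose weight becomes 0.\<close>
    define t where "t = Min ((\<lambda>j. l j / - m j) ` N)"
    have l0: "0 \<le> l j" for j using less.prems by (simp add: feas_def)
    have t_le: "t \<le> l j / - m j" if "j \<in> N" for j
      unfolding t_def using N that by simp
    have "t \<in> (\<lambda>j. l j / - m j) ` N"
      unfolding t_def using N by (intro Min_in) auto
    then obtain j1 where j1: "j1 \<in> N" "t = l j1 / - m j1" by blast
    have t0: "0 \<le> t" unfolding j1(2) using l0 j1(1) by (auto simp: N_def divide_nonneg_neg)
    let ?l = "\<lambda>j. l j + t * m j"
    have "0 \<le> ?l j" for j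
    proof (cases "m j < 0")
      case True
      then have "j \<in> N" using m(1) by (auto simp: N_def ker_def supp_def)
      from t_le[OF this] True have "t * (- m j) \<le> l j" by (simp add: pos_le_divide_eq del: divide_minus_right)
      then show ?thesis by simp
    next
      case False
      then show ?thesis using l0[of j] t0 by simp
    qed
    then have f: "feas c x ?l" using less.prems m(1) by (intro feas_add)
    have "supp ?l \<subseteq> supp l" using m(2) by (intro supp_add) auto
    moreover have "j1 \<in> supp l" using j1(1) by (intro subsetD[OF m(2)]) (simp add: supp_def N_def)
    moreover have "j1 \<notin> supp ?l" using j1 by (simp add: supp_def N_def)
    ultimately have "supp ?l \<subset> supp l" by blast
    moreover have "finite (supp l)" using less.prems by (auto simp: feas_def finite_supp)
    ultimately have "card (supp ?l) < card (supp l)" by (rule psubset_card_mono[rotated])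
    from less.hyps[OF this f] obtain l' where
      "feas c x l'" "indep (supp l')" "cost h l' \<le> cost h ?l" by blast
    moreover have "cost h ?l \<le> cost h l"
      using m(4) t0 by (simp add: cost_add mult_nonneg_nonpos)
    ultimately show ?thesis by (meson order_trans)
  qed (use less.prems in blast)
qed

text \<open>A basic point is determined by its support, so only finitely many compete and a minimum
  exists; \<open>basic_reduction\<close> makes it a minimum over all feasible points.\<close>

lemma min_basic:
  assumes "feas c x l"
  obtains l' where "feas c x l'" "indep (supp l')" "\<And>l''. feas c x l'' \<Longrightarrow> cost h l' \<le> cost h l''"
proof -
  let ?B = "{l'. feas c x l' \<and> indep (supp l')}"
  have "inj_on supp ?B"
  proof (rule inj_onI)
    fix l1 l2 assume l: "l1 \<in> ?B" "l2 \<in> ?B" "supp l1 = supp l2"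
    have "ker (\<lambda>j. l1 j + (-1) * l2 j)" using l by (intro feas_diff) auto
    moreover have "supp (\<lambda>j. l1 j + (-1) * l2 j) \<subseteq> supp l1" using l(3) by (intro supp_add) auto
    ultimately have "(\<lambda>j. l1 j + (-1) * l2 j) = (\<lambda>_. 0)" using l(1) unfolding indep_def by blast
    then show "l1 = l2" by (simp add: fun_eq_iff)
  qed
  moreover have "supp ` ?B \<subseteq> Pow J" by (auto simp: feas_def)
  ultimately have fin: "finite ?B"
    using finJ by (meson finite_Pow_iff finite_imageD finite_subset)
  have "?B \<noteq> {}" using basic_reduction[OF assms] by blast
  with fin obtain l' where l': "l' \<in> ?B" "\<And>l''. l'' \<in> ?B \<Longrightarrow> cost h l' \<le> cost h l''"
    using ex_min_if_finite[of "cost h ` ?B"]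
    by (metis (no_types, lifting) arg_min_if_finite(1) arg_min_least)
  show thesis
  proof
    show "feas c x l'" "indep (supp l')" using l'(1) by auto
    fix l'' assume "feas c x l''"
    from basic_reduction[OF this, of h] l'(2) show "cost h l' \<le> cost h l''"
      by (metis (mono_tags, lifting) mem_Collect_eq order_trans)
  qed
qed

text \<open>The vectors \<open>comb m\<close> for weights m on S with all class sums 0 form a
  subspace W that contains \<open>dirs S\<close>, hence is everything. Representing p q - p j0 in W,
  for some j0 of S with the label of q, gives weights on S that compensate a unit of weight at
  q.\<close>

lemma spanning_red:
  assumes S: "spanning S" and q: "q \<in> J - S"
  shows "ker (red S q)" "red S q q = 1" "supp (red S q) \<subseteq> insert q S"
proof -
  have SJ: "S \<subseteq> J" using S by (simp add: spanning_def full_def)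
  obtain j0 where j0: "j0 \<in> S" "lab j0 = lab q"
  proof -
    have "lab q < r" using q lab_less by blast
    then show ?thesis using S that unfolding spanning_def full_def by blast
  qed
  define W where "W = {y. \<exists>m. supp m \<subseteq> S \<and> comb m = y \<and> (\<forall>i<r. class_sum m i = 0)}"
  have unit: "comb (\<lambda>j. if j = k then 1 else 0) = p k"
    "class_sum (\<lambda>j. if j = k then 1 else 0) i = (if lab k = i then 1 else 0)" if "k \<in> J" for k i
  proof -
    have "comb (\<lambda>j. if j = k then 1 else 0) = (\<Sum>j\<in>J. if j = k then p k else 0)"
      unfolding comb_def by (intro sum.cong) auto
    then show "comb (\<lambda>j. if j = k then 1 else 0) = p k" using that finJ by simp
    have "class_sum (\<lambda>j. if j = k then 1 else 0) i = (\<Sum>j\<in>J. if j = k then (if lab k = i then 1 else 0) else 0)"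
      unfolding class_sum_def by (intro sum.cong) auto
    then show "class_sum (\<lambda>j. if j = k then 1 else 0) i = (if lab k = i then 1 else 0)"
      using that finJ by simp
  qed
  have subW: "subspace W"
  proof (rule subspaceI)
    show "0 \<in> W" by (auto simp: W_def supp_def intro!: exI[of _ "\<lambda>_. 0"])
  next
    fix x y assume "x \<in> W" "y \<in> W"
    then obtain m n where "supp m \<subseteq> S" "comb m = x" "\<forall>i<r. class_sum m i = 0"
      "supp n \<subseteq> S" "comb n = y" "\<forall>i<r. class_sum n i = 0" by (auto simp: W_def)
    then show "x + y \<in> W"
      unfolding W_def using supp_add[of m S n 1] comb_add[of m 1 n] class_sum_add[of m 1 n]
      by (intro CollectI exI[of _ "\<lambda>j. m j + 1 * n j"]) simp
  next
    fix x :: 'a and t assume "x \<in> W"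
    then obtain m where "supp m \<subseteq> S" "comb m = x" "\<forall>i<r. class_sum m i = 0" by (auto simp: W_def)
    then show "t *\<^sub>R x \<in> W"
      unfolding W_def using comb_add[of "\<lambda>_. 0" t m] class_sum_add[of "\<lambda>_. 0" t m]
      by (intro CollectI exI[of _ "\<lambda>j. t * m j"]) (auto simp: supp_def)
  qed
  have "dirs S \<subseteq> W"
  proof
    fix y assume "y \<in> dirs S"
    then obtain j k where jk: "j \<in> S" "k \<in> S" "lab j = lab k" "y = p j - p k" by (auto simp: dirs_def)
    let ?m = "\<lambda>i. (if i = j then 1 else 0) + (-1) * (if i = k then 1 else 0)"
    have "supp ?m \<subseteq> S" using jk by (auto simp: supp_def split: if_splits)
    moreover have "j \<in> J" "k \<in> J" using jk SJ by auto
    then have "comb ?m = y" "class_sum ?m i = 0" for i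
      unfolding comb_add class_sum_add unit[OF \<open>j \<in> J\<close>] unit[OF \<open>k \<in> J\<close>] using jk(3,4) by simp_all
    ultimately show "y \<in> W" unfolding W_def by blast
  qed
  then have "p q - p j0 \<in> W" using span_minimal[OF _ subW] S unfolding spanning_def by blast
  then obtain n where n: "supp n \<subseteq> S" "comb n = p q - p j0" "\<forall>i<r. class_sum n i = 0"
    by (auto simp: W_def)
  let ?m = "\<lambda>i. (if i = q then 1 else 0) + (-1) * ((if i = j0 then 1 else 0) + 1 * n i)"
  have "supp ?m \<subseteq> insert q S" using n(1) j0(1) by (auto simp: supp_def split: if_splits)
  moreover have qJ: "q \<in> J" "j0 \<in> J" using q j0 SJ by auto
  have "comb ?m = 0" "\<forall>i<r. class_sum ?m i = 0"
    unfolding comb_add class_sum_add unit[OF qJ(1)] unit[OF qJ(2)] using j0(2) n(2,3) by simp_all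
  moreover have "?m q = 1" using q j0 n(1) by (auto simp: supp_def)
  ultimately have "ker ?m \<and> ?m q = 1 \<and> supp ?m \<subseteq> insert q S"
    using q SJ unfolding ker_def by blast
  then have "\<exists>m. ker m \<and> m q = 1 \<and> supp m \<subseteq> insert q S" by blast
  then have "ker (red S q) \<and> red S q q = 1 \<and> supp (red S q) \<subseteq> insert q S"
    unfolding red_def by (rule someI_ex)
  then show "ker (red S q)" "red S q q = 1" "supp (red S q) \<subseteq> insert q S" by auto
qed

lemma generic_exists: obtains h where "generic h"
proof -
  let ?M = "(\<lambda>(S, q). red S q) ` {(S, q). spanning S \<and> q \<in> J - S}"
  have "{(S, q). spanning S \<and> q \<in> J - S} \<subseteq> Pow J \<times> J"
    by (auto simp: spanning_def full_def)
  then have "finite ?M" using finJ by (meson finite_Pow_iff finite_SigmaI finite_imageI finite_subset)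
  moreover have "\<exists>j\<in>J. m j \<noteq> 0" if "m \<in> ?M" for m
  proof -
    obtain S q where "spanning S" "q \<in> J - S" "m = red S q" using \<open>m \<in> ?M\<close> by auto
    then show ?thesis using spanning_red(2) by (intro bexI[of _ q]) auto
  qed
  ultimately obtain h where h: "\<And>m. m \<in> ?M \<Longrightarrow> (\<Sum>j\<in>J. h j * m j) \<noteq> 0"
    using generic_functional[OF finJ, of ?M] by blast
  have "generic h"
    unfolding generic_def cost_def
  proof (intro allI impI)
    fix S q assume "spanning S" "q \<in> J - S"
    then have "red S q \<in> ?M" by (auto intro!: rev_image_eqI[of "(S, q)"])
    then show "(\<Sum>j\<in>J. h j * red S q j) \<noteq> 0" by (rule h)
  qed
  then show thesis by (rule that)
qed

text \<open>The difference l' - l equals the sum of l' q times \<open>red S q\<close> over q outside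
  S. The cost difference is therefore a nonnegative combination of positive reduced costs, and it is
  0 only if l' vanishes outside S.\<close>

lemma good_optimal:
  assumes S: "good h S" and l: "feas c x l" "supp l \<subseteq> S" and l': "feas c x l'"
  shows "cost h l \<le> cost h l'" "cost h l' \<le> cost h l \<Longrightarrow> supp l' \<subseteq> S"
proof -
  have sp: "spanning S" and indS: "indep S" and pos: "\<And>q. q \<in> J - S \<Longrightarrow> 0 < cost h (red S q)"
    using S by (auto simp: good_def spanning_def)
  let ?d = "\<lambda>j. l' j + (-1) * l j"
  let ?e = "\<lambda>j. \<Sum>q\<in>J - S. l' q * red S q j"
  let ?f = "\<lambda>j. ?d j + (-1) * ?e j"
  have kd: "ker ?d" by (rule feas_diff[OF l' l(1)])
  have ke: "ker ?e" by (intro ker_sum ker_scale spanning_red[OF sp])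
  have kf: "ker ?f" by (rule ker_add[OF kd ke])
  have lS: "l j = 0" if "j \<notin> S" for j using l(2) that by (auto simp: supp_def)
  have "?f j = 0" if j: "j \<notin> S" for j
  proof (cases "j \<in> J")
    case True
    have "?e j = (\<Sum>q\<in>J - S. if q = j then l' j else 0)"
    proof (intro sum.cong refl)
      fix q assume q: "q \<in> J - S"
      show "l' q * red S q j = (if q = j then l' j else 0)"
        using spanning_red(2,3)[OF sp q] j by (auto simp: supp_def)
    qed
    also have "\<dots> = l' j" using True j finJ by simp
    finally show ?thesis using lS[OF j] by simp
  next
    case False
    then show ?thesis using kf by (auto simp: ker_def supp_def)
  qed
  then have "supp ?f \<subseteq> S" by (auto simp: supp_def)
  \<comment> \<open>The claimed identity for l' - l: the difference of its two sides is a kernel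
    vector supported in the independent set S.\<close>
  with kf indS have "?f = (\<lambda>_. 0)" unfolding indep_def by blast
  then have "?d = ?e" by (simp add: fun_eq_iff)
  then have "cost h ?d = (\<Sum>q\<in>J - S. l' q * cost h (red S q))"
    by (simp only: cost_sum cost_scale)
  then have eq: "cost h l' - cost h l = (\<Sum>q\<in>J - S. l' q * cost h (red S q))"
    unfolding cost_add by simp
  have l'0: "0 \<le> l' q" for q using l' by (simp add: feas_def)
  have nn: "0 \<le> l' q * cost h (red S q)" if "q \<in> J - S" for q
    using l'0[of q] pos[OF that] by simp
  have nonneg: "0 \<le> (\<Sum>q\<in>J - S. l' q * cost h (red S q))" by (rule sum_nonneg) (rule nn)
  show "cost h l \<le> cost h l'" using eq nonneg by linarith
  assume "cost h l' \<le> cost h l"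
  then have "(\<Sum>q\<in>J - S. l' q * cost h (red S q)) = 0"
    using eq nonneg by linarith
  then have "l' q * cost h (red S q) = 0" if "q \<in> J - S" for q
    using nn that finJ by (subst (asm) sum_nonneg_eq_0_iff) auto
  then have "l' q = 0" if "q \<in> J - S" for q using pos that by fastforce
  then show "supp l' \<subseteq> S" using l' by (auto simp: feas_def supp_def)
qed

text \<open>The weights witnessing the two memberships are both optimal, so each support is
  contained in the other good set.\<close>

lemma cell_disjoint:
  assumes S: "good h S" "good h S'" and x: "x \<in> cell c S" "x \<in> cell c S'"
  shows "S = S'"
proof -
  obtain l l' where l: "feas c x l" "supp l = S" and l': "feas c x l'" "supp l' = S'"
    using x by (auto simp: cell_def)
  have "cost h l \<le> cost h l'" "cost h l' \<le> cost h l"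
    using good_optimal(1)[OF S(1) l(1) _ l'(1)] good_optimal(1)[OF S(2) l'(1) _ l(1)] l(2) l'(2)
    by simp_all
  then show ?thesis using good_optimal(2)[OF S(1) l(1) _ l'(1)] good_optimal(2)[OF S(2) l'(1) _ l(1)] l l'
    by blast
qed

text \<open>The cell is that of an optimal basic point. If its support spans, a reduced cost that is
  not positive is negative by genericity, and a short move along \<open>red\<close> would lower the
  cost. Positivity of c makes every label occur in the support.\<close>

lemma cell_cover:
  assumes h: "generic h" and l: "feas c x l" and c: "\<And>i. i < r \<Longrightarrow> 0 < c i"
  obtains S where "full S" "x \<in> cell c S" "good h S \<or> span (dirs S) \<noteq> UNIV"
proof -
  obtain l' where l': "feas c x l'" "indep (supp l')" "\<And>l''. feas c x l'' \<Longrightarrow> cost h l' \<le> cost h l''"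
    using min_basic[OF l] by blast
  let ?S = "supp l'"
  have "\<exists>j\<in>?S. lab j = i" if "i < r" for i
  proof (rule ccontr)
    assume "\<not> ?thesis"
    then have "class_sum l' i = 0" unfolding class_sum_def by (intro sum.neutral) (auto simp: supp_def)
    then show False using l'(1) that c[OF that] by (simp add: feas_def)
  qed
  then have full: "full ?S" using l'(1) by (auto simp: full_def feas_def)
  moreover have "x \<in> cell c ?S" using l'(1) by (auto simp: cell_def)
  moreover have "good h ?S" if sp: "span (dirs ?S) = UNIV"
  proof -
    have S: "spanning ?S" using full l'(2) sp by (simp add: spanning_def)
    have "0 < cost h (red ?S q)" if q: "q \<in> J - ?S" for q
    proof (rule ccontr)
      let ?m = "red ?S q"
      note m = spanning_red[OF S q]
      assume "\<not> 0 < cost h ?m"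
      then have neg: "cost h ?m < 0" using h S q unfolding generic_def by force
      have l0: "0 \<le> l' j" for j using l'(1) by (simp add: feas_def)
      \<comment> \<open>Where l' vanishes the direction vanishes too, except at q, where it is 1;
        elsewhere l' is positive and absorbs a small step.\<close>
      have "\<forall>\<^sub>F t in at_right (0::real). \<forall>j\<in>J. 0 \<le> l' j + t * ?m j"
      proof (intro eventually_ball_finite finJ ballI)
        fix j assume j: "j \<in> J"
        show "\<forall>\<^sub>F t in at_right (0::real). 0 \<le> l' j + t * ?m j"
        proof (cases "l' j = 0")
          case True
          have "0 \<le> ?m j"
          proof (cases "j = q")
            case False
            with True have "j \<notin> insert q (supp l')" by (simp add: supp_def)
            then have "j \<notin> supp ?m" using m(3) by blast
            then show ?thesis by (simp add: supp_def)
          qed (use m(2) in simp)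
          then show ?thesis
            using eventually_at_right_less[of "0::real"] True by (auto elim!: eventually_mono)
        next
          case False
          have "((\<lambda>t. l' j + t * ?m j) \<longlongrightarrow> l' j + 0 * ?m j) (at_right 0)"
            by (intro tendsto_intros)
          then have "\<forall>\<^sub>F t in at_right 0. 0 < l' j + t * ?m j"
            using False l0[of j] by (intro order_tendstoD(1)) auto
          then show ?thesis by eventually_elim simp
        qed
      qed
      then have "\<forall>\<^sub>F t in at_right (0::real). 0 < t \<and> (\<forall>j\<in>J. 0 \<le> l' j + t * ?m j)"
        using eventually_at_right_less[of "0::real"] by eventually_elim simp
      then obtain t where t: "0 < t" "\<And>j. j \<in> J \<Longrightarrow> 0 \<le> l' j + t * ?m j"
        using eventually_happens trivial_limit_at_right_real by blast
      have "0 \<le> l' j + t * ?m j" for j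
      proof (cases "j \<in> J")
        case False
        then have "?m j = 0" using m(1) unfolding ker_def supp_def by blast
        with l0[of j] show ?thesis by simp
      qed (rule t(2))
      then have "feas c x (\<lambda>j. l' j + t * ?m j)" using l'(1) m(1) by (intro feas_add)
      from l'(3)[OF this] have "0 \<le> t * cost h ?m" by (simp add: cost_add)
      with t(1) neg show False by (simp add: zero_le_mult_iff)
    qed
    with S show ?thesis by (simp add: good_def)
  qed
  ultimately show thesis using that by blast
qed

text \<open>The cell lies in a translate of a proper subspace: subtracting, for every label i, c i
  times a fixed representative leaves only multiples of differences of points with equal
  labels.\<close>

lemma cell_negligible:
  assumes S: "full S" and sp: "span (dirs S) \<noteq> UNIV"
  shows "negligible (cell c S)"
proof -
  obtain rep where rep: "\<And>i. i < r \<Longrightarrow> rep i \<in> S" "\<And>i. i < r \<Longrightarrow> lab (rep i) = i"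
    using S unfolding full_def by metis
  have SJ: "S \<subseteq> J" using S by (simp add: full_def)
  let ?o = "\<Sum>i<r. c i *\<^sub>R p (rep i)"
  have "cell c S \<subseteq> (+) ?o ` span (dirs S)"
  proof
    fix x assume "x \<in> cell c S"
    then obtain l where l: "feas c x l" "supp l = S" by (auto simp: cell_def)
    have "?o = (\<Sum>i<r. \<Sum>j\<in>J. if lab j = i then l j *\<^sub>R p (rep (lab j)) else 0)"
    proof (intro sum.cong refl)
      fix i assume i: "i \<in> {..<r}"
      have "c i *\<^sub>R p (rep i) = class_sum l i *\<^sub>R p (rep i)" using l i by (simp add: feas_def)
      also have "\<dots> = (\<Sum>j\<in>J. if lab j = i then l j *\<^sub>R p (rep (lab j)) else 0)"
        unfolding class_sum_def scaleR_sum_left by (intro sum.cong) auto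
      finally show "c i *\<^sub>R p (rep i) = \<dots>" .
    qed
    also have "\<dots> = (\<Sum>j\<in>J. \<Sum>i<r. if lab j = i then l j *\<^sub>R p (rep (lab j)) else 0)"
      by (rule sum.swap)
    also have "\<dots> = (\<Sum>j\<in>J. l j *\<^sub>R p (rep (lab j)))"
      using lab_less by (intro sum.cong) auto
    finally have o: "?o = (\<Sum>j\<in>J. l j *\<^sub>R p (rep (lab j)))" .
    have "x = comb l" using l by (simp add: feas_def)
    then have "x - ?o = (\<Sum>j\<in>J. l j *\<^sub>R (p j - p (rep (lab j))))"
      unfolding o comb_def by (simp add: sum_subtractf scaleR_diff_right)
    also have "\<dots> \<in> span (dirs S)"
    proof (intro span_sum)
      fix j assume j: "j \<in> J"
      show "l j *\<^sub>R (p j - p (rep (lab j))) \<in> span (dirs S)"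
      proof (cases "j \<in> S")
        case True
        then have "p j - p (rep (lab j)) \<in> dirs S"
          using rep[OF lab_less[OF j]] unfolding dirs_def by fastforce
        then show ?thesis by (intro span_scale span_base)
      next
        case False
        then show ?thesis using l(2) by (auto simp: supp_def span_zero)
      qed
    qed
    finally show "x \<in> (+) ?o ` span (dirs S)"
      by (intro image_eqI[of _ _ "x - ?o"]) auto
  qed
  moreover have "dim (span (dirs S)) < DIM('a)"
    using sp dim_subset_UNIV[of "dirs S"] dim_eq_full[of "dirs S"] by simp
  then have "negligible (span (dirs S))" by (rule negligible_lowdim)
  then have "negligible ((+) ?o ` span (dirs S))" by (rule negligible_translation)
  ultimately show ?thesis by (rule negligible_subset[rotated])
qed

end

section \<open>From cells to the volume of a Minkowski sum of polytopes\<close>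

lemma borel_translation:
  fixes X :: "'a::euclidean_space set"
  assumes "X \<in> sets borel"
  shows "(+) a ` X \<in> sets borel" "vol ((+) a ` X) = vol X"
proof -
  have "(+) a ` X = (\<lambda>x. x - a) -` X \<inter> space borel"
    by (auto simp: image_iff) (metis add.commute diff_add_cancel)
  also have "\<dots> \<in> sets borel" by (rule measurable_sets[OF _ assms]) measurable
  finally show *: "(+) a ` X \<in> sets borel" .
  show "vol ((+) a ` X) = vol X"
    using measure_translation[of a X] * assms by simp
qed

context labelled_points
begin

text \<open>Once one representative per label is removed, the remaining indices T give vectors d j
  that form a basis of the space. In these coordinates the cell is a product of open simplices, of
  size c i for the label i, so its volume is a constant times the product of c over the labels of
  T.\<close>

lemma cell_volume:
  assumes S: "spanning S"
  obtains C g where "\<And>b. b \<in> Basis \<Longrightarrow> g b < r"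
    "\<And>c. (\<And>i. i < r \<Longrightarrow> 0 < c i) \<Longrightarrow>
       cell c S \<in> sets borel \<and> vol (cell c S) = C * (\<Prod>b\<in>(Basis::'a set). c (g b))"
proof -
  have full: "full S" and indS: "indep S" and spanS: "span (dirs S) = UNIV"
    using S by (auto simp: spanning_def)
  have SJ: "S \<subseteq> J" using full by (simp add: full_def)
  then have finS: "finite S" using finJ finite_subset by blast
  obtain rep where rep: "\<And>i. i < r \<Longrightarrow> rep i \<in> S" "\<And>i. i < r \<Longrightarrow> lab (rep i) = i"
    using full unfolding full_def by metis
  define R where "R = rep ` {..<r}"
  define T where "T = S - R"
  define d where "d j = p j - p (rep (lab j))" for j
  have TJ: "T \<subseteq> J" "finite T" using SJ finS by (auto simp: T_def)
  have inj_rep: "inj_on rep {..<r}" by (rule inj_on_inverseI[of _ lab]) (simp add: rep)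
  have repR: "rep i \<in> R" "rep i \<notin> T" if "i < r" for i using that by (auto simp: R_def T_def)
  have R: "i = rep (lab i)" "lab i < r" if "i \<in> R" for i using that rep by (auto simp: R_def)
  have split: "(\<Sum>j\<in>J. F j) = (\<Sum>j\<in>T. F j) + (\<Sum>i<r. F (rep i))"
    if "\<And>j. j \<notin> S \<Longrightarrow> F j = 0" for F :: "'j \<Rightarrow> 'b::real_vector"
  proof -
    have "(\<Sum>j\<in>J. F j) = (\<Sum>j\<in>S. F j)"
      using SJ finJ that by (intro sum.mono_neutral_right) auto
    also have "S = T \<union> R" using rep by (auto simp: T_def R_def)
    also have "(\<Sum>j\<in>T \<union> R. F j) = (\<Sum>j\<in>T. F j) + (\<Sum>j\<in>R. F j)"
      by (intro sum.union_disjoint) (auto simp: TJ, auto simp: R_def T_def)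
    also have "(\<Sum>j\<in>R. F j) = (\<Sum>i<r. F (rep i))"
      unfolding R_def by (simp add: sum.reindex[OF inj_rep])
    finally show ?thesis .
  qed
  define ts where "ts l i = (\<Sum>k\<in>T. if lab k = i then l k else 0)" for l :: "'j \<Rightarrow> real" and i
  \<comment> \<open>Weights on T extend uniquely to weights on S with class sums c: the
    representative of a label takes what the other weights of its class leave.\<close>
  define ext where "ext c l j = (if j \<in> T then l j else if j \<in> R then c (lab j) - ts l (lab j) else 0)"
    for c l j
  define o' where "o' c = (\<Sum>i<r. c i *\<^sub>R p (rep i))" for c
  have ext_supp: "supp (ext c l) \<subseteq> S" for c l
    using rep by (auto simp: supp_def ext_def T_def R_def split: if_splits)
  have ext0: "ext c l j = 0" if "j \<notin> S" for c l j using that ext_supp by (auto simp: supp_def)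
  have ext_rep: "ext c l (rep i) = c i - ts l i" if "i < r" for c l i
    using repR[OF that] rep(2)[OF that] by (simp add: ext_def)
  have ext_class: "class_sum (ext c l) i = c i" if i: "i < r" for c l i
  proof -
    have "class_sum (ext c l) i = (\<Sum>j\<in>T. if lab j = i then ext c l j else 0)
      + (\<Sum>k<r. if lab (rep k) = i then ext c l (rep k) else 0)"
      unfolding class_sum_def by (rule split) (simp add: ext0)
    also have "(\<Sum>j\<in>T. if lab j = i then ext c l j else 0) = ts l i"
      unfolding ts_def by (intro sum.cong) (auto simp: ext_def)
    also have "(\<Sum>k<r. if lab (rep k) = i then ext c l (rep k) else 0) = (\<Sum>k<r. if k = i then c i - ts l i else 0)"
      by (intro sum.cong) (auto simp: ext_rep rep)
    also have "\<dots> = c i - ts l i" using i by simp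
    finally show ?thesis by simp
  qed
  have ext_comb: "comb (ext c l) = o' c + (\<Sum>j\<in>T. l j *\<^sub>R d j)" for c l
  proof -
    have "comb (ext c l) = (\<Sum>j\<in>T. ext c l j *\<^sub>R p j) + (\<Sum>i<r. ext c l (rep i) *\<^sub>R p (rep i))"
      unfolding comb_def by (rule split) (simp add: ext0)
    also have "(\<Sum>j\<in>T. ext c l j *\<^sub>R p j) = (\<Sum>j\<in>T. l j *\<^sub>R p j)"
      by (intro sum.cong) (auto simp: ext_def)
    also have "(\<Sum>i<r. ext c l (rep i) *\<^sub>R p (rep i)) = o' c - (\<Sum>i<r. ts l i *\<^sub>R p (rep i))"
      by (simp add: ext_rep o'_def sum_subtractf[symmetric] scaleR_diff_left)
    also have "(\<Sum>i<r. ts l i *\<^sub>R p (rep i))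
      = (\<Sum>i<r. \<Sum>k\<in>T. if lab k = i then l k *\<^sub>R p (rep i) else 0)"
      unfolding ts_def scaleR_sum_left by (intro sum.cong) auto
    also have "\<dots> = (\<Sum>k\<in>T. \<Sum>i<r. if lab k = i then l k *\<^sub>R p (rep i) else 0)" by (rule sum.swap)
    also have "\<dots> = (\<Sum>k\<in>T. l k *\<^sub>R p (rep (lab k)))"
      using lab_less TJ by (intro sum.cong) auto
    finally show ?thesis by (simp add: d_def scaleR_diff_right sum_subtractf)
  qed
  have ext_unique: "f = ext c f" if f: "supp f \<subseteq> S" "\<And>i. i < r \<Longrightarrow> class_sum f i = c i" for c f
  proof
    fix j
    have f0: "f j = 0" if "j \<notin> S" for j using f(1) that by (auto simp: supp_def)
    consider "j \<in> T" | "j \<in> R" "j \<notin> T" | "j \<notin> S" by (auto simp: T_def)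
    then show "f j = ext c f j"
    proof cases
      case 2
      let ?i = "lab j"
      have "class_sum f ?i = (\<Sum>j\<in>T. if lab j = ?i then f j else 0)
        + (\<Sum>k<r. if lab (rep k) = ?i then f (rep k) else 0)"
        unfolding class_sum_def by (rule split) (simp add: f0)
      also have "(\<Sum>k<r. if lab (rep k) = ?i then f (rep k) else 0) = (\<Sum>k<r. if k = ?i then f j else 0)"
        using R(1)[OF 2(1)] by (intro sum.cong) (auto simp: rep)
      also have "\<dots> = f j" using R(2)[OF 2(1)] by simp
      finally show ?thesis using f(2)[OF R(2)[OF 2(1)]] 2 by (simp add: ext_def ts_def)
    next
      case 3
      show ?thesis unfolding f0[OF 3] ext0[OF 3] ..
    qed (simp add: ext_def)
  qed
  have indT: "l j = 0" if l: "(\<Sum>j\<in>T. l j *\<^sub>R d j) = 0" "j \<in> T" for l j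
  proof -
    have "ker (ext (\<lambda>_. 0) l)"
      using ext_supp[of "\<lambda>_. 0" l] SJ l(1) by (auto simp: ker_def ext_class ext_comb o'_def)
    with indS ext_supp have "ext (\<lambda>_. 0) l = (\<lambda>_. 0)" unfolding indep_def by blast
    then have "ext (\<lambda>_. 0) l j = 0" by simp
    with l(2) show ?thesis by (simp add: ext_def)
  qed
  have inj_d: "inj_on d T"
  proof (rule inj_onI, rule ccontr)
    fix j k assume jk: "j \<in> T" "k \<in> T" "d j = d k" "j \<noteq> k"
    let ?l = "\<lambda>i. (if i = j then 1 else 0) - (if i = k then 1 else 0) :: real"
    have "(\<Sum>i\<in>T. ?l i *\<^sub>R d i) = (\<Sum>i\<in>T. if i = j then d j else 0) - (\<Sum>i\<in>T. if i = k then d k else 0)"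
      unfolding sum_subtractf[symmetric] by (intro sum.cong) auto
    also have "\<dots> = 0" using jk TJ by simp
    finally have "?l j = 0" using jk(1) by (rule indT)
    with jk show False by simp
  qed
  have ind_d: "independent (d ` T)"
  proof (rule real_vector.independent_if_scalars_zero)
    show "finite (d ` T)" using TJ by simp
    fix f x assume f: "(\<Sum>x\<in>d ` T. f x *\<^sub>R x) = 0" and x: "x \<in> d ` T"
    have "(\<Sum>j\<in>T. f (d j) *\<^sub>R d j) = 0" using f by (simp add: sum.reindex[OF inj_d])
    then show "f x = 0" using indT[of "\<lambda>j. f (d j)"] x by auto
  qed
  have span_d: "span (d ` T) = UNIV"
  proof -
    have dS: "d j \<in> span (d ` T)" if "j \<in> S" for j
    proof (cases "j \<in> T")
      case False
      with that have "j \<in> R" by (simp add: T_def)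
      from R(1)[OF this] have "d j = 0" by (simp add: d_def)
      then show ?thesis by (simp add: span_zero)
    qed (simp add: span_base)
    have "dirs S \<subseteq> span (d ` T)"
    proof
      fix y assume "y \<in> dirs S"
      then obtain j k where jk: "j \<in> S" "k \<in> S" "lab j = lab k" "y = p j - p k" by (auto simp: dirs_def)
      then have "y = d j - d k" by (simp add: d_def)
      then show "y \<in> span (d ` T)" using span_diff[OF dS dS] jk by simp
    qed
    from span_minimal[OF this subspace_span] spanS show ?thesis by auto
  qed
  \<comment> \<open>A basis of the space has \<open>DIM('a)\<close> elements, so T can be indexed by
    \<open>Basis\<close>, which turns weights on T into coordinates of a vector.\<close>
  have "card T = card (d ` T)" using card_image[OF inj_d] by simp
  also have "\<dots> = dim (d ` T)" using dim_eq_card_independent[OF ind_d] by simp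
  also have "\<dots> = DIM('a)" using span_d dim_span[of "d ` T"] by simp
  finally have cardT: "card (Basis :: 'a set) = card T" by simp
  obtain b where b: "bij_betw b (Basis :: 'a set) T"
    using finite_same_card_bij[OF finite_Basis TJ(2) cardT] by blast
  define b' where "b' = inv_into Basis b"
  have bT: "b e \<in> T" if "e \<in> Basis" for e using b that by (auto simp: bij_betw_def)
  have b'b: "b' (b e) = e" if "e \<in> Basis" for e using b that by (simp add: b'_def bij_betw_def)
  have b'T: "b' j \<in> Basis" "b (b' j) = j" if "j \<in> T" for j
    using b that by (auto simp: b'_def bij_betw_def inv_into_into f_inv_into_f)
  define L where "L y = (\<Sum>e\<in>Basis. (y \<bullet> e) *\<^sub>R d (b e))" for y
  have linL: "linear L"
    unfolding L_def by (intro linear_compose_sum ballI linearI)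
      (auto simp: inner_left_distrib scaleR_left_distrib)
  have L_T: "L y = (\<Sum>j\<in>T. l j *\<^sub>R d j)" if "\<And>e. e \<in> Basis \<Longrightarrow> l (b e) = y \<bullet> e" for y l
  proof -
    have "L y = (\<Sum>e\<in>Basis. l (b e) *\<^sub>R d (b e))" unfolding L_def by (intro sum.cong) (auto simp: that)
    also have "\<dots> = (\<Sum>j\<in>T. l j *\<^sub>R d j)" by (rule sum.reindex_bij_betw[OF b])
    finally show ?thesis .
  qed
  have injL: "inj L"
  proof (subst linear_injective_0[OF linL], intro allI impI)
    fix y assume "L y = 0"
    then have *: "(\<Sum>j\<in>T. (y \<bullet> b' j) *\<^sub>R d j) = 0" using L_T[of "\<lambda>j. y \<bullet> b' j" y] b'b by simp
    have "y \<bullet> e = 0" if "e \<in> Basis" for e using indT[OF *, of "b e"] bT[OF that] b'b[OF that] by simp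
    then show "y = 0" by (simp add: euclidean_eq_iff[where 'a='a])
  qed
  \<comment> \<open>The product of simplices: the coordinates are positive, and their sum over each
    label stays below c i, so that the weight of the representative is positive too.\<close>
  define D where "D c = {y. (\<forall>e\<in>Basis. 0 < y \<bullet> e) \<and> (\<forall>i<r. (\<Sum>e\<in>Basis. if lab (b e) = i then y \<bullet> e else 0) < c i)}"
    for c
  have ts_b: "ts l i = (\<Sum>e\<in>Basis. if lab (b e) = i then l (b e) else 0)" for l i
    unfolding ts_def by (rule sum.reindex_bij_betw[OF b, symmetric])
  have cell_eq: "cell c S = (+) (o' c) ` L ` D c" for c
  proof
    show "cell c S \<subseteq> (+) (o' c) ` L ` D c"
    proof
      fix x assume "x \<in> cell c S"
      then obtain l where l: "feas c x l" "supp l = S" by (auto simp: cell_def)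
      have le: "l = ext c l" using l by (intro ext_unique) (auto simp: feas_def)
      let ?y = "\<Sum>e\<in>Basis. l (b e) *\<^sub>R e"
      have pos: "0 < l j" if "j \<in> S" for j
      proof -
        have "0 \<le> l j" using l(1) by (simp add: feas_def)
        moreover have "l j \<noteq> 0" using l(2) that unfolding supp_def by blast
        ultimately show ?thesis by simp
      qed
      have "?y \<in> D c"
        unfolding D_def
      proof (intro CollectI conjI ballI allI impI)
        fix e :: 'a assume "e \<in> Basis"
        then show "0 < ?y \<bullet> e" using pos[of "b e"] bT[of e] by (simp add: T_def)
      next
        fix i assume i: "i < r"
        have "0 < ext c l (rep i)" using pos[OF rep(1)[OF i]] le by metis
        then have "ts l i < c i" by (simp add: ext_rep[OF i])
        then show "(\<Sum>e\<in>Basis. if lab (b e) = i then ?y \<bullet> e else 0) < c i"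
          by (simp add: ts_b cong: if_cong sum.cong)
      qed
      moreover have "x = o' c + L ?y"
      proof -
        have "x = comb (ext c l)" using l(1) le by (simp add: feas_def)
        also have "\<dots> = o' c + (\<Sum>j\<in>T. l j *\<^sub>R d j)" by (rule ext_comb)
        also have "(\<Sum>j\<in>T. l j *\<^sub>R d j) = L ?y" by (rule L_T[symmetric]) simp
        finally show ?thesis .
      qed
      ultimately show "x \<in> (+) (o' c) ` L ` D c" by blast
    qed
    show "(+) (o' c) ` L ` D c \<subseteq> cell c S"
    proof
      fix x assume "x \<in> (+) (o' c) ` L ` D c"
      then obtain y where y: "y \<in> D c" "x = o' c + L y" by blast
      define l where "l = (\<lambda>j. y \<bullet> b' j)"
      have lb: "l (b e) = y \<bullet> e" if "e \<in> Basis" for e using b'b[OF that] by (simp add: l_def)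
      have pos: "0 < ext c l j" if "j \<in> S" for j
      proof (cases "j \<in> T")
        case True
        then show ?thesis using y(1) b'T[OF True] by (simp add: ext_def l_def D_def)
      next
        case False
        with that have "j \<in> R" by (simp add: T_def)
        then obtain i where i: "i < r" "j = rep i" by (auto simp: R_def)
        have "ts l i = (\<Sum>e\<in>Basis. if lab (b e) = i then y \<bullet> e else 0)"
          unfolding ts_b by (intro sum.cong) (auto simp: lb)
        then have "ts l i < c i" using y(1) i(1) by (simp add: D_def)
        then show ?thesis by (simp add: i ext_rep)
      qed
      have "supp (ext c l) = S" using pos ext_supp[of c l] by (force simp: supp_def)
      moreover have "comb (ext c l) = x"
        unfolding ext_comb y(2) using L_T[of l y] lb by simp
      moreover have "0 \<le> ext c l j" for j using pos[of j] ext0[of j c l] by (cases "j \<in> S") auto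
      ultimately have "feas c x (ext c l)" using SJ by (auto simp: feas_def ext_class)
      with \<open>supp (ext c l) = S\<close> show "x \<in> cell c S" by (auto simp: cell_def)
    qed
  qed
  have "D c = (\<Inter>e\<in>Basis. {y. 0 < y \<bullet> e}) \<inter> (\<Inter>i\<in>{..<r}. {y. (\<Sum>e\<in>Basis. if lab (b e) = i then y \<bullet> e else 0) < c i})" for c
    by (auto simp: D_def)
  moreover have "continuous_on UNIV (\<lambda>y. if lab (b e) = i then y \<bullet> e else (0::real))" for e i
    by (cases "lab (b e) = i") (auto intro!: continuous_intros)
  ultimately have "open (D c)" for c
    by (auto intro!: open_Int open_INT open_Collect_less continuous_intros)
  then have Dm: "D c \<in> sets borel" for c by simp
  obtain k where k: "\<And>X. X \<in> sets borel \<Longrightarrow> L ` X \<in> sets borel \<and> vol (L ` X) = k * vol X"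
    using lborel_linear_image[OF linL injL] by metis
  \<comment> \<open>Scaling each coordinate by c of its label turns the simplices of size 1 into
    those of size c i; \<open>vol_stretch\<close> then yields the monomial.\<close>
  have stretch: "D c = (\<lambda>x. \<Sum>e\<in>Basis. (c (lab (b e)) * (x \<bullet> e)) *\<^sub>R e) ` D (\<lambda>_. 1)"
    if c: "\<And>i. i < r \<Longrightarrow> 0 < c i" for c
  proof -
    have lr: "lab (b e) < r" if "e \<in> Basis" for e using bT[OF that] TJ lab_less by blast
    have sc: "(\<Sum>e\<in>Basis. if lab (b e) = i then c (lab (b e)) * f e else 0)
        = c i * (\<Sum>e\<in>(Basis::'a set). if lab (b e) = i then f e else 0)" for f :: "'a \<Rightarrow> real" and i
      unfolding sum_distrib_left by (intro sum.cong) auto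
    show ?thesis
    proof
      show "(\<lambda>x. \<Sum>e\<in>Basis. (c (lab (b e)) * (x \<bullet> e)) *\<^sub>R e) ` D (\<lambda>_. 1) \<subseteq> D c"
      proof
        fix z assume "z \<in> (\<lambda>x. \<Sum>e\<in>Basis. (c (lab (b e)) * (x \<bullet> e)) *\<^sub>R e) ` D (\<lambda>_. 1)"
        then obtain x where x: "x \<in> D (\<lambda>_. 1)" "z = (\<Sum>e\<in>Basis. (c (lab (b e)) * (x \<bullet> e)) *\<^sub>R e)" by blast
        have z: "z \<bullet> e = c (lab (b e)) * (x \<bullet> e)" if "e \<in> Basis" for e using that by (simp add: x(2))
        show "z \<in> D c"
          unfolding D_def
        proof (intro CollectI conjI ballI allI impI)
          fix e :: 'a assume e: "e \<in> Basis"
          then show "0 < z \<bullet> e" using x(1) c[OF lr[OF e]] by (simp add: z D_def)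
        next
          fix i assume i: "i < r"
          have "(\<Sum>e\<in>Basis. if lab (b e) = i then z \<bullet> e else 0)
            = (\<Sum>e\<in>Basis. if lab (b e) = i then c (lab (b e)) * (x \<bullet> e) else 0)"
            by (intro sum.cong) (auto simp: z)
          also have "\<dots> = c i * (\<Sum>e\<in>Basis. if lab (b e) = i then x \<bullet> e else 0)" by (rule sc)
          also have "\<dots> < c i * 1" using x(1) i c[OF i] unfolding D_def by (intro mult_strict_left_mono) auto
          finally show "(\<Sum>e\<in>Basis. if lab (b e) = i then z \<bullet> e else 0) < c i" by simp
        qed
      qed
      show "D c \<subseteq> (\<lambda>x. \<Sum>e\<in>Basis. (c (lab (b e)) * (x \<bullet> e)) *\<^sub>R e) ` D (\<lambda>_. 1)"
      proof
        fix z assume z: "z \<in> D c"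
        define x where "x = (\<Sum>e\<in>Basis. ((z \<bullet> e) / c (lab (b e))) *\<^sub>R e)"
        have x: "x \<bullet> e = (z \<bullet> e) / c (lab (b e))" if "e \<in> Basis" for e using that by (simp add: x_def)
        have zx: "z \<bullet> e = c (lab (b e)) * (x \<bullet> e)" if "e \<in> Basis" for e
          using c[OF lr[OF that]] by (simp add: x[OF that])
        have "x \<in> D (\<lambda>_. 1)"
          unfolding D_def
        proof (intro CollectI conjI ballI allI impI)
          fix e :: 'a assume e: "e \<in> Basis"
          then show "0 < x \<bullet> e" using z c[OF lr[OF e]] by (simp add: x D_def)
        next
          fix i assume i: "i < r"
          have "c i * (\<Sum>e\<in>Basis. if lab (b e) = i then x \<bullet> e else 0)
            = (\<Sum>e\<in>Basis. if lab (b e) = i then c (lab (b e)) * (x \<bullet> e) else 0)" by (rule sc[symmetric])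
          also have "\<dots> = (\<Sum>e\<in>Basis. if lab (b e) = i then z \<bullet> e else 0)"
            by (intro sum.cong) (auto simp: zx)
          also have "\<dots> < c i * 1" using z i by (simp add: D_def)
          finally show "(\<Sum>e\<in>Basis. if lab (b e) = i then x \<bullet> e else 0) < 1"
            using c[OF i] by simp
        qed
        moreover have "z = (\<Sum>e\<in>Basis. (c (lab (b e)) * (x \<bullet> e)) *\<^sub>R e)"
          by (rule euclidean_eqI) (simp add: zx)
        ultimately show "z \<in> (\<lambda>x. \<Sum>e\<in>Basis. (c (lab (b e)) * (x \<bullet> e)) *\<^sub>R e) ` D (\<lambda>_. 1)" by blast
      qed
    qed
  qed
  show thesis
  proof
    show "lab (b e) < r" if "e \<in> Basis" for e using bT[OF that] TJ lab_less by blast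
    fix c :: "nat \<Rightarrow> real" assume c: "\<And>i. i < r \<Longrightarrow> 0 < c i"
    have "vol (D c) = (\<Prod>e\<in>Basis. c (lab (b e))) * vol (D (\<lambda>_. 1))"
    proof -
      have "0 < c (lab (b e))" if "e \<in> Basis" for e using bT[OF that] TJ lab_less c by blast
      from vol_stretch[OF Dm[of "\<lambda>_. 1"], of "\<lambda>e. c (lab (b e))", OF this] show ?thesis
        using arg_cong[OF stretch[of c, OF c], where f = vol] by simp
    qed
    then show "cell c S \<in> sets borel \<and>
        vol (cell c S) = (k * vol (D (\<lambda>_. 1))) * (\<Prod>e\<in>Basis. c (lab (b e)))"
      unfolding cell_eq using k[OF Dm[of c]] borel_translation[of "L ` D c" "o' c"] by simp
  qed
qed

end

text \<open>The index set consists of pairs (i, v), so that a point occurring in several V i has a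
  separate weight for each. Dividing the weights of label i by c i > 0 gives a convex combination of
  V i.\<close>

lemma hull_sum_iff_feas:
  fixes V :: "nat \<Rightarrow> 'a::euclidean_space set"
  assumes fin: "\<And>i. i < r \<Longrightarrow> finite (V i)" and c: "\<And>i. i < r \<Longrightarrow> 0 < c i"
  shows "x \<in> (\<Sum>i<r. (*\<^sub>R) (c i) ` (convex hull V i))
    \<longleftrightarrow> (\<exists>l. labelled_points.feas (Sigma {..<r} V) fst snd r c x l)"
proof -
  let ?J = "Sigma {..<r} V"
  interpret labelled_points ?J fst snd r
    using fin by unfold_locales auto
  have split: "(\<Sum>j\<in>?J. f j) = (\<Sum>i<r. \<Sum>v\<in>V i. f (i, v))" for f :: "nat \<times> 'a \<Rightarrow> 'b::comm_monoid_add"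
    using fin by (subst sum.Sigma) (auto simp: case_prod_unfold)
  have csum: "class_sum l i = (\<Sum>v\<in>V i. l (i, v))" if "i < r" for l i
  proof -
    have "class_sum l i = (\<Sum>k<r. \<Sum>v\<in>V k. if k = i then l (k, v) else 0)"
      unfolding class_sum_def split by simp
    also have "\<dots> = (\<Sum>k<r. if k = i then (\<Sum>v\<in>V i. l (i, v)) else 0)"
      by (intro sum.cong) auto
    finally show ?thesis using that by simp
  qed
  have comb: "comb l = (\<Sum>i<r. \<Sum>v\<in>V i. l (i, v) *\<^sub>R v)" for l
    unfolding comb_def split by simp
  show ?thesis
  proof
    assume "x \<in> (\<Sum>i<r. (*\<^sub>R) (c i) ` (convex hull V i))"
    then obtain s where s: "x = sum s {..<r}" "\<And>i. i < r \<Longrightarrow> s i \<in> (*\<^sub>R) (c i) ` (convex hull V i)"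
      by (auto simp: set_sum_alt)
    have "\<exists>u. (\<forall>v\<in>V i. 0 \<le> u v) \<and> sum u (V i) = 1 \<and> s i = c i *\<^sub>R (\<Sum>v\<in>V i. u v *\<^sub>R v)" if "i < r" for i
      using s(2)[OF that] convex_hull_finite[OF fin[OF that]] by auto
    then obtain u where u: "\<And>i v. i < r \<Longrightarrow> v \<in> V i \<Longrightarrow> 0 \<le> u i v" "\<And>i. i < r \<Longrightarrow> sum (u i) (V i) = 1"
      "\<And>i. i < r \<Longrightarrow> s i = c i *\<^sub>R (\<Sum>v\<in>V i. u i v *\<^sub>R v)" by metis
    define l where "l j = (if j \<in> ?J then c (fst j) * u (fst j) (snd j) else 0)" for j
    have "comb l = x"
      unfolding comb s(1) by (intro sum.cong) (auto simp: l_def u(3) scaleR_sum_right)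
    moreover have "class_sum l i = c i" if "i < r" for i
    proof -
      have "class_sum l i = (\<Sum>v\<in>V i. c i * u i v)"
        unfolding csum[OF that] using that by (intro sum.cong) (auto simp: l_def)
      then show ?thesis using u(2)[OF that] by (simp add: sum_distrib_left[symmetric])
    qed
    moreover have "0 \<le> l j" for j
      using u(1) c by (auto simp: l_def less_imp_le)
    moreover have "supp l \<subseteq> ?J" by (auto simp: supp_def l_def split: if_splits)
    ultimately show "\<exists>l. feas c x l" unfolding feas_def by blast
  next
    assume "\<exists>l. feas c x l"
    then obtain l where l: "\<And>j. 0 \<le> l j" "comb l = x" "\<And>i. i < r \<Longrightarrow> class_sum l i = c i"
      by (auto simp: feas_def)
    define s where "s i = (\<Sum>v\<in>V i. l (i, v) *\<^sub>R v)" for i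
    have "s i \<in> (*\<^sub>R) (c i) ` (convex hull V i)" if i: "i < r" for i
    proof
      show "s i = c i *\<^sub>R (\<Sum>v\<in>V i. (l (i, v) / c i) *\<^sub>R v)"
        using c[OF i] by (simp add: s_def scaleR_sum_right)
      have "(\<Sum>v\<in>V i. l (i, v) / c i) = 1"
        using l(3)[OF i] c[OF i] csum[OF i, of l] by (simp add: sum_divide_distrib[symmetric])
      then show "(\<Sum>v\<in>V i. (l (i, v) / c i) *\<^sub>R v) \<in> convex hull V i"
        using l(1) c[OF i] unfolding convex_hull_finite[OF fin[OF i]]
        by (intro CollectI exI[of _ "\<lambda>v. l (i, v) / c i"]) auto
    qed
    then show "x \<in> (\<Sum>i<r. (*\<^sub>R) (c i) ` (convex hull V i))"
      using l(2) unfolding set_sum_alt[OF finite_lessThan] comb s_def[symmetric] by auto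
  qed
qed

text \<open>Good cells are disjoint and cover the sum up to finitely many negligible cells of sets
  that do not span. The order of quantifiers matters: sets, constants and exponents are fixed before
  c.\<close>

lemma polytope_volume_monomials:
  fixes V :: "nat \<Rightarrow> 'a::euclidean_space set"
  assumes V: "\<forall>i<r. finite (V i) \<and> V i \<noteq> {}"
  shows "\<exists>(G :: (nat \<times> 'a) set set) C g. finite G \<and> (\<forall>s\<in>G. \<forall>b\<in>Basis. g s b < r) \<and>
    (\<forall>c. (\<forall>i<r. 0 < c i) \<longrightarrow> vol (\<Sum>i<r. (*\<^sub>R) (c i) ` (convex hull V i))
      = (\<Sum>s\<in>G. C s * (\<Prod>b\<in>(Basis::'a set). c (g s b))))"
proof -
  have fin: "\<And>i. i < r \<Longrightarrow> finite (V i)" and ne: "\<And>i. i < r \<Longrightarrow> V i \<noteq> {}" using V by auto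
  let ?J = "Sigma {..<r} V"
  interpret labelled_points ?J fst snd r
    using fin by unfold_locales auto
  obtain h where h: "generic h" by (rule generic_exists)
  let ?G = "{S. good h S}"
  have GJ: "?G \<subseteq> Pow ?J" by (auto simp: good_def spanning_def full_def)
  then have finG: "finite ?G" using finJ by (meson finite_Pow_iff finite_subset)
  have "\<forall>S\<in>?G. \<exists>C g. (\<forall>b\<in>Basis. g b < r) \<and> (\<forall>c. (\<forall>i<r. 0 < c i) \<longrightarrow>
       cell c S \<in> sets borel \<and> vol (cell c S) = C * (\<Prod>b\<in>(Basis::'a set). c (g b)))"
  proof
    fix S assume "S \<in> ?G"
    then have "spanning S" by (simp add: good_def)
    from cell_volume[OF this] show "\<exists>C g. (\<forall>b\<in>Basis. g b < r) \<and> (\<forall>c. (\<forall>i<r. 0 < c i) \<longrightarrow>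
       cell c S \<in> sets borel \<and> vol (cell c S) = C * (\<Prod>b\<in>(Basis::'a set). c (g b)))" by metis
  qed
  then obtain C g where Cg: "\<And>S b. S \<in> ?G \<Longrightarrow> b \<in> Basis \<Longrightarrow> g S b < r"
    "\<And>S c. S \<in> ?G \<Longrightarrow> (\<And>i. i < r \<Longrightarrow> 0 < c i) \<Longrightarrow>
       cell c S \<in> sets borel \<and> vol (cell c S) = C S * (\<Prod>b\<in>(Basis::'a set). c (g S b))"
    by metis
  have "vol (\<Sum>i<r. (*\<^sub>R) (c i) ` (convex hull V i)) = (\<Sum>S\<in>?G. C S * (\<Prod>b\<in>(Basis::'a set). c (g S b)))"
    if c: "\<And>i. i < r \<Longrightarrow> 0 < c i" for c
  proof -
    let ?M = "\<Sum>i<r. (*\<^sub>R) (c i) ` (convex hull V i)"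
    let ?U = "\<Union>S\<in>?G. cell c S"
    note feas_iff = hull_sum_iff_feas[of r V c, OF fin c]
    have M: "body ?M"
      using fin ne by (intro body_sum body_scale) (auto simp: body_def finite_imp_compact_convex_hull)
    have UM: "cell c S \<subseteq> ?M" for S using feas_iff by (auto simp: cell_def)
    let ?N = "\<Union>S\<in>{S. full S \<and> span (dirs S) \<noteq> UNIV}. cell c S"
    have "?M - ?U \<subseteq> ?N"
    proof
      fix x assume x: "x \<in> ?M - ?U"
      then obtain l where l: "feas c x l" using feas_iff by auto
      obtain S where "full S" "x \<in> cell c S" "good h S \<or> span (dirs S) \<noteq> UNIV"
        by (rule cell_cover[OF h l c])
      with x show "x \<in> ?N" by blast
    qed
    moreover have "negligible ?N"
    proof (rule negligible_Union)
      have "{S. full S \<and> span (dirs S) \<noteq> UNIV} \<subseteq> Pow ?J" by (auto simp: full_def)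
      then show "finite (cell c ` {S. full S \<and> span (dirs S) \<noteq> UNIV})"
        using finJ by (meson finite_Pow_iff finite_subset finite_imageI)
    qed (auto intro: cell_negligible)
    ultimately have "negligible (?M - ?U \<union> (?U - ?M))"
      using UM negligible_subset by (metis (no_types, lifting) Diff_eq_empty_iff UN_least sup_bot.right_neutral)
    then have "measure lebesgue ?U = measure lebesgue ?M"
      by (rule measure_negligible_symdiff[OF body_lmeasurable[OF M]])
    moreover have Um: "?U \<in> sets borel" using Cg(2)[OF _ c] finG by (intro sets.finite_UN) auto
    ultimately have "vol ?M = vol ?U" using vol_lebesgue[OF M] by simp
    also have "\<dots> = (\<Sum>S\<in>?G. vol (cell c S))"
    proof (rule measure_finite_Union[OF finG])
      show "(\<lambda>S. cell c S) ` ?G \<subseteq> sets lborel" using Cg(2)[OF _ c] by auto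
      show "disjoint_family_on (\<lambda>S. cell c S) ?G"
        unfolding disjoint_family_on_def using cell_disjoint by blast
      fix S assume "S \<in> ?G"
      have "emeasure lborel (cell c S) \<le> emeasure lborel ?M"
        using UM M by (intro emeasure_mono) (auto simp: body_borel)
      also have "\<dots> < \<infinity>" using emeasure_compact_finite[OF bodyD(1)[OF M]] .
      finally show "emeasure lborel (cell c S) \<noteq> \<infinity>" by simp
    qed
    also have "\<dots> = (\<Sum>S\<in>?G. C S * (\<Prod>b\<in>(Basis::'a set). c (g S b)))"
      using Cg(2)[OF _ c] by (intro sum.cong) auto
    finally show "vol ?M = (\<Sum>S\<in>?G. C S * (\<Prod>b\<in>(Basis::'a set). c (g S b)))" .
  qed
  then show ?thesis
    using finG Cg(1) by (intro exI[of _ ?G] exI[of _ C] exI[of _ g]) blast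
qed

text \<open>As 0 may lie outside N, the sum is first translated by a small multiple of - y with y in
  N; then it contains M and shrinks to it.\<close>

lemma vol_add_small:
  fixes M N :: "'a::euclidean_space set"
  assumes M: "body M" and N: "body N"
  shows "(\<lambda>k. vol (M + (*\<^sub>R) (1 / real (Suc k)) ` N)) \<longlonglongrightarrow> vol M"
proof -
  obtain y where y: "y \<in> N" using bodyD(3)[OF N] by blast
  obtain R where R: "0 < R" "\<And>x. x \<in> N \<Longrightarrow> norm x \<le> R"
    using compact_imp_bounded[OF bodyD(1)[OF N]] bounded_pos by blast
  let ?e = "\<lambda>k. 1 / real (Suc k)"
  let ?L = "\<lambda>k. {- (?e k *\<^sub>R y)} + (M + (*\<^sub>R) (?e k) ` N)"
  have "(\<lambda>k. vol (?L k)) \<longlonglongrightarrow> vol M"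
  proof (rule vol_outer_tendsto)
    show "body M" by (rule M)
    show "body (?L k)" for k by (intro body_plus body_singleton body_scale M N)
    fix k
    show "M \<subseteq> ?L k"
    proof
      fix x assume "x \<in> M"
      then have "- (?e k *\<^sub>R y) + (x + ?e k *\<^sub>R y) \<in> ?L k"
        using y by (intro set_plus_intro) auto
      then show "x \<in> ?L k" by simp
    qed
    show "?L k \<subseteq> M + cball 0 (2 * R * ?e k)"
    proof
      fix x assume "x \<in> ?L k"
      then obtain m z where mz: "m \<in> M" "z \<in> N" "x = - (?e k *\<^sub>R y) + (m + ?e k *\<^sub>R z)"
        by (auto elim!: set_plus_elim)
      have "norm (z - y) \<le> 2 * R"
        using R(2)[OF y] R(2)[OF mz(2)] norm_triangle_ineq4[of z y] by linarith
      then have "norm (?e k *\<^sub>R (z - y)) \<le> 2 * R * ?e k"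
        unfolding norm_scaleR by (simp add: divide_right_mono)
      then have "m + ?e k *\<^sub>R (z - y) \<in> M + cball 0 (2 * R * ?e k)"
        using mz(1) by (intro set_plus_intro) (auto simp: dist_norm)
      moreover have "x = m + ?e k *\<^sub>R (z - y)" unfolding mz(3) by (simp only: scaleR_diff_right) simp
      ultimately show "x \<in> M + cball 0 (2 * R * ?e k)" by simp
    qed
  next
    show "(\<lambda>k. 2 * R * ?e k) \<longlonglongrightarrow> 0"
      using tendsto_mult_right_zero[OF LIMSEQ_inverse_real_of_nat, of "2 * R"] by (simp add: inverse_eq_divide)
  qed
  then show ?thesis using M N by (simp add: vol_translation body_plus body_scale)
qed

text \<open>The cells degenerate when some c i is 0, so the identity is carried to the boundary by
  continuity: raising every c i by e adds e times the sum of all hulls.\<close>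

lemma polytope_volume_monomials_nonneg:
  fixes V :: "nat \<Rightarrow> 'a::euclidean_space set"
  assumes V: "\<forall>i<r. finite (V i) \<and> V i \<noteq> {}"
  shows "\<exists>(G :: (nat \<times> 'a) set set) C g. finite G \<and> (\<forall>s\<in>G. \<forall>b\<in>Basis. g s b < r) \<and>
    (\<forall>c. (\<forall>i<r. 0 \<le> c i) \<longrightarrow> vol (\<Sum>i<r. (*\<^sub>R) (c i) ` (convex hull V i))
      = (\<Sum>s\<in>G. C s * (\<Prod>b\<in>(Basis::'a set). c (g s b))))"
proof -
  obtain G :: "(nat \<times> 'a) set set" and C g where G: "finite G" "\<forall>s\<in>G. \<forall>b\<in>Basis. g s b < r"
    and pos: "\<forall>c. (\<forall>i<r. 0 < c i) \<longrightarrow>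
       vol (\<Sum>i<r. (*\<^sub>R) (c i) ` (convex hull V i)) = (\<Sum>s\<in>G. C s * (\<Prod>b\<in>(Basis::'a set). c (g s b)))"
    using polytope_volume_monomials[OF V] by (elim exE conjE) (rule that; assumption)
  have bV: "body (convex hull V i)" if "i < r" for i
    using V that by (auto simp: body_def finite_imp_compact_convex_hull)
  have "vol (\<Sum>i<r. (*\<^sub>R) (c i) ` (convex hull V i)) = (\<Sum>s\<in>G. C s * (\<Prod>b\<in>(Basis::'a set). c (g s b)))"
    if c: "\<forall>i<r. 0 \<le> c i" for c
  proof -
    let ?M = "\<Sum>i<r. (*\<^sub>R) (c i) ` (convex hull V i)"
    let ?N = "\<Sum>i<r. convex hull V i"
    let ?e = "\<lambda>k. 1 / real (Suc k)"
    have "(\<lambda>k. vol (?M + (*\<^sub>R) (?e k) ` ?N)) \<longlonglongrightarrow> vol ?M"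
      by (intro vol_add_small body_sum body_scale bV) auto
    moreover have "vol (?M + (*\<^sub>R) (?e k) ` ?N) = (\<Sum>s\<in>G. C s * (\<Prod>b\<in>(Basis::'a set). c (g s b) + ?e k))" for k
    proof -
      have "?M + (*\<^sub>R) (?e k) ` ?N = (\<Sum>i<r. (*\<^sub>R) (c i + ?e k) ` (convex hull V i))"
        unfolding scale_sum sum.distrib[symmetric] using c bV
        by (intro sum.cong) (auto simp: scale_add bodyD)
      moreover have "vol \<dots> = (\<Sum>s\<in>G. C s * (\<Prod>b\<in>(Basis::'a set). c (g s b) + ?e k))"
        using c by (intro pos[rule_format]) (simp add: add_nonneg_pos)
      ultimately show ?thesis by simp
    qed
    ultimately have "(\<lambda>k. \<Sum>s\<in>G. C s * (\<Prod>b\<in>(Basis::'a set). c (g s b) + ?e k)) \<longlonglongrightarrow> vol ?M" by simp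
    moreover have "(\<lambda>k. \<Sum>s\<in>G. C s * (\<Prod>b\<in>(Basis::'a set). c (g s b) + ?e k))
        \<longlonglongrightarrow> (\<Sum>s\<in>G. C s * (\<Prod>b\<in>(Basis::'a set). c (g s b) + 0))"
      using LIMSEQ_inverse_real_of_nat by (intro tendsto_intros) (simp add: inverse_eq_divide)
    ultimately show "vol ?M = (\<Sum>s\<in>G. C s * (\<Prod>b\<in>(Basis::'a set). c (g s b)))"
      using LIMSEQ_unique by force
  qed
  then show ?thesis
    using G by (intro exI[of _ G] exI[of _ C] exI[of _ g]) blast
qed

text \<open>The polytope is spanned by sums of a finite net in K and the corners of a small cube:
  cubes around the net cover K, and taking hulls commutes with Minkowski sums.\<close>

lemma outer_polytope:
  fixes K :: "'a::euclidean_space set"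
  assumes K: "body K" and e: "0 < e"
  obtains V where "finite V" "V \<noteq> {}" "K \<subseteq> convex hull V" "convex hull V \<subseteq> K + cball 0 e"
proof -
  \<comment> \<open>The Euclidean norm is at most the sum of the absolute values of the coordinates,
    so a cube of half-width d stays within distance e.\<close>
  define d where "d = e / real DIM('a)"
  have d: "0 < d" using e by (simp add: d_def)
  obtain N where N: "finite N" "N \<subseteq> K" "K \<subseteq> (\<Union>x\<in>N. ball x d)"
    using compact_imp_seq_compact compactE_image[OF bodyD(1)[OF K], of K "\<lambda>x. ball x d"] d by (metis UN_I centre_in_ball open_ball subsetI)
  obtain W where W: "finite W" "cbox (0 - (\<Sum>i\<in>Basis. d *\<^sub>R i)) (0 + (\<Sum>i\<in>Basis. d *\<^sub>R i)) = convex hull (W::'a set)"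
    using cube_convex_hull[OF d] by blast
  have W_mem: "x \<in> convex hull W \<longleftrightarrow> (\<forall>b\<in>Basis. \<bar>x \<bullet> b\<bar> \<le> d)" for x
    unfolding W(2)[symmetric] by (auto simp: mem_box abs_le_iff minus_le_iff)
  have hull: "convex hull (N + W) = convex hull N + convex hull W" by (rule convex_hull_set_plus)
  have sub: "K \<subseteq> convex hull (N + W)"
  proof
    fix x assume "x \<in> K"
    then obtain y where y: "y \<in> N" "dist y x < d" using N(3) by auto
    have "\<bar>(x - y) \<bullet> b\<bar> \<le> d" if "b \<in> Basis" for b
      using Basis_le_norm[OF that, of "x - y"] y(2) by (simp add: dist_norm norm_minus_commute)
    then have "y + (x - y) \<in> convex hull N + convex hull W"
      using y(1) by (intro set_plus_intro) (auto simp: W_mem hull_inc)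
    then show "x \<in> convex hull (N + W)" unfolding hull by simp
  qed
  show thesis
  proof
    show "finite (N + W)" using N W by (intro finite_set_plus) auto
    show "K \<subseteq> convex hull (N + W)" by (rule sub)
    then show "N + W \<noteq> {}" using bodyD(3)[OF K] by (metis convex_hull_empty subset_empty)
    have "convex hull N \<subseteq> K" using N(2) bodyD(2)[OF K] by (simp add: hull_minimal)
    moreover have "convex hull W \<subseteq> cball 0 e"
    proof
      fix x assume "x \<in> convex hull W"
      then have "norm x \<le> (\<Sum>b\<in>(Basis::'a set). d)"
        using norm_le_l1[of x] sum_mono[of Basis "\<lambda>b. \<bar>x \<bullet> b\<bar>" "\<lambda>_. d"] by (simp add: W_mem)
      also have "\<dots> = e" by (simp add: d_def)
      finally show "x \<in> cball 0 e" by simp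
    qed
    ultimately show "convex hull (N + W) \<subseteq> K + cball 0 e" unfolding hull by (rule set_plus_mono2)
  qed
qed

section \<open>Existence and uniqueness of mixed volumes\<close>

text \<open>Inclusion and exclusion, by expanding a product over I whose factors are 1 + 0 on T and
  1 - 1 elsewhere.\<close>

lemma alternating_sum_containing:
  assumes "finite I" "T \<subseteq> I"
  shows "(\<Sum>S\<in>Pow I. (-1) ^ card (I - S) * (if T \<subseteq> S then 1 else 0)) = (if T = I then 1 else 0 :: real)"
proof -
  have "(if T \<subseteq> S then 1 else 0) * (-1) ^ card (I - S)
      = (\<Prod>i\<in>S. 1) * (\<Prod>i\<in>I - S. if i \<in> T then 0 else (-1 :: real))" if "S \<in> Pow I" for S
  proof (cases "T \<subseteq> S")
    case True
    then have "(\<Prod>i\<in>I - S. if i \<in> T then 0 else (-1 :: real)) = (\<Prod>i\<in>I - S. -1)"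
      by (intro prod.cong) auto
    then show ?thesis using True by simp
  next
    case False
    then obtain i where "i \<in> T" "i \<in> I - S" using assms(2) by auto
    then have "(\<Prod>i\<in>I - S. if i \<in> T then 0 else (-1 :: real)) = 0"
      using assms(1) by (intro prod_zero) auto
    then show ?thesis using False by simp
  qed
  then have "(\<Sum>S\<in>Pow I. (-1) ^ card (I - S) * (if T \<subseteq> S then 1 else 0))
      = (\<Sum>S\<in>Pow I. (\<Prod>i\<in>S. 1) * (\<Prod>i\<in>I - S. if i \<in> T then 0 else (-1 :: real)))"
    by (intro sum.cong) (simp_all add: mult.commute)
  also have "\<dots> = (\<Prod>i\<in>I. 1 + (if i \<in> T then 0 else -1))" by (rule prod_add[OF assms(1), symmetric])
  also have "\<dots> = (if T = I then 1 else 0)"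
  proof (cases "T = I")
    case False
    then obtain i where "i \<in> I" "i \<notin> T" using assms(2) by auto
    then show ?thesis using False assms(1) by (auto intro!: prod_zero)
  qed simp
  finally show ?thesis .
qed

text \<open>Ryser's formula for the permanent, with rows I and columns B. Expanding the product
  gives all maps g from B to I, and the alternating sum keeps those whose image is all of I.\<close>

lemma ryser:
  fixes x :: "'i \<Rightarrow> 'l \<Rightarrow> real"
  assumes fin: "finite I" "finite B" and card: "card B = card I"
  shows "(\<Sum>S\<in>Pow I. (-1) ^ card (I - S) * (\<Prod>l\<in>B. \<Sum>i\<in>S. x i l))
    = (\<Sum>g\<in>{g \<in> B \<rightarrow>\<^sub>E I. bij_betw g B I}. \<Prod>l\<in>B. x (g l) l)"
proof -
  have "(\<Prod>l\<in>B. \<Sum>i\<in>S. x i l) = (\<Sum>g\<in>B \<rightarrow>\<^sub>E I. (if g ` B \<subseteq> S then 1 else 0) * (\<Prod>l\<in>B. x (g l) l))"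
    if S: "S \<in> Pow I" for S
  proof -
    have "(\<Prod>l\<in>B. \<Sum>i\<in>S. x i l) = (\<Sum>g\<in>B \<rightarrow>\<^sub>E S. \<Prod>l\<in>B. x (g l) l)"
      using fin S finite_subset by (intro prod_sum_PiE) auto
    also have "\<dots> = (\<Sum>g\<in>B \<rightarrow>\<^sub>E I. if g ` B \<subseteq> S then \<Prod>l\<in>B. x (g l) l else 0)"
      using fin S by (intro sum.mono_neutral_cong_left finite_PiE)
        (auto simp: PiE_iff image_subset_iff)
    finally show ?thesis by (simp add: if_distrib cong: if_cong) (intro sum.cong, auto)
  qed
  then have "(\<Sum>S\<in>Pow I. (-1) ^ card (I - S) * (\<Prod>l\<in>B. \<Sum>i\<in>S. x i l))
      = (\<Sum>S\<in>Pow I. \<Sum>g\<in>B \<rightarrow>\<^sub>E I. (-1) ^ card (I - S) * (if g ` B \<subseteq> S then 1 else 0) * (\<Prod>l\<in>B. x (g l) l))"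
    by (simp add: sum_distrib_left mult.assoc)
  also have "\<dots> = (\<Sum>g\<in>B \<rightarrow>\<^sub>E I. (\<Sum>S\<in>Pow I. (-1) ^ card (I - S) * (if g ` B \<subseteq> S then 1 else 0)) * (\<Prod>l\<in>B. x (g l) l))"
    unfolding sum_distrib_right by (rule sum.swap)
  also have "\<dots> = (\<Sum>g\<in>B \<rightarrow>\<^sub>E I. (if g ` B = I then 1 else 0) * (\<Prod>l\<in>B. x (g l) l))"
    using fin by (intro sum.cong refl arg_cong2[where f="(*)"] alternating_sum_containing) auto
  also have "\<dots> = (\<Sum>g\<in>{g \<in> B \<rightarrow>\<^sub>E I. bij_betw g B I}. \<Prod>l\<in>B. x (g l) l)"
  proof (rule sum.mono_neutral_cong_right)
    show "finite (B \<rightarrow>\<^sub>E I)" using fin by (intro finite_PiE) auto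
    show "\<forall>g\<in>(B \<rightarrow>\<^sub>E I) - {g \<in> B \<rightarrow>\<^sub>E I. bij_betw g B I}. (if g ` B = I then 1 else 0) * (\<Prod>l\<in>B. x (g l) l) = 0"
      using fin card by (auto simp: bij_betw_def intro: eq_card_imp_inj_on)
  qed (auto simp: bij_betw_def)
  finally show ?thesis .
qed

text \<open>The denominator is \<open>n!\<close>, written so that it cancels against the sum in \<open>ryser\<close>.\<close>

definition polarized_volume :: "'a::euclidean_space set list \<Rightarrow> real" where
  "polarized_volume Ks = (\<Sum>S\<in>Pow {..<DIM('a)}. (-1) ^ card ({..<DIM('a)} - S) * vol (\<Sum>i\<in>S. Ks ! i))
     / real (card {g \<in> (Basis::'a set) \<rightarrow>\<^sub>E {..<DIM('a)}. bij_betw g Basis {..<DIM('a)}})"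

lemma bijections_Basis:
  "finite {g \<in> (Basis::'a::euclidean_space set) \<rightarrow>\<^sub>E {..<DIM('a)}. bij_betw g Basis {..<DIM('a)}}"
  "{g \<in> (Basis::'a::euclidean_space set) \<rightarrow>\<^sub>E {..<DIM('a)}. bij_betw g Basis {..<DIM('a)}} \<noteq> {}"
proof -
  show "finite {g \<in> (Basis::'a set) \<rightarrow>\<^sub>E {..<DIM('a)}. bij_betw g Basis {..<DIM('a)}}"
    by (rule finite_subset[of _ "(Basis::'a set) \<rightarrow>\<^sub>E {..<DIM('a)}"]) (auto intro: finite_PiE)
  obtain g :: "'a \<Rightarrow> nat" where g: "bij_betw g Basis {..<DIM('a)}"
    using finite_same_card_bij[of "Basis :: 'a set" "{..<DIM('a)}"] by auto
  then have "restrict g Basis \<in> {g \<in> (Basis::'a set) \<rightarrow>\<^sub>E {..<DIM('a)}. bij_betw g Basis {..<DIM('a)}}"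
    by (auto simp: bij_betw_def inj_on_def)
  then show "{g \<in> (Basis::'a set) \<rightarrow>\<^sub>E {..<DIM('a)}. bij_betw g Basis {..<DIM('a)}} \<noteq> {}" by blast
qed

text \<open>The dilation factor of K a is the number of i in S with f i = a, so a sum with repeated
  bodies becomes a combination to which a volume polynomial applies.\<close>

lemma sum_select:
  fixes K :: "nat \<Rightarrow> 'a::euclidean_space set"
  assumes "finite S" "\<And>i. i \<in> S \<Longrightarrow> f i < r" "\<And>a. a < r \<Longrightarrow> body (K a)"
  shows "(\<Sum>i\<in>S. K (f i)) = (\<Sum>a<r. (*\<^sub>R) (\<Sum>i\<in>S. if f i = a then 1 else 0) ` K a)"
proof -
  have "(\<Sum>a<r. (*\<^sub>R) (\<Sum>i\<in>S. if f i = a then 1 else 0) ` K a)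
      = (\<Sum>a<r. \<Sum>i\<in>S. (*\<^sub>R) (if f i = a then 1 else 0) ` K a)"
    using assms(3) by (intro sum.cong refl scale_sum_coeff) (auto simp: bodyD)
  also have "\<dots> = (\<Sum>i\<in>S. \<Sum>a<r. (*\<^sub>R) (if f i = a then 1 else 0) ` K a)" by (rule sum.swap)
  also have "\<dots> = (\<Sum>i\<in>S. \<Sum>a<r. if a = f i then K (f i) else 0)"
    using scale_zero[OF bodyD(3)[OF assms(3)]] by (intro sum.cong refl) auto
  also have "\<dots> = (\<Sum>i\<in>S. K (f i))"
    using assms(2) by (intro sum.cong refl) (simp add: sum.delta')
  finally show ?thesis ..
qed

lemma index_list_nth: "length js = n \<Longrightarrow> set js \<subseteq> {..<r} \<Longrightarrow> i < n \<Longrightarrow> js ! i < (r::nat)"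
  by (metis lessThan_iff nth_mem subsetD)

lemma finite_index_lists: "finite {js. length js = n \<and> set js \<subseteq> {..<r::nat}}"
  using finite_lists_length_eq[of "{..<r}" n] by (simp add: conj_commute)

text \<open>
  Polarization recovers a homogeneous polynomial from its values at the 0/1 combinations of the
  arguments.
\<close>

lemma polarization:
  fixes K :: "nat \<Rightarrow> 'a::euclidean_space set" and G :: "'s set"
  assumes K: "\<And>i. i < r \<Longrightarrow> body (K i)"
    and g: "\<And>s b. s \<in> G \<Longrightarrow> b \<in> Basis \<Longrightarrow> g s b < r"
    and vol: "\<And>c. (\<And>i. i < r \<Longrightarrow> 0 \<le> c i) \<Longrightarrow>
       vol (\<Sum>i<r. (*\<^sub>R) (c i) ` K i) = (\<Sum>s\<in>G. C s * (\<Prod>b\<in>(Basis::'a set). c (g s b)))"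
    and c: "\<And>i. i < r \<Longrightarrow> 0 \<le> c i"
  shows "vol (\<Sum>i<r. (*\<^sub>R) (c i) ` K i)
    = (\<Sum>js | length js = DIM('a) \<and> set js \<subseteq> {..<r}. polarized_volume (map K js) * prod_list (map c js))"
proof -
  let ?n = "DIM('a)" and ?I = "{..<DIM('a)}" and ?B = "Basis :: 'a set"
  let ?Bij = "{g \<in> ?B \<rightarrow>\<^sub>E ?I. bij_betw g ?B ?I}"
  let ?L = "{js. length js = ?n \<and> set js \<subseteq> {..<r}}"
  note N = bijections_Basis[where 'a='a]
  have N0: "real (card ?Bij) \<noteq> 0" using N by (simp add: card_gt_0_iff)
  \<comment> \<open>At the combination selected by S, the factor for b counts the i in S with js ! i
    = g s b. Hence \<open>ryser\<close> applies to the 0/1 matrix of matches between positions and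
    basis vectors.\<close>
  have polarized_volume: "polarized_volume (map K js) * real (card ?Bij)
      = (\<Sum>s\<in>G. C s * (\<Sum>h\<in>?Bij. \<Prod>l\<in>?B. if js ! h l = g s l then 1 else 0))" if js: "js \<in> ?L" for js
  proof -
    have jsr: "js ! i < r" if "i < ?n" for i using index_list_nth[OF _ _ that] js by blast
    have "vol (\<Sum>i\<in>S. map K js ! i) = (\<Sum>s\<in>G. C s * (\<Prod>b\<in>?B. \<Sum>i\<in>S. if js ! i = g s b then 1 else 0))"
      if S: "S \<in> Pow ?I" for S
    proof -
      have "(\<Sum>i\<in>S. map K js ! i) = (\<Sum>i\<in>S. K (js ! i))"
        using S js by (intro sum.cong) auto
      also have "\<dots> = (\<Sum>a<r. (*\<^sub>R) (\<Sum>i\<in>S. if js ! i = a then 1 else 0) ` K a)"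
        using S jsr K finite_subset[of S ?I] by (intro sum_select) auto
      also have "vol \<dots> = (\<Sum>s\<in>G. C s * (\<Prod>b\<in>?B. \<Sum>i\<in>S. if js ! i = g s b then 1 else 0))"
        by (rule vol) (simp add: sum_nonneg)
      finally show ?thesis .
    qed
    then have "polarized_volume (map K js) * real (card ?Bij)
      = (\<Sum>S\<in>Pow ?I. (-1) ^ card (?I - S) * (\<Sum>s\<in>G. C s * (\<Prod>b\<in>?B. \<Sum>i\<in>S. if js ! i = g s b then 1 else 0)))"
      using N0 by (simp add: polarized_volume_def)
    also have "\<dots> = (\<Sum>S\<in>Pow ?I. \<Sum>s\<in>G. C s * ((-1) ^ card (?I - S) * (\<Prod>b\<in>?B. \<Sum>i\<in>S. if js ! i = g s b then 1 else 0)))"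
      unfolding sum_distrib_left by (intro sum.cong refl) (simp add: mult.left_commute)
    also have "\<dots> = (\<Sum>s\<in>G. C s * (\<Sum>S\<in>Pow ?I. (-1) ^ card (?I - S) * (\<Prod>b\<in>?B. \<Sum>i\<in>S. if js ! i = g s b then 1 else 0)))"
      by (subst sum.swap) (simp add: sum_distrib_left)
    also have "\<dots> = (\<Sum>s\<in>G. C s * (\<Sum>h\<in>?Bij. \<Prod>l\<in>?B. if js ! h l = g s l then 1 else 0))"
      by (intro sum.cong refl arg_cong2[where f="(*)"] ryser) auto
    finally show ?thesis .
  qed
  \<comment> \<open>For fixed h and s exactly one list matches everywhere, namely the one with g s l
    at position h l. Summing over lists thus returns the monomial once for each bijection.\<close>
  have mono: "(\<Sum>js\<in>?L. (\<Prod>l\<in>?B. if js ! h l = g s l then 1 else 0) * prod_list (map c js))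
      = (\<Prod>b\<in>?B. c (g s b))" if h: "h \<in> ?Bij" and s: "s \<in> G" for h s
  proof -
    have hb: "bij_betw h ?B ?I" using h by simp
    define js0 where "js0 = map (\<lambda>i. g s (inv_into ?B h i)) [0..<?n]"
    have inv: "inv_into ?B h i \<in> ?B" "h (inv_into ?B h i) = i" if "i < ?n" for i
      using hb that by (auto simp: bij_betw_def inv_into_into f_inv_into_f)
    have hinv: "inv_into ?B h (h l) = l" "h l < ?n" if "l \<in> ?B" for l
      using hb that by (auto simp: bij_betw_def)
    have js0: "js0 \<in> ?L" using g[OF s] inv by (auto simp: js0_def)
    have iff: "(\<forall>l\<in>?B. js ! h l = g s l) \<longleftrightarrow> js = js0" if "js \<in> ?L" for js
    proof
      assume *: "\<forall>l\<in>?B. js ! h l = g s l"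
      show "js = js0"
      proof (rule nth_equalityI)
        show "length js = length js0" using that js0 by simp
        fix i assume "i < length js"
        then have "i < ?n" using that by simp
        then show "js ! i = js0 ! i" using inv[of i] * by (simp add: js0_def) metis
      qed
    next
      assume "js = js0"
      then show "\<forall>l\<in>?B. js ! h l = g s l" using hinv by (simp add: js0_def)
    qed
    have "(\<Sum>js\<in>?L. (\<Prod>l\<in>?B. if js ! h l = g s l then 1 else 0) * prod_list (map c js))
        = (\<Sum>js\<in>?L. if js = js0 then prod_list (map c js0) else 0)"
    proof (intro sum.cong refl)
      fix js assume js: "js \<in> ?L"
      have "(\<Prod>l\<in>?B. if js ! h l = g s l then 1 else 0) = (if js = js0 then 1 else (0::real))"
      proof (cases "js = js0")
        case False
        then obtain l where "l \<in> ?B" "js ! h l \<noteq> g s l" using iff[OF js] by blast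
        then show ?thesis using False by (auto intro!: prod_zero)
      next
        case True
        then have "\<forall>l\<in>?B. js ! h l = g s l" using iff[OF js] by blast
        then show ?thesis using True by (simp cong: prod.cong)
      qed
      then show "(\<Prod>l\<in>?B. if js ! h l = g s l then 1 else 0) * prod_list (map c js)
          = (if js = js0 then prod_list (map c js0) else 0)" by simp
    qed
    also have "\<dots> = prod_list (map c js0)" using js0 finite_index_lists by simp
    also have "\<dots> = (\<Prod>i\<in>?I. c (g s (inv_into ?B h i)))"
      unfolding js0_def by (simp add: prod.list_conv_set_nth atLeast0LessThan comp_def)
    also have "\<dots> = (\<Prod>l\<in>?B. c (g s (inv_into ?B h (h l))))"
      by (rule prod.reindex_bij_betw[OF hb, symmetric])
    also have "\<dots> = (\<Prod>b\<in>?B. c (g s b))" using hinv by (intro prod.cong) auto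
    finally show ?thesis .
  qed
  have "(\<Sum>js\<in>?L. polarized_volume (map K js) * prod_list (map c js)) * real (card ?Bij)
      = (\<Sum>js\<in>?L. (\<Sum>s\<in>G. C s * (\<Sum>h\<in>?Bij. \<Prod>l\<in>?B. if js ! h l = g s l then 1 else 0)) * prod_list (map c js))"
    unfolding sum_distrib_right by (intro sum.cong refl) (simp add: polarized_volume[symmetric] sum_distrib_right[symmetric])
  also have "\<dots> = (\<Sum>js\<in>?L. \<Sum>s\<in>G. \<Sum>h\<in>?Bij. C s * ((\<Prod>l\<in>?B. if js ! h l = g s l then 1 else 0) * prod_list (map c js)))"
    unfolding sum_distrib_right sum_distrib_left mult.assoc ..
  also have "\<dots> = (\<Sum>s\<in>G. \<Sum>js\<in>?L. \<Sum>h\<in>?Bij. C s * ((\<Prod>l\<in>?B. if js ! h l = g s l then 1 else 0) * prod_list (map c js)))"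
    by (rule sum.swap)
  also have "\<dots> = (\<Sum>s\<in>G. \<Sum>h\<in>?Bij. \<Sum>js\<in>?L. C s * ((\<Prod>l\<in>?B. if js ! h l = g s l then 1 else 0) * prod_list (map c js)))"
    by (intro sum.cong refl sum.swap)
  also have "\<dots> = (\<Sum>s\<in>G. \<Sum>h\<in>?Bij. C s * (\<Prod>b\<in>?B. c (g s b)))"
    unfolding sum_distrib_left[symmetric] using mono
    by (intro sum.cong refl arg_cong2[where f="(*)"]) auto
  also have "\<dots> = (\<Sum>s\<in>G. C s * (\<Prod>b\<in>?B. c (g s b))) * real (card ?Bij)"
    by (simp add: sum_distrib_right mult.commute)
  finally have "(\<Sum>js\<in>?L. polarized_volume (map K js) * prod_list (map c js)) = (\<Sum>s\<in>G. C s * (\<Prod>b\<in>?B. c (g s b)))"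
    using N0 by simp
  also have "\<dots> = vol (\<Sum>i<r. (*\<^sub>R) (c i) ` K i)" using vol[of c] c by simp
  finally show ?thesis by simp
qed

lemma polarized_volume_outer_tendsto:
  fixes Ks :: "'a::euclidean_space set list"
  assumes Ks: "length Ks = DIM('a)" "\<And>i. i < DIM('a) \<Longrightarrow> body (Ks ! i)"
    and L: "\<And>k. length (L k) = DIM('a)" "\<And>k i. i < DIM('a) \<Longrightarrow> body (L k ! i)"
    and sub: "\<And>k i. i < DIM('a) \<Longrightarrow> Ks ! i \<subseteq> L k ! i"
      "\<And>k i. i < DIM('a) \<Longrightarrow> L k ! i \<subseteq> Ks ! i + cball 0 (e k)"
    and e: "\<And>k. 0 \<le> e k" "e \<longlonglongrightarrow> 0"
  shows "(\<lambda>k. polarized_volume (L k)) \<longlonglongrightarrow> polarized_volume Ks"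
  unfolding polarized_volume_def
proof (intro tendsto_divide tendsto_sum tendsto_mult tendsto_const)
  fix S assume S: "S \<in> Pow {..<DIM('a)}"
  then have finS: "finite S" using finite_subset by auto
  show "(\<lambda>k. vol (\<Sum>i\<in>S. L k ! i)) \<longlonglongrightarrow> vol (\<Sum>i\<in>S. Ks ! i)"
  proof (rule vol_outer_tendsto)
    show "body (\<Sum>i\<in>S. Ks ! i)" "body (\<Sum>i\<in>S. L k ! i)" for k using S Ks L by (auto intro!: body_sum)
    show "(\<Sum>i\<in>S. Ks ! i) \<subseteq> (\<Sum>i\<in>S. L k ! i)" for k using S sub by (intro set_sum_mono) auto
    show "(\<Sum>i\<in>S. L k ! i) \<subseteq> (\<Sum>i\<in>S. Ks ! i) + cball 0 (\<Sum>i\<in>S. e k)" for k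
      by (rule outer_sum[OF finS]) (use S sub(2) e(1) in blast)+
    show "(\<lambda>k. \<Sum>i\<in>S. e k) \<longlonglongrightarrow> 0" using tendsto_mult_right_zero[OF e(2), of "real (card S)"] by simp
  qed
qed (use bijections_Basis[where 'a='a] in \<open>auto simp: card_gt_0_iff\<close>)

text \<open>The cell decompositions of the approximating polytopes are unrelated for different k.
  After \<open>polarization\<close> the coefficients are fixed combinations of volumes, so both
  sides converge.\<close>

lemma polarized_volume_expansion:
  fixes K :: "nat \<Rightarrow> 'a::euclidean_space set"
  assumes K: "\<And>i. i < r \<Longrightarrow> body (K i)" and c: "\<And>i. i < r \<Longrightarrow> 0 \<le> c i"
  shows "vol (\<Sum>i<r. (*\<^sub>R) (c i) ` K i)
    = (\<Sum>js | length js = DIM('a) \<and> set js \<subseteq> {..<r}. polarized_volume (map K js) * prod_list (map c js))"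
proof -
  let ?L = "{js. length js = DIM('a) \<and> set js \<subseteq> {..<r}}"
  let ?e = "\<lambda>k. 1 / real (Suc k)"
  have e: "?e \<longlonglongrightarrow> 0" using LIMSEQ_inverse_real_of_nat by (simp add: inverse_eq_divide)
  define V where "V k i = (SOME V. finite V \<and> V \<noteq> {} \<and> K i \<subseteq> convex hull V
      \<and> convex hull V \<subseteq> K i + cball 0 (?e k))" for k i
  have "finite (V k i) \<and> V k i \<noteq> {} \<and> K i \<subseteq> convex hull V k i
      \<and> convex hull V k i \<subseteq> K i + cball 0 (?e k)" if i: "i < r" for i k
  proof -
    have "0 < ?e k" by simp
    then obtain W where "finite W" "W \<noteq> {}" "K i \<subseteq> convex hull W" "convex hull W \<subseteq> K i + cball 0 (?e k)"
      using outer_polytope[OF K[OF i]] by metis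
    then show ?thesis unfolding V_def
      by (intro someI_ex[of "\<lambda>V. finite V \<and> V \<noteq> {} \<and> K i \<subseteq> convex hull V \<and> convex hull V \<subseteq> K i + cball 0 (?e k)"]) auto
  qed
  then have V: "\<And>i k. i < r \<Longrightarrow> finite (V k i)" "\<And>i k. i < r \<Longrightarrow> V k i \<noteq> {}"
    "\<And>i k. i < r \<Longrightarrow> K i \<subseteq> convex hull (V k i)" "\<And>i k. i < r \<Longrightarrow> convex hull (V k i) \<subseteq> K i + cball 0 (?e k)"
    by blast+
  let ?P = "\<lambda>k i. convex hull (V k i)"
  have P: "body (?P k i)" if "i < r" for k i
    using V(1,2)[OF that, of k] by (auto simp: body_def finite_imp_compact_convex_hull)
  have *: "vol (\<Sum>i<r. (*\<^sub>R) (c i) ` ?P k i) = (\<Sum>js\<in>?L. polarized_volume (map (?P k) js) * prod_list (map c js))" for k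
  proof -
    have Vk: "\<forall>i<r. finite (V k i) \<and> V k i \<noteq> {}" using V(1,2) by blast
    obtain G :: "(nat \<times> 'a) set set" and C g where G: "\<forall>s\<in>G. \<forall>b\<in>Basis. g s b < r"
      "\<forall>c. (\<forall>i<r. 0 \<le> c i) \<longrightarrow>
         vol (\<Sum>i<r. (*\<^sub>R) (c i) ` ?P k i) = (\<Sum>s\<in>G. C s * (\<Prod>b\<in>(Basis::'a set). c (g s b)))"
      using polytope_volume_monomials_nonneg[OF Vk] by (elim exE conjE) (rule that; assumption)
    show ?thesis
    proof (rule polarization)
      show "vol (\<Sum>i<r. (*\<^sub>R) (c i) ` ?P k i) = (\<Sum>s\<in>G. C s * (\<Prod>b\<in>(Basis::'a set). c (g s b)))"
        if "\<And>i. i < r \<Longrightarrow> 0 \<le> c i" for c using G(2) that by blast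
    qed (use P G(1) c in auto)
  qed
  have "(\<lambda>k. vol (\<Sum>i<r. (*\<^sub>R) (c i) ` ?P k i)) \<longlonglongrightarrow> vol (\<Sum>i<r. (*\<^sub>R) (c i) ` K i)"
  proof (rule vol_outer_tendsto)
    show "body (\<Sum>i<r. (*\<^sub>R) (c i) ` K i)" "body (\<Sum>i<r. (*\<^sub>R) (c i) ` ?P k i)" for k
      using K P by (auto intro!: body_sum body_scale)
    show "(\<Sum>i<r. (*\<^sub>R) (c i) ` K i) \<subseteq> (\<Sum>i<r. (*\<^sub>R) (c i) ` ?P k i)" for k
      using V by (intro set_sum_mono scale_mono) auto
    show "(\<Sum>i<r. (*\<^sub>R) (c i) ` ?P k i) \<subseteq> (\<Sum>i<r. (*\<^sub>R) (c i) ` K i) + cball 0 (\<Sum>i<r. c i * ?e k)" for k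
      using V c by (intro outer_sum outer_scale) auto
    show "(\<lambda>k. \<Sum>i<r. c i * ?e k) \<longlonglongrightarrow> 0"
      using tendsto_mult_right_zero[OF e, of "sum c {..<r}"] by (simp add: sum_divide_distrib)
  qed
  moreover have "(\<lambda>k. \<Sum>js\<in>?L. polarized_volume (map (?P k) js) * prod_list (map c js))
      \<longlonglongrightarrow> (\<Sum>js\<in>?L. polarized_volume (map K js) * prod_list (map c js))"
  proof (intro tendsto_sum tendsto_mult tendsto_const)
    fix js assume js: "js \<in> ?L"
    have jsr: "js ! i < r" if "i < DIM('a)" for i using index_list_nth[OF _ _ that] js by blast
    show "(\<lambda>k. polarized_volume (map (?P k) js)) \<longlonglongrightarrow> polarized_volume (map K js)"
      by (rule polarized_volume_outer_tendsto[where e = ?e]) (use js jsr K P V e in auto)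
  qed
  ultimately show ?thesis using LIMSEQ_unique unfolding * by blast
qed

text \<open>Permuting the bodies permutes the subsets S and keeps their sizes.\<close>

lemma polarized_volume_cong_mset:
  fixes Ks :: "'a::euclidean_space set list"
  assumes "mset Ks = mset Ls" "length Ks = DIM('a)"
  shows "polarized_volume Ks = polarized_volume Ls"
proof -
  have len: "length Ls = DIM('a)" using assms mset_eq_length by metis
  obtain p where p: "p permutes {..<length Ls}" "permute_list p Ls = Ks"
    using mset_eq_permutation[OF assms(1)] .
  let ?I = "{..<DIM('a)}"
  have pI: "p permutes ?I" using p len by simp
  have bij: "bij_betw (image p) (Pow ?I) (Pow ?I)"
    by (rule bij_betw_Pow[OF permutes_imp_bij[OF pI]])
  have injp: "inj_on p S" for S using permutes_inj_on[OF pI] .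
  have "(\<Sum>S\<in>Pow ?I. (-1) ^ card (?I - S) * vol (\<Sum>i\<in>S. Ks ! i))
      = (\<Sum>S\<in>Pow ?I. (-1) ^ card (?I - p ` S) * vol (\<Sum>i\<in>p ` S. Ls ! i))"
  proof (intro sum.cong refl)
    fix S assume S: "S \<in> Pow ?I"
    have "?I - p ` S = p ` (?I - S)"
      using permutes_image[OF pI] image_set_diff[OF permutes_inj[OF pI], of ?I S] by simp
    then have "card (?I - p ` S) = card (?I - S)" using injp by (simp add: card_image)
    moreover have "(\<Sum>i\<in>p ` S. Ls ! i) = (\<Sum>i\<in>S. Ks ! i)"
      unfolding sum.reindex[OF injp] p(2)[symmetric] using S len p(1)
      by (intro sum.cong) (auto simp: permute_list_nth)
    ultimately show "(-1) ^ card (?I - S) * vol (\<Sum>i\<in>S. Ks ! i)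
        = (-1) ^ card (?I - p ` S) * vol (\<Sum>i\<in>p ` S. Ls ! i)" by simp
  qed
  also have "\<dots> = (\<Sum>S\<in>Pow ?I. (-1) ^ card (?I - S) * vol (\<Sum>i\<in>S. Ls ! i))"
    by (rule sum.reindex_bij_betw[OF bij])
  finally show ?thesis by (simp add: polarized_volume_def)
qed

lemma is_mixed_volume_mixed_volume: "is_mixed_volume (UNIV :: 'a::euclidean_space set) mixed_volume"
proof -
  \<comment> \<open>The value 0 is put on lists of other lengths because the symmetry of
    \<open>polarized_volume\<close> is established for lists with \<open>DIM('a)\<close>
    entries.\<close>
  let ?V = "\<lambda>Ks::'a set list. if {} \<in> set Ks \<or> length Ks \<noteq> DIM('a) then 0 else polarized_volume Ks"
  have "is_mixed_volume UNIV ?V"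
    unfolding is_mixed_volume_def
  proof (intro conjI allI impI)
    fix Ks Ls :: "'a set list" assume *: "mset Ks = mset Ls"
    then have "set Ks = set Ls" "length Ks = length Ls" using mset_eq_setD mset_eq_length by blast+
    then show "?V Ks = ?V Ls" using polarized_volume_cong_mset[OF *] by simp
  next
    fix r K and c :: "nat \<Rightarrow> real"
    assume "\<forall>i<r. compact (K i) \<and> convex (K i) \<and> K i \<noteq> {} \<and> K i \<subseteq> (UNIV::'a set) \<and> 0 \<le> c i"
    then have K: "\<And>i. i < r \<Longrightarrow> body (K i)" and c: "\<And>i. i < r \<Longrightarrow> 0 \<le> c i" by (auto simp: body_def)
    have "{} \<notin> set (map K js)" if "set js \<subseteq> {..<r}" for js
      using that bodyD(3)[OF K] by fastforce
    then have eq: "(\<Sum>js | length js = DIM('a) \<and> set js \<subseteq> {..<r}. ?V (map K js) * prod_list (map c js))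
        = (\<Sum>js | length js = DIM('a) \<and> set js \<subseteq> {..<r}. polarized_volume (map K js) * prod_list (map c js))"
      by (intro sum.cong) auto
    show "volume_in UNIV (\<Sum>i<r. (*\<^sub>R) (c i) ` K i) =
        (\<Sum>js | length js = dim (UNIV::'a set) \<and> set js \<subseteq> {..<r}. ?V (map K js) * prod_list (map c js))"
      unfolding volume_in_UNIV dim_UNIV eq by (rule polarized_volume_expansion[OF K c])
  qed simp
  then show ?thesis
    unfolding mixed_volume_in_def by (rule someI[of "is_mixed_volume (UNIV :: 'a set)"])
qed

lemma is_mixed_volume_expansion:
  fixes r :: nat
  assumes V: "is_mixed_volume E V"
    and K: "\<And>i. i < r \<Longrightarrow> body (K i) \<and> K i \<subseteq> E \<and> 0 \<le> c i"
  shows "volume_in E (\<Sum>i<r. (*\<^sub>R) (c i) ` K i)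
    = (\<Sum>js | length js = dim E \<and> set js \<subseteq> {..<r}. V (map K js) * prod_list (map c js))"
proof -
  have "\<forall>(r::nat) K c. (\<forall>i<r. compact (K i) \<and> convex (K i) \<and> K i \<noteq> {} \<and> K i \<subseteq> E \<and> 0 \<le> c i) \<longrightarrow>
      volume_in E (\<Sum>i<r. (*\<^sub>R) (c i) ` K i)
        = (\<Sum>js | length js = dim E \<and> set js \<subseteq> {..<r}. V (map K js) * prod_list (map c js))"
    using V unfolding is_mixed_volume_def by (elim conjE)
  moreover have "\<forall>i<r. compact (K i) \<and> convex (K i) \<and> K i \<noteq> {} \<and> K i \<subseteq> E \<and> 0 \<le> c i"
    using K by (simp add: body_def)
  ultimately show ?thesis by simp
qed

text \<open>Uniqueness: inserting 0/1 coefficients into the expansion expresses the alternating sum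
  of volumes through V, and \<open>ryser\<close> leaves only index lists that are permutations,
  where V takes one value by symmetry. This gives the chosen functional a formula, and hence
  continuity.\<close>

lemma mixed_volume_eq_pol:
  fixes V :: "'a::euclidean_space set list \<Rightarrow> real"
  assumes V: "is_mixed_volume UNIV V"
    and Ks: "length Ks = DIM('a)" "\<And>i. i < DIM('a) \<Longrightarrow> body (Ks ! i)"
  shows "V Ks = polarized_volume Ks"
proof -
  let ?n = "DIM('a)" and ?I = "{..<DIM('a)}" and ?B = "Basis :: 'a set"
  let ?Bij = "{g \<in> ?B \<rightarrow>\<^sub>E ?I. bij_betw g ?B ?I}"
  let ?L = "{js. length js = ?n \<and> set js \<subseteq> ?I}"
  note N = bijections_Basis[where 'a='a]
  have N0: "real (card ?Bij) \<noteq> 0" using N by (simp add: card_gt_0_iff)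
  obtain e where e: "bij_betw e ?B ?I"
    using finite_same_card_bij[of ?B ?I] by auto
  have symV: "V Ks = V Ls" if "mset Ks = mset Ls" for Ks Ls
    using V that unfolding is_mixed_volume_def by blast
  have vol: "vol (\<Sum>i\<in>S. Ks ! i) = (\<Sum>js\<in>?L. V (map ((!) Ks) js) * (\<Prod>b\<in>?B. \<Sum>i\<in>S. if i = js ! e b then 1 else 0))"
    if S: "S \<in> Pow ?I" for S
  proof -
    let ?c = "\<lambda>i. if i \<in> S then 1 else (0::real)"
    have finS: "finite S" using S finite_subset by auto
    have "(\<Sum>i\<in>S. Ks ! i) = (\<Sum>i<?n. if i \<in> S then Ks ! i else {0})"
    proof -
      have "(\<Sum>i\<in>S. Ks ! i) = (\<Sum>i\<in>S. if i \<in> S then Ks ! i else {0})" by (intro sum.cong) auto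
      also have "\<dots> = (\<Sum>i<?n. if i \<in> S then Ks ! i else {0})"
        using S by (intro sum.mono_neutral_left) auto
      finally show ?thesis .
    qed
    also have "\<dots> = (\<Sum>i<?n. (*\<^sub>R) (?c i) ` (Ks ! i))"
      using scale_zero[OF bodyD(3)[OF Ks(2)]] by (intro sum.cong) auto
    also have "vol \<dots> = (\<Sum>js | length js = dim (UNIV::'a set) \<and> set js \<subseteq> ?I. V (map ((!) Ks) js) * prod_list (map ?c js))"
      using is_mixed_volume_expansion[OF V, of ?n "(!) Ks" ?c] Ks(2) by (simp add: volume_in_UNIV)
    also have "\<dots> = (\<Sum>js\<in>?L. V (map ((!) Ks) js) * (\<Prod>b\<in>?B. \<Sum>i\<in>S. if i = js ! e b then 1 else 0))"
    proof (unfold dim_UNIV, intro sum.cong refl arg_cong2[where f="(*)"])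
      fix js assume js: "js \<in> ?L"
      have "prod_list (map ?c js) = (\<Prod>i\<in>?I. ?c (js ! i))"
        using js by (simp add: prod.list_conv_set_nth atLeast0LessThan)
      also have "\<dots> = (\<Prod>b\<in>?B. ?c (js ! e b))" by (rule prod.reindex_bij_betw[OF e, symmetric])
      also have "\<dots> = (\<Prod>b\<in>?B. \<Sum>i\<in>S. if i = js ! e b then 1 else 0)"
        using finS by (intro prod.cong refl) simp
      finally show "prod_list (map ?c js) = \<dots>" .
    qed
    finally show ?thesis .
  qed
  have "polarized_volume Ks * real (card ?Bij)
      = (\<Sum>S\<in>Pow ?I. (-1) ^ card (?I - S) * (\<Sum>js\<in>?L. V (map ((!) Ks) js) * (\<Prod>b\<in>?B. \<Sum>i\<in>S. if i = js ! e b then 1 else 0)))"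
    using N0 vol by (simp add: polarized_volume_def)
  also have "\<dots> = (\<Sum>S\<in>Pow ?I. \<Sum>js\<in>?L. V (map ((!) Ks) js) * ((-1) ^ card (?I - S) * (\<Prod>b\<in>?B. \<Sum>i\<in>S. if i = js ! e b then 1 else 0)))"
    unfolding sum_distrib_left by (intro sum.cong refl) (simp add: mult.left_commute)
  also have "\<dots> = (\<Sum>js\<in>?L. V (map ((!) Ks) js) * (\<Sum>S\<in>Pow ?I. (-1) ^ card (?I - S) * (\<Prod>b\<in>?B. \<Sum>i\<in>S. if i = js ! e b then 1 else 0)))"
    by (subst sum.swap) (simp add: sum_distrib_left)
  also have "\<dots> = (\<Sum>js\<in>?L. V (map ((!) Ks) js) * (\<Sum>h\<in>?Bij. \<Prod>l\<in>?B. if h l = js ! e l then 1 else 0))"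
    by (intro sum.cong refl arg_cong2[where f="(*)"] ryser) auto
  also have "\<dots> = (\<Sum>js\<in>?L. \<Sum>h\<in>?Bij. V (map ((!) Ks) js) * (\<Prod>l\<in>?B. if h l = js ! e l then 1 else 0))"
    unfolding sum_distrib_left ..
  also have "\<dots> = (\<Sum>h\<in>?Bij. \<Sum>js\<in>?L. V (map ((!) Ks) js) * (\<Prod>l\<in>?B. if h l = js ! e l then 1 else 0))"
    by (rule sum.swap)
  also have "\<dots> = (\<Sum>h\<in>?Bij. V Ks)"
  proof (intro sum.cong refl)
    fix h assume "h \<in> ?Bij"
    then have h: "bij_betw h ?B ?I" by simp
    define e' where "e' = inv_into ?B e"
    have e': "e' i \<in> ?B" "e (e' i) = i" if "i < ?n" for i
      using e that by (auto simp: e'_def bij_betw_def inv_into_into f_inv_into_f)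
    have ee: "e' (e l) = l" "e l < ?n" if "l \<in> ?B" for l
      using e that by (auto simp: e'_def bij_betw_def)
    have hl: "h l < ?n" if "l \<in> ?B" for l using h that by (auto simp: bij_betw_def)
    define js0 where "js0 = map (\<lambda>i. h (e' i)) [0..<?n]"
    have js0: "js0 \<in> ?L" using e' hl by (auto simp: js0_def)
    have iff: "(\<forall>l\<in>?B. h l = js ! e l) \<longleftrightarrow> js = js0" if "js \<in> ?L" for js
    proof
      assume *: "\<forall>l\<in>?B. h l = js ! e l"
      show "js = js0"
      proof (rule nth_equalityI)
        show "length js = length js0" using that js0 by simp
        fix i assume "i < length js"
        then have i: "i < ?n" using that by simp
        then have "h (e' i) = js ! i" using e'[OF i] * by metis
        then show "js ! i = js0 ! i" using i by (simp add: js0_def)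
      qed
    next
      assume "js = js0"
      then show "\<forall>l\<in>?B. h l = js ! e l" using ee by (simp add: js0_def)
    qed
    have "(\<Sum>js\<in>?L. V (map ((!) Ks) js) * (\<Prod>l\<in>?B. if h l = js ! e l then 1 else 0))
      = (\<Sum>js\<in>?L. if js = js0 then V (map ((!) Ks) js0) else 0)"
    proof (intro sum.cong refl)
      fix js assume js: "js \<in> ?L"
      have "(\<Prod>l\<in>?B. if h l = js ! e l then 1 else 0) = (if js = js0 then 1 else (0::real))"
      proof (cases "js = js0")
        case False
        then obtain l where "l \<in> ?B" "h l \<noteq> js ! e l" using iff[OF js] by blast
        then show ?thesis using False by (auto intro!: prod_zero)
      next
        case True
        then have "\<forall>l\<in>?B. h l = js ! e l" using iff[OF js] by blast
        then show ?thesis using True by (simp cong: prod.cong)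
      qed
      then show "V (map ((!) Ks) js) * (\<Prod>l\<in>?B. if h l = js ! e l then 1 else 0)
        = (if js = js0 then V (map ((!) Ks) js0) else 0)" by simp
    qed
    also have "\<dots> = V (map ((!) Ks) js0)" using js0 finite_index_lists by simp
    also have "\<dots> = V Ks"
    proof (rule symV)
      have "bij_betw (h \<circ> e') ?I ?I"
        using bij_betw_trans[OF bij_betw_inv_into[OF e] h] by (simp add: e'_def)
      then have "distinct js0" "set js0 = ?I"
        unfolding js0_def by (auto simp: distinct_map bij_betw_def atLeast0LessThan comp_def)
      then have "mset js0 = mset [0..<?n]"
        by (intro set_eq_iff_mset_eq_distinct[THEN iffD1]) (auto simp: atLeast0LessThan)
      then have "mset (map ((!) Ks) js0) = mset (map ((!) Ks) [0..<?n])" by simp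
      also have "map ((!) Ks) [0..<?n] = Ks" using Ks(1) map_nth[of Ks] by simp
      finally show "mset (map ((!) Ks) js0) = mset Ks" .
    qed
    finally show "(\<Sum>js\<in>?L. V (map ((!) Ks) js) * (\<Prod>l\<in>?B. if h l = js ! e l then 1 else 0)) = V Ks" .
  qed
  finally show ?thesis using N0 by simp
qed

section \<open>Second order expansion of volume polynomials\<close>

text \<open>A homogeneous polynomial of degree n in the variables c j, written over index lists as
  in \<open>is_mixed_volume\<close>; peeling off the head of the list allows induction on the
  degree.\<close>

definition list_sum :: "nat set \<Rightarrow> nat \<Rightarrow> (nat list \<Rightarrow> real) \<Rightarrow> (nat \<Rightarrow> real) \<Rightarrow> real" where
  "list_sum X n F c = (\<Sum>js | length js = n \<and> set js \<subseteq> X. F js * prod_list (map c js))"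

lemma list_sum_0: "list_sum X 0 F c = F []"
proof -
  have "{js. length js = 0 \<and> set js \<subseteq> X} = {[]}" by auto
  then show ?thesis unfolding list_sum_def by simp
qed

lemma list_sum_Suc:
  assumes "finite X"
  shows "list_sum X (Suc n) F c = (\<Sum>j\<in>X. c j * list_sum X n (\<lambda>js. F (j # js)) c)"
proof -
  let ?L = "{js. length js = n \<and> set js \<subseteq> X}"
  have "{js. length js = Suc n \<and> set js \<subseteq> X} = (\<lambda>(j, js). j # js) ` (X \<times> ?L)"
    by (auto simp: length_Suc_conv image_iff)
  moreover have "inj_on (\<lambda>(j, js). j # js) (X \<times> ?L)" by (auto simp: inj_on_def)
  ultimately have "list_sum X (Suc n) F c = (\<Sum>(j, js)\<in>X \<times> ?L. F (j # js) * (c j * prod_list (map c js)))"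
    unfolding list_sum_def by (simp add: sum.reindex case_prod_unfold)
  also have "\<dots> = (\<Sum>j\<in>X. \<Sum>js\<in>?L. F (j # js) * (c j * prod_list (map c js)))"
    by (rule sum.cartesian_product[symmetric])
  finally show ?thesis by (simp add: list_sum_def sum_distrib_left mult.left_commute)
qed

lemma list_sum_cong:
  "(\<And>js. F js = G js) \<Longrightarrow> (\<And>j. j \<in> X \<Longrightarrow> c j = d j) \<Longrightarrow> list_sum X n F c = list_sum X n G d"
  unfolding list_sum_def by (intro sum.cong refl arg_cong2[where f="(*)"] arg_cong[where f=prod_list]) auto

lemma list_sum_singleton: "c j = 1 \<Longrightarrow> list_sum {j} n F c = F (replicate n j)"
proof (induction n arbitrary: F)
  case (Suc n)
  then show ?case by (simp add: list_sum_Suc)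
qed (simp add: list_sum_0)

definition symmetric_fun :: "(nat list \<Rightarrow> real) \<Rightarrow> bool" where
  "symmetric_fun F \<longleftrightarrow> (\<forall>js ks. mset js = mset ks \<longrightarrow> F js = F ks)"

lemma symmetric_fun_Cons: "symmetric_fun F \<Longrightarrow> symmetric_fun (\<lambda>js. F (j # js))"
  by (simp add: symmetric_fun_def)

text \<open>On t \<ge> 0 the function is a polynomial with these first three coefficients. The
  remainder is left open, since nothing beyond the second order is compared.\<close>

definition expands :: "(real \<Rightarrow> real) \<Rightarrow> real \<Rightarrow> real \<Rightarrow> real \<Rightarrow> bool" where
  "expands f a b c \<longleftrightarrow> (\<exists>R. \<forall>t\<ge>0. f t = a + t * b + t\<^sup>2 * c + t ^ 3 * poly R t)"

lemma expands_cong: "expands f a b c \<Longrightarrow> (\<And>t. t \<ge> 0 \<Longrightarrow> g t = f t) \<Longrightarrow> expands g a b c"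
  by (auto simp: expands_def)

lemma expands_add: "expands f a b c \<Longrightarrow> expands g a' b' c' \<Longrightarrow> expands (\<lambda>t. f t + g t) (a + a') (b + b') (c + c')"
proof -
  assume "expands f a b c" "expands g a' b' c'"
  then obtain R R' where "\<forall>t\<ge>0. f t = a + t * b + t\<^sup>2 * c + t ^ 3 * poly R t"
    "\<forall>t\<ge>0. g t = a' + t * b' + t\<^sup>2 * c' + t ^ 3 * poly R' t" by (auto simp: expands_def)
  then show ?thesis unfolding expands_def by (intro exI[of _ "R + R'"]) (simp add: algebra_simps)
qed

lemma expands_cmult: "expands f a b c \<Longrightarrow> expands (\<lambda>t. k * f t) (k * a) (k * b) (k * c)"
proof -
  assume "expands f a b c"
  then obtain R where "\<forall>t\<ge>0. f t = a + t * b + t\<^sup>2 * c + t ^ 3 * poly R t" by (auto simp: expands_def)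
  then show ?thesis unfolding expands_def by (intro exI[of _ "smult k R"]) (simp add: algebra_simps)
qed

lemma expands_shift: "expands f a b c \<Longrightarrow> expands (\<lambda>t. t * f t) 0 a b"
proof -
  assume "expands f a b c"
  then obtain R where "\<forall>t\<ge>0. f t = a + t * b + t\<^sup>2 * c + t ^ 3 * poly R t" by (auto simp: expands_def)
  then show ?thesis unfolding expands_def
    by (intro exI[of _ "pCons c R"]) (simp add: algebra_simps power2_eq_square power3_eq_cube)
qed

lemma expands_const: "expands (\<lambda>t. a) a 0 0"
  unfolding expands_def by (intro exI[of _ 0]) simp

lemma expands_sum:
  "(\<And>i. i \<in> I \<Longrightarrow> expands (f i) (a i) (b i) (c i)) \<Longrightarrow>
    expands (\<lambda>t. \<Sum>i\<in>I. f i t) (\<Sum>i\<in>I. a i) (\<Sum>i\<in>I. b i) (\<Sum>i\<in>I. c i)"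
  by (induction I rule: infinite_finite_induct) (auto intro: expands_add simp: expands_const)

lemma expands_poly_eq:
  assumes "expands f a b c"
  obtains p where "\<And>t. t \<ge> 0 \<Longrightarrow> f t = poly p t" "coeff p 0 = a" "coeff p 1 = b" "coeff p 2 = c"
proof -
  obtain R where R: "\<forall>t\<ge>0. f t = a + t * b + t\<^sup>2 * c + t ^ 3 * poly R t" using assms by (auto simp: expands_def)
  let ?p = "pCons a (pCons b (pCons c R))"
  show thesis
  proof (rule that[of ?p])
    show "f t = poly ?p t" if "t \<ge> 0" for t
      using R that by (simp add: algebra_simps power2_eq_square power3_eq_cube)
  qed (simp_all add: numeral_2_eq_2)
qed

lemma poly_eq_on_nonneg:
  fixes p q :: "real poly"
  assumes "\<And>t. t > 0 \<Longrightarrow> poly p t = poly q t"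
  shows "p = q"
proof (rule ccontr)
  assume "p \<noteq> q"
  then have "finite {t. poly (p - q) t = 0}" by (intro poly_roots_finite) simp
  moreover have "{0<..} \<subseteq> {t. poly (p - q) t = 0}" using assms by auto
  ultimately show False using infinite_Ioi[of "0::real"] finite_subset by blast
qed

lemma expands_unique:
  assumes "expands f a b c" "expands g a' b' c'" "\<And>t. t > 0 \<Longrightarrow> f t = g t"
  shows "a = a'" "b = b'" "c = c'"
proof -
  obtain p where p: "\<And>t. t \<ge> 0 \<Longrightarrow> f t = poly p t" "coeff p 0 = a" "coeff p 1 = b" "coeff p 2 = c"
    using expands_poly_eq[OF assms(1)] by metis
  obtain q where q: "\<And>t. t \<ge> 0 \<Longrightarrow> g t = poly q t" "coeff q 0 = a'" "coeff q 1 = b'" "coeff q 2 = c'"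
    using expands_poly_eq[OF assms(2)] by metis
  have "p = q"
  proof (rule poly_eq_on_nonneg)
    fix t :: real assume "t > 0"
    then show "poly p t = poly q t" using assms(3)[of t] p(1)[of t] q(1)[of t] by simp
  qed
  then show "a = a'" "b = b'" "c = c'" using p q by auto
qed

text \<open>As the constant terms agree, b and b' are limits of the difference quotients at 0 from
  the right, which are ordered.\<close>

lemma expands_mono:
  assumes f: "expands f a b c" and g: "expands g a b' c'" and le: "\<And>t. t > 0 \<Longrightarrow> f t \<le> g t"
  shows "b \<le> b'"
proof -
  have lim: "((\<lambda>t. (f t - a) / t) \<longlongrightarrow> b) (at_right 0)" if f: "expands f a b c" for f b c
  proof -
    obtain R where R: "\<forall>t\<ge>0. f t = a + t * b + t\<^sup>2 * c + t ^ 3 * poly R t" using f by (auto simp: expands_def)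
    have "((\<lambda>t. b + t * c + t\<^sup>2 * poly R t) \<longlongrightarrow> b + 0 * c + 0\<^sup>2 * poly R 0) (at_right 0)"
      by (intro tendsto_intros)
    moreover have "\<forall>\<^sub>F t in at_right 0. b + t * c + t\<^sup>2 * poly R t = (f t - a) / t"
      using eventually_at_right_less[of "0::real"]
    proof eventually_elim
      case (elim t)
      have "f t - a = t * (b + t * c + t\<^sup>2 * poly R t)"
        using R elim by (simp add: algebra_simps power2_eq_square power3_eq_cube)
      then show ?case using elim by simp
    qed
    ultimately show ?thesis by (simp add: tendsto_cong)
  qed
  have "\<forall>\<^sub>F t in at_right 0. (f t - a) / t \<le> (g t - a) / t"
    using eventually_at_right_less[of "0::real"]
    by eventually_elim (use le in \<open>auto intro: divide_right_mono\<close>)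
  then show ?thesis using lim[OF f] lim[OF g] trivial_limit_at_right_real tendsto_le by blast
qed

text \<open>Induction on the degree by the head of the list: a head in J contributes y, and a head
  in I contributes a factor t, which shifts the coefficients by one order. Symmetry of F moves the
  entries from I to the front. Where n - 1 or n - 2 is truncated, the factor n or n (n - 1) is
  0.\<close>

lemma list_sum_expands:
  assumes fin: "finite J" "finite I" and dis: "J \<inter> I = {}"
  shows "symmetric_fun F \<Longrightarrow> expands (\<lambda>t. list_sum (J \<union> I) n F (\<lambda>k. if k \<in> I then t * x k else y k))
      (list_sum J n F y)
      (real n * (\<Sum>i\<in>I. x i * list_sum J (n - 1) (\<lambda>js. F (i # js)) y))
      (real n * (real n - 1) / 2 * (\<Sum>i\<in>I. \<Sum>i'\<in>I. x i * x i' * list_sum J (n - 2) (\<lambda>js. F (i # i' # js)) y))"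
proof (induction n arbitrary: F)
  case 0
  then show ?case by (simp add: list_sum_0 expands_const)
next
  case (Suc n)
  let ?c = "\<lambda>t k. if k \<in> I then t * x k else y k"
  let ?S = "\<lambda>t j. list_sum (J \<union> I) n (\<lambda>js. F (j # js)) (?c t)"
  define A where "A j = list_sum J n (\<lambda>js. F (j # js)) y" for j
  define B where "B j = real n * (\<Sum>i\<in>I. x i * list_sum J (n - 1) (\<lambda>js. F (j # i # js)) y)" for j
  define C where "C j = real n * (real n - 1) / 2 * (\<Sum>i\<in>I. \<Sum>i'\<in>I. x i * x i' * list_sum J (n - 2) (\<lambda>js. F (j # i # i' # js)) y)" for j
  have IH: "expands (\<lambda>t. ?S t j) (A j) (B j) (C j)" for j
    unfolding A_def B_def C_def by (rule Suc.IH[OF symmetric_fun_Cons[OF Suc.prems]])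
  have "expands (\<lambda>t. (\<Sum>j\<in>J. y j * ?S t j) + (\<Sum>i\<in>I. x i * (t * ?S t i)))
     ((\<Sum>j\<in>J. y j * A j) + (\<Sum>i\<in>I. x i * 0))
     ((\<Sum>j\<in>J. y j * B j) + (\<Sum>i\<in>I. x i * A i))
     ((\<Sum>j\<in>J. y j * C j) + (\<Sum>i\<in>I. x i * B i))"
    by (intro expands_add expands_sum expands_cmult expands_shift[OF IH] IH)
  moreover have "(\<Sum>j\<in>J. y j * ?S t j) + (\<Sum>i\<in>I. x i * (t * ?S t i)) = list_sum (J \<union> I) (Suc n) F (?c t)" for t
  proof -
    have "list_sum (J \<union> I) (Suc n) F (?c t) = (\<Sum>j\<in>J \<union> I. ?c t j * ?S t j)"
      using fin by (simp add: list_sum_Suc)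
    also have "\<dots> = (\<Sum>j\<in>J. ?c t j * ?S t j) + (\<Sum>j\<in>I. ?c t j * ?S t j)"
      using fin dis by (rule sum.union_disjoint)
    also have "(\<Sum>j\<in>J. ?c t j * ?S t j) = (\<Sum>j\<in>J. y j * ?S t j)"
      using dis by (intro sum.cong refl) auto
    also have "(\<Sum>j\<in>I. ?c t j * ?S t j) = (\<Sum>i\<in>I. x i * (t * ?S t i))"
      by (intro sum.cong refl) simp
    finally show ?thesis by simp
  qed
  moreover have "(\<Sum>j\<in>J. y j * A j) + (\<Sum>i\<in>I. x i * 0) = list_sum J (Suc n) F y"
    using fin by (simp add: list_sum_Suc A_def)
  moreover have "(\<Sum>j\<in>J. y j * B j) + (\<Sum>i\<in>I. x i * A i)
      = real (Suc n) * (\<Sum>i\<in>I. x i * list_sum J (Suc n - 1) (\<lambda>js. F (i # js)) y)"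
  proof -
    \<comment> \<open>Exchanging the sums and moving j behind i reassembles the sum over j into a
      list sum of degree one higher.\<close>
    have "(\<Sum>j\<in>J. y j * B j) = real n * (\<Sum>i\<in>I. x i * A i)"
    proof (cases n)
      case (Suc m)
      have "(\<Sum>j\<in>J. y j * B j) = (\<Sum>j\<in>J. \<Sum>i\<in>I. real n * (x i * (y j * list_sum J m (\<lambda>js. F (j # i # js)) y)))"
        unfolding B_def Suc sum_distrib_left by (intro sum.cong refl) (simp add: mult_ac)
      also have "\<dots> = (\<Sum>i\<in>I. \<Sum>j\<in>J. real n * (x i * (y j * list_sum J m (\<lambda>js. F (j # i # js)) y)))" by (rule sum.swap)
      also have "\<dots> = (\<Sum>i\<in>I. real n * (x i * (\<Sum>j\<in>J. y j * list_sum J m (\<lambda>js. F (i # j # js)) y)))"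
        unfolding sum_distrib_left using Suc.prems
        by (intro sum.cong refl arg_cong2[where f="(*)"] list_sum_cong) (auto simp: symmetric_fun_def)
      finally show ?thesis unfolding A_def Suc using fin by (simp add: list_sum_Suc sum_distrib_left)
    qed (simp add: B_def)
    then show ?thesis by (simp add: A_def algebra_simps)
  qed
  moreover have "(\<Sum>j\<in>J. y j * C j) + (\<Sum>i\<in>I. x i * B i)
      = real (Suc n) * (real (Suc n) - 1) / 2 * (\<Sum>i\<in>I. \<Sum>i'\<in>I. x i * x i' * list_sum J (Suc n - 2) (\<lambda>js. F (i # i' # js)) y)"
  proof -
    define D where "D = (\<Sum>i\<in>I. \<Sum>i'\<in>I. x i * x i' * list_sum J (Suc n - 2) (\<lambda>js. F (i # i' # js)) y)"
    have "(\<Sum>i\<in>I. x i * B i) = real n * D"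
      unfolding B_def D_def sum_distrib_left by (intro sum.cong refl) (simp add: mult_ac)
    moreover have "(\<Sum>j\<in>J. y j * C j) = real n * (real n - 1) / 2 * D"
    proof (cases "n \<le> 1")
      case True
      then have "n = 0 \<or> n = 1" by auto
      then show ?thesis by (auto simp: C_def)
    next
      case False
      then obtain m where m: "n = Suc (Suc m)" by (cases n; cases "n - 1") auto
      let ?k = "real n * (real n - 1) / 2"
      have "(\<Sum>j\<in>J. y j * C j) = (\<Sum>j\<in>J. \<Sum>i\<in>I. \<Sum>i'\<in>I. ?k * (x i * x i' * (y j * list_sum J m (\<lambda>js. F (j # i # i' # js)) y)))"
        unfolding C_def m sum_distrib_left by (intro sum.cong refl) (simp add: mult_ac)
      also have "\<dots> = (\<Sum>i\<in>I. \<Sum>j\<in>J. \<Sum>i'\<in>I. ?k * (x i * x i' * (y j * list_sum J m (\<lambda>js. F (j # i # i' # js)) y)))"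
        by (rule sum.swap)
      also have "\<dots> = (\<Sum>i\<in>I. \<Sum>i'\<in>I. \<Sum>j\<in>J. ?k * (x i * x i' * (y j * list_sum J m (\<lambda>js. F (j # i # i' # js)) y)))"
        by (intro sum.cong refl sum.swap)
      also have "\<dots> = (\<Sum>i\<in>I. \<Sum>i'\<in>I. ?k * (x i * x i' * (\<Sum>j\<in>J. y j * list_sum J m (\<lambda>js. F (i # i' # j # js)) y)))"
        unfolding sum_distrib_left using Suc.prems
        by (intro sum.cong refl arg_cong2[where f="(*)"] list_sum_cong) (auto simp: symmetric_fun_def)
      also have "\<dots> = ?k * D"
        unfolding D_def m using fin by (simp add: list_sum_Suc sum_distrib_left)
      finally show ?thesis .
    qed
    ultimately have "(\<Sum>j\<in>J. y j * C j) + (\<Sum>i\<in>I. x i * B i) = real n * (real n - 1) / 2 * D + real n * D" by simp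
    also have "\<dots> = real (Suc n) * (real (Suc n) - 1) / 2 * D" by (simp add: field_simps)
    finally show ?thesis unfolding D_def .
  qed
  ultimately show ?case by simp
qed

text \<open>First and second variation of the volume at A. The body A gets the index r with
  coefficient 1, and K i gets the coefficient t x i, so that \<open>list_sum_expands\<close> applies
  with J = {r}.\<close>

lemma mixed_volume_expands:
  fixes V :: "'a::euclidean_space set list \<Rightarrow> real" and r :: nat
  assumes V: "is_mixed_volume E V" and A: "body A" "A \<subseteq> E"
    and K: "\<And>i. i < r \<Longrightarrow> body (K i)" "\<And>i. i < r \<Longrightarrow> K i \<subseteq> E" and x: "\<And>i. i < r \<Longrightarrow> 0 \<le> x i"
  shows "expands (\<lambda>t. volume_in E (A + (*\<^sub>R) t ` (\<Sum>i<r. (*\<^sub>R) (x i) ` K i)))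
    (volume_in E A)
    (\<Sum>i<r. x i * (real (dim E) * V (replicate (dim E - 1) A @ [K i])))
    (1/2 * (\<Sum>i<r. \<Sum>j<r. x i * x j * (real (dim E) * (real (dim E) - 1) * V (replicate (dim E - 2) A @ [K i, K j]))))"
proof -
  let ?m = "dim E"
  define L where "L i = (if i < r then K i else A)" for i
  have symV: "V Ks = V Ls" if "mset Ks = mset Ls" for Ks Ls
    using V that unfolding is_mixed_volume_def by blast
  have sym: "symmetric_fun (\<lambda>js. V (map L js))"
    unfolding symmetric_fun_def using symV by (metis mset_map)
  have vol: "volume_in E (A + (*\<^sub>R) t ` (\<Sum>i<r. (*\<^sub>R) (x i) ` K i))
      = list_sum ({r} \<union> {..<r}) ?m (\<lambda>js. V (map L js)) (\<lambda>k. if k \<in> {..<r} then t * x k else 1)"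
    (is "_ = list_sum _ _ _ ?c") if t: "t \<ge> 0" for t
  proof -
    have "A + (*\<^sub>R) t ` (\<Sum>i<r. (*\<^sub>R) (x i) ` K i) = (\<Sum>i<Suc r. (*\<^sub>R) (?c i) ` L i)"
      by (simp add: L_def scale_sum scale_scale add.commute)
    moreover have "volume_in E (\<Sum>i<Suc r. (*\<^sub>R) (?c i) ` L i)
        = (\<Sum>js | length js = ?m \<and> set js \<subseteq> {..<Suc r}. V (map L js) * prod_list (map ?c js))"
      by (rule is_mixed_volume_expansion[OF V]) (use A K x t in \<open>auto simp: L_def\<close>)
    moreover have "{..<Suc r} = {r} \<union> {..<r}" by auto
    ultimately show ?thesis by (simp only: list_sum_def)
  qed
  have ex: "expands (\<lambda>t. list_sum ({r} \<union> {..<r}) ?m (\<lambda>js. V (map L js)) (\<lambda>k. if k \<in> {..<r} then t * x k else 1))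
    (list_sum {r} ?m (\<lambda>js. V (map L js)) (\<lambda>_. 1))
    (real ?m * (\<Sum>i\<in>{..<r}. x i * list_sum {r} (?m - 1) (\<lambda>js. V (map L (i # js))) (\<lambda>_. 1)))
    (real ?m * (real ?m - 1) / 2 * (\<Sum>i\<in>{..<r}. \<Sum>j\<in>{..<r}. x i * x j * list_sum {r} (?m - 2) (\<lambda>js. V (map L (i # j # js))) (\<lambda>_. 1)))"
    by (rule list_sum_expands[OF _ _ _ sym]) auto
  \<comment> \<open>The term with A alone is the value at t = 0, where the second summand is
    {0}.\<close>
  have 0: "list_sum {r} ?m (\<lambda>js. V (map L js)) (\<lambda>_. 1) = volume_in E A"
  proof -
    have b: "body (\<Sum>i<r. (*\<^sub>R) (x i) ` K i)" using K by (intro body_sum body_scale) auto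
    then have "volume_in E A = volume_in E (A + (*\<^sub>R) 0 ` (\<Sum>i<r. (*\<^sub>R) (x i) ` K i))"
      unfolding scale_zero[OF bodyD(3)[OF b]] by simp
    also have "\<dots> = list_sum ({r} \<union> {..<r}) ?m (\<lambda>js. V (map L js)) (\<lambda>k. if k \<in> {..<r} then 0 * x k else 1)"
      by (rule vol) simp
    also have "\<dots> = list_sum {r} ?m (\<lambda>js. V (map L js)) (\<lambda>_. 1)"
      using ex by (auto simp: expands_def)
    finally show ?thesis by simp
  qed
  have 1: "list_sum {r} (?m - 1) (\<lambda>js. V (map L (i # js))) (\<lambda>_. 1) = V (replicate (?m - 1) A @ [K i])"
    if "i < r" for i
    using that by (simp add: list_sum_singleton L_def) (rule symV, simp)
  have 2: "list_sum {r} (?m - 2) (\<lambda>js. V (map L (i # j # js))) (\<lambda>_. 1) = V (replicate (?m - 2) A @ [K i, K j])"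
    if "i < r" "j < r" for i j
    using that by (simp add: list_sum_singleton L_def) (rule symV, simp)
  have e1: "real ?m * (\<Sum>i\<in>{..<r}. x i * list_sum {r} (?m - 1) (\<lambda>js. V (map L (i # js))) (\<lambda>_. 1))
      = (\<Sum>i<r. x i * (real ?m * V (replicate (?m - 1) A @ [K i])))"
    unfolding sum_distrib_left by (intro sum.cong refl) (simp only: 1 lessThan_iff mult_ac)
  have e2: "real ?m * (real ?m - 1) / 2 * (\<Sum>i\<in>{..<r}. \<Sum>j\<in>{..<r}. x i * x j * list_sum {r} (?m - 2) (\<lambda>js. V (map L (i # j # js))) (\<lambda>_. 1))
      = 1/2 * (\<Sum>i<r. \<Sum>j<r. x i * x j * (real ?m * (real ?m - 1) * V (replicate (?m - 2) A @ [K i, K j])))"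
    unfolding sum_distrib_left by (intro sum.cong refl) (simp only: 2 lessThan_iff, simp)
  show ?thesis by (rule expands_cong[OF ex[unfolded 0 e1 e2] vol])
qed

section \<open>Projections and volumes in subspaces\<close>

text \<open>An orthogonal transformation carries \<open>Basis\<close> to B and preserves
  \<open>lborel\<close>, which is a product measure in the standard coordinates.\<close>

lemma emeasure_orthonormal_box:
  fixes B :: "'a::euclidean_space set"
  assumes orth: "pairwise orthogonal B" and n1: "\<And>b. b \<in> B \<Longrightarrow> norm b = 1" and sp: "span B = UNIV"
    and A: "\<And>b. b \<in> B \<Longrightarrow> A b \<in> sets borel"
  shows "emeasure lborel {x. \<forall>b\<in>B. x \<bullet> b \<in> A b} = (\<Prod>b\<in>B. emeasure lborel (A b))"
proof -
  have "0 \<notin> B" using n1 by force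
  with orth have ind: "independent B" by (rule pairwise_orthogonal_independent)
  then have fin: "finite B" by (rule independent_imp_finite)
  have card: "card (Basis :: 'a set) = card B"
    using ind sp by (metis dim_UNIV dim_span dim_eq_card_independent)
  obtain g where g: "bij_betw g (Basis :: 'a set) B"
    using finite_same_card_bij [OF finite_Basis fin card] by blast
  have gB: "g b \<in> B" if "b \<in> Basis" for b using g that by (auto simp: bij_betw_def)
  define T where "T x = (\<Sum>b\<in>Basis. (x \<bullet> b) *\<^sub>R g b)" for x
  have lin: "linear T"
    unfolding T_def by (intro linear_compose_sum ballI linearI)
      (auto simp: inner_left_distrib scaleR_left_distrib)
  have gg: "g b \<bullet> g c = (if b = c then 1 else 0)" if "b \<in> Basis" "c \<in> Basis" for b c
  proof (cases "b = c")
    case True then show ?thesis using n1[OF gB[OF that(1)]] by (simp add: norm_eq_1)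
  next
    case False
    then have "g b \<noteq> g c" using g that by (auto simp: bij_betw_def inj_on_def)
    then show ?thesis using orth gB that False by (auto simp: pairwise_def orthogonal_def)
  qed
  have Tg: "T x \<bullet> g c = x \<bullet> c" if "c \<in> Basis" for x c
  proof -
    have "T x \<bullet> g c = (\<Sum>b\<in>Basis. if b = c then x \<bullet> c else 0)"
      unfolding T_def inner_sum_left by (intro sum.cong refl) (auto simp: gg that)
    then show ?thesis using that by simp
  qed
  have "T x \<bullet> T y = x \<bullet> y" for x y
  proof -
    have "T x \<bullet> T y = (\<Sum>b\<in>Basis. (y \<bullet> b) * (T x \<bullet> g b))"
      by (subst (2) T_def) (simp add: inner_sum_right)
    also have "\<dots> = x \<bullet> y" by (simp add: Tg euclidean_inner[of x y] mult.commute)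
    finally show ?thesis .
  qed
  with lin have T: "orthogonal_transformation T" by (simp add: orthogonal_transformation_def)
  have [measurable]: "T \<in> borel_measurable borel"
    by (intro borel_measurable_continuous_onI linear_continuous_on) (simp add: lin linear_linear)
  let ?S = "{x. \<forall>b\<in>B. x \<bullet> b \<in> A b}"
  have box: "{x. \<forall>b\<in>D. x \<bullet> b \<in> A' b} \<in> sets borel"
    if "finite D" "\<And>b. b \<in> D \<Longrightarrow> A' b \<in> sets borel" for D :: "'a set" and A' :: "'a \<Rightarrow> real set"
  proof -
    have "{x \<in> space borel. \<forall>b\<in>D. x \<bullet> b \<in> A' b} \<in> sets borel"
    proof (intro sets.sets_Collect_finite_All that(1))
      fix b assume b: "b \<in> D"
      have "(\<lambda>x. x \<bullet> b) \<in> borel_measurable borel" by simp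
      from measurable_sets[OF this that(2)[OF b]] show "{x \<in> space borel. x \<bullet> b \<in> A' b} \<in> sets borel"
        by (simp add: vimage_def)
    qed
    then show ?thesis by simp
  qed
  interpret product_sigma_finite "\<lambda>_::'a. lborel :: real measure" ..
  have "emeasure lborel ?S = emeasure (distr lborel borel T) ?S"
    by (simp add: distr_orthogonal_lborel[OF T])
  also have "\<dots> = emeasure lborel (T -` ?S)"
    using box[OF fin A] by (subst emeasure_distr) auto
  also have "T -` ?S = {y. \<forall>b\<in>Basis. y \<bullet> b \<in> A (g b)}"
  proof -
    have "(\<forall>b\<in>B. T y \<bullet> b \<in> A b) \<longleftrightarrow> (\<forall>b\<in>Basis. T y \<bullet> g b \<in> A (g b))" for y
      using g by (auto simp: bij_betw_def)
    then have "T -` ?S = {y. \<forall>b\<in>Basis. T y \<bullet> g b \<in> A (g b)}" by auto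
    also have "\<dots> = {y. \<forall>b\<in>Basis. y \<bullet> b \<in> A (g b)}" by (simp add: Tg cong: ball_cong)
    finally show ?thesis .
  qed
  also have "emeasure lborel \<dots> = emeasure (distr (\<Pi>\<^sub>M b\<in>Basis. lborel) borel (\<lambda>f. \<Sum>b\<in>Basis. f b *\<^sub>R b)) \<dots>"
    by (simp only: lborel_eq[symmetric])
  also have "\<dots> = emeasure (\<Pi>\<^sub>M b\<in>Basis. lborel) (\<Pi>\<^sub>E b\<in>Basis. A (g b))"
    using box[of Basis "\<lambda>b. A (g b)"] A gB
    by (subst emeasure_distr) (auto simp: space_PiM PiE_def Pi_def vimage_def intro!: arg_cong2[where f=emeasure])
  also have "\<dots> = (\<Prod>b\<in>Basis. emeasure lborel (A (g b)))"
    using A gB by (intro emeasure_PiM) auto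
  also have "\<dots> = (\<Prod>b\<in>B. emeasure lborel (A b))"
    by (rule prod.reindex_bij_betw [OF g])
  finally show ?thesis .
qed

lemma distr_orthonormal_coordinates:
  fixes B :: "'a::euclidean_space set"
  assumes orth: "pairwise orthogonal B" and n1: "\<And>b. b \<in> B \<Longrightarrow> norm b = 1" and sp: "span B = UNIV"
  shows "distr lborel (\<Pi>\<^sub>M b\<in>B. lborel) (\<lambda>x. \<lambda>b\<in>B. x \<bullet> b) = (\<Pi>\<^sub>M b\<in>B. lborel)"
proof -
  interpret product_sigma_finite "\<lambda>_::'a. lborel :: real measure" ..
  have "0 \<notin> B" using n1 by force
  with orth have fin: "finite B" using pairwise_orthogonal_independent independent_imp_finite by blast
  have m: "(\<lambda>x. \<lambda>b\<in>B. x \<bullet> b) \<in> measurable lborel (\<Pi>\<^sub>M b\<in>B. lborel)"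
    by (intro measurable_restrict) auto
  show ?thesis
  proof (rule PiM_eqI[OF fin])
    fix A :: "'a \<Rightarrow> real set" assume A: "\<And>i. i \<in> B \<Longrightarrow> A i \<in> sets lborel"
    have "emeasure (distr lborel (\<Pi>\<^sub>M b\<in>B. lborel) (\<lambda>x. \<lambda>b\<in>B. x \<bullet> b)) (Pi\<^sub>E B A)
        = emeasure lborel {x. \<forall>b\<in>B. x \<bullet> b \<in> A b}"
      using A fin by (subst emeasure_distr[OF m])
        (auto intro!: sets_PiM_I_finite arg_cong2[where f=emeasure] simp: PiE_iff)
    also have "\<dots> = (\<Prod>b\<in>B. emeasure lborel (A b))"
      using A by (intro emeasure_orthonormal_box orth n1 sp) auto
    finally show "emeasure (distr lborel (\<Pi>\<^sub>M b\<in>B. lborel) (\<lambda>x. \<lambda>b\<in>B. x \<bullet> b)) (Pi\<^sub>E B A)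
        = (\<Prod>b\<in>B. emeasure lborel (A b))" .
  qed simp
qed

lemma subspace_decomp:
  fixes E :: "'a::euclidean_space set"
  assumes "subspace E"
  obtains y z where "y \<in> E" "z \<in> E\<^sup>\<bottom>" "x = y + z"
proof -
  obtain y z where yz: "y \<in> span E" "\<And>w. w \<in> span E \<Longrightarrow> orthogonal z w" "x = y + z"
    using orthogonal_subspace_decomp_exists[of E x] by blast
  have "span E = E" using assms by (simp add: span_eq_iff)
  with yz(1,2) have "y \<in> E" "z \<in> E\<^sup>\<bottom>"
    by (auto simp: orthogonal_comp_def orthogonal_commute)
  then show thesis using yz(3) by (rule that)
qed

text \<open>Fubini in orthonormal coordinates: the basis chosen in \<open>lborel_in E\<close> is
  completed by C to a basis of the space. There X plus a box over C is a product set, and the factor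
  over B is by construction the measure on E.\<close>

lemma volume_in_prism:
  fixes X :: "'a::euclidean_space set"
  assumes E: "subspace E" and C: "orthonormal_basis_of (E\<^sup>\<bottom>) C"
    and X: "body X" "X \<subseteq> E" and s: "0 \<le> s"
  shows "vol (X + (\<Sum>c\<in>C. closed_segment 0 (s *\<^sub>R c))) = s ^ card C * volume_in E X"
proof -
  define B where "B = (SOME B. orthonormal_basis_of E B)"
  have "orthonormal_basis_of E B"
    unfolding B_def by (rule orthonormal_basis_of_exists[OF E])
  then have BE: "B \<subseteq> E" and orthB: "pairwise orthogonal B" and nB: "\<And>b. b \<in> B \<Longrightarrow> norm b = 1" and spB: "span B = E"
    by (auto simp: orthonormal_basis_of_def)
  have CE: "C \<subseteq> E\<^sup>\<bottom>" and orthC: "pairwise orthogonal C" and nC: "\<And>b. b \<in> C \<Longrightarrow> norm b = 1" and spC: "span C = E\<^sup>\<bottom>"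
    using C by (auto simp: orthonormal_basis_of_def)
  have EC: "x \<bullet> c = 0" if "x \<in> E" "c \<in> E\<^sup>\<bottom>" for x c
    using that by (auto simp: orthogonal_comp_def orthogonal_def inner_commute)
  have dis: "B \<inter> C = {}"
  proof (rule ccontr)
    assume "B \<inter> C \<noteq> {}"
    then obtain b where "b \<in> B" "b \<in> C" by blast
    then have "b \<bullet> b = 0" using EC BE CE by blast
    with nB[OF \<open>b \<in> B\<close>] show False by simp
  qed
  have fin: "finite B" "finite C"
    using pairwise_orthogonal_independent[OF orthB] pairwise_orthogonal_independent[OF orthC]
      independent_imp_finite nB nC by (metis norm_zero zero_neq_one)+
  have orth: "pairwise orthogonal (B \<union> C)"
    unfolding pairwise_def
  proof (intro ballI impI)
    fix x y assume xy: "x \<in> B \<union> C" "y \<in> B \<union> C" "x \<noteq> y"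
    have "orthogonal x y" if "x \<in> B" "y \<in> C" for x y
      using EC[of x y] that BE CE by (auto simp: orthogonal_def)
    with xy orthB orthC show "orthogonal x y"
      using orthogonal_commute[of x y] by (auto simp: pairwise_def)
  qed
  have n1: "norm b = 1" if "b \<in> B \<union> C" for b using that nB nC by blast
  have sp: "span (B \<union> C) = UNIV"
  proof -
    have "x \<in> span (B \<union> C)" for x
    proof -
      obtain y z where "y \<in> E" "z \<in> E\<^sup>\<bottom>" "x = y + z" using subspace_decomp[OF E] by blast
      then show ?thesis using spB spC span_mono[of B "B \<union> C"] span_mono[of C "B \<union> C"]
        by (auto intro!: span_add)
    qed
    then show ?thesis by auto
  qed
  define pr where "pr x = (\<Sum>b\<in>B. (x \<bullet> b) *\<^sub>R b)" for x
  have prE: "pr x = x" if "x \<in> E" for x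
    unfolding pr_def using orthonormal_basis_expand[OF orthB nB _ fin(1), of x] that spB by simp
  let ?P = "\<Sum>c\<in>C. closed_segment 0 (s *\<^sub>R c)"
  \<comment> \<open>The sum in terms of coordinates: those along B give the point of X, and each one
    along C ranges over [0,s].\<close>
  have W: "X + ?P = {x. pr x \<in> X \<and> (\<forall>c\<in>C. x \<bullet> c \<in> {0..s})}"
  proof
    show "X + ?P \<subseteq> {x. pr x \<in> X \<and> (\<forall>c\<in>C. x \<bullet> c \<in> {0..s})}"
    proof
      fix x assume "x \<in> X + ?P"
      then obtain y z where yz: "y \<in> X" "z \<in> ?P" "x = y + z" by (rule set_plus_elim)
      then obtain f where f: "z = sum f C" "\<forall>c\<in>C. f c \<in> closed_segment 0 (s *\<^sub>R c)"
        by (auto simp: set_sum_alt[OF fin(2)])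
      have "\<forall>c\<in>C. \<exists>t. 0 \<le> t \<and> t \<le> s \<and> f c = t *\<^sub>R c"
      proof
        fix c assume "c \<in> C"
        then obtain u where "0 \<le> u" "u \<le> 1" "f c = u *\<^sub>R (s *\<^sub>R c)"
          using f(2) by (auto simp: in_segment)
        then show "\<exists>t. 0 \<le> t \<and> t \<le> s \<and> f c = t *\<^sub>R c"
          using s by (intro exI[of _ "u * s"]) (auto simp: mult_left_le_one_le)
      qed
      then obtain t where t: "\<And>c. c \<in> C \<Longrightarrow> 0 \<le> t c \<and> t c \<le> s \<and> f c = t c *\<^sub>R c" by metis
      have z: "z = (\<Sum>c\<in>C. t c *\<^sub>R c)" unfolding f(1) by (rule sum.cong) (simp_all add: t)
      have zE: "z \<in> E\<^sup>\<bottom>" unfolding z spC[symmetric] by (intro span_sum span_scale span_base)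
      have zb: "z \<bullet> b = 0" if "b \<in> B" for b using EC[of b z] zE BE that by (auto simp: inner_commute)
      have "pr x = pr y" unfolding pr_def yz(3) by (intro sum.cong refl) (simp add: inner_left_distrib zb)
      then have "pr x \<in> X" using prE[of y] yz(1) X(2) by auto
      moreover have "x \<bullet> c = t c" if c: "c \<in> C" for c
      proof -
        have "x \<bullet> c = z \<bullet> c" using EC[of y c] yz X(2) CE c by (auto simp: inner_left_distrib)
        also have "\<dots> = (\<Sum>d\<in>C. if d = c then t c else 0)"
          unfolding z inner_sum_left using orthC nC c
          by (intro sum.cong refl) (auto simp: pairwise_def orthogonal_def norm_eq_1)
        also have "\<dots> = t c" using c fin by simp
        finally show ?thesis .
      qed
      ultimately show "x \<in> {x. pr x \<in> X \<and> (\<forall>c\<in>C. x \<bullet> c \<in> {0..s})}" using t by auto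
    qed
    show "{x. pr x \<in> X \<and> (\<forall>c\<in>C. x \<bullet> c \<in> {0..s})} \<subseteq> X + ?P"
    proof
      fix x assume x: "x \<in> {x. pr x \<in> X \<and> (\<forall>c\<in>C. x \<bullet> c \<in> {0..s})}"
      have "finite (B \<union> C)" using fin by simp
      then have "x = (\<Sum>b\<in>B \<union> C. (x \<bullet> b) *\<^sub>R b)"
        using orthonormal_basis_expand[OF orth n1, of x] sp by simp
      also have "\<dots> = pr x + (\<Sum>c\<in>C. (x \<bullet> c) *\<^sub>R c)"
        unfolding pr_def using fin dis by (intro sum.union_disjoint) auto
      also have "\<dots> \<in> X + ?P"
      proof (intro set_plus_intro)
        show "pr x \<in> X" using x by simp
        have "(x \<bullet> c) *\<^sub>R c \<in> closed_segment 0 (s *\<^sub>R c)" if "c \<in> C" for c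
        proof (cases "s = 0")
          case False
          with s have "s > 0" by simp
          then show ?thesis using x that
            by (auto simp: in_segment intro!: exI[of _ "(x \<bullet> c) / s"])
        qed (use x that in \<open>force\<close>)
        then show "(\<Sum>c\<in>C. (x \<bullet> c) *\<^sub>R c) \<in> ?P"
          unfolding set_sum_alt[OF fin(2)] by blast
      qed
      finally show "x \<in> X + ?P" .
    qed
  qed
  interpret product_sigma_finite "\<lambda>_::'a. lborel :: real measure" ..
  let ?MB = "\<Pi>\<^sub>M b\<in>B. (lborel :: real measure)" and ?MC = "\<Pi>\<^sub>M b\<in>C. (lborel :: real measure)"
  let ?M = "\<Pi>\<^sub>M b\<in>B \<union> C. (lborel :: real measure)"
  have Xm: "X \<in> sets borel" using X by (simp add: body_borel)
  define SB where "SB = {f \<in> space ?MB. (\<Sum>b\<in>B. f b *\<^sub>R b) \<in> X}"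
  have cmB: "(\<lambda>f. \<Sum>b\<in>B. f b *\<^sub>R b) \<in> borel_measurable ?MB"
    by measurable
  have SBm: "SB \<in> sets ?MB"
    unfolding SB_def using measurable_sets[OF cmB Xm] by (simp add: vimage_def Int_def conj_commute)
  define SM where "SM = {f \<in> space ?M. (\<Sum>b\<in>B. f b *\<^sub>R b) \<in> X \<and> (\<forall>c\<in>C. f c \<in> {0..s})}"
  have SMm: "SM \<in> sets ?M"
  proof -
    have "(\<lambda>f. \<Sum>b\<in>B. f b *\<^sub>R b) \<in> borel_measurable ?M"
      by (intro borel_measurable_sum borel_measurable_scaleR borel_measurable_const) measurable
    from measurable_sets[OF this Xm] have "{f \<in> space ?M. (\<Sum>b\<in>B. f b *\<^sub>R b) \<in> X} \<in> sets ?M"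
      by (simp add: vimage_def Int_def conj_commute)
    moreover have "{f \<in> space ?M. \<forall>c\<in>C. f c \<in> {0..s}} \<in> sets ?M"
      using fin(2)
    proof (intro sets.sets_Collect_finite_All)
      fix c assume "c \<in> C"
      then have "(\<lambda>f. f c) \<in> measurable ?M lborel" by (intro measurable_component_singleton) simp
      from measurable_sets[OF this, of "{0..s}"] show "{f \<in> space ?M. f c \<in> {0..s}} \<in> sets ?M"
        by (simp add: vimage_def Int_def conj_commute)
    qed
    moreover have "SM = {f \<in> space ?M. (\<Sum>b\<in>B. f b *\<^sub>R b) \<in> X} \<inter> {f \<in> space ?M. \<forall>c\<in>C. f c \<in> {0..s}}"
      by (auto simp: SM_def)
    ultimately show ?thesis by (simp only: sets.Int)
  qed
  have "emeasure lborel (X + ?P) = emeasure (distr lborel ?M (\<lambda>x. \<lambda>b\<in>B \<union> C. x \<bullet> b)) SM"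
    using SMm by (subst emeasure_distr)
      (auto simp: W SM_def pr_def space_PiM intro!: measurable_restrict arg_cong2[where f=emeasure] cong: sum.cong)
  also have "\<dots> = emeasure ?M SM"
    by (simp only: distr_orthonormal_coordinates[OF orth n1 sp])
  also have "\<dots> = emeasure (distr (?MB \<Otimes>\<^sub>M ?MC) ?M (merge B C)) SM"
    by (simp only: distr_merge[OF dis fin])
  also have "\<dots> = emeasure (?MB \<Otimes>\<^sub>M ?MC) (SB \<times> (\<Pi>\<^sub>E c\<in>C. {0..s}))"
  proof -
    have "merge B C -` SM \<inter> space (?MB \<Otimes>\<^sub>M ?MC) = SB \<times> (\<Pi>\<^sub>E c\<in>C. {0..s})"
    proof -
      have 1: "(\<Sum>b\<in>B. merge B C (f, h) b *\<^sub>R b) = (\<Sum>b\<in>B. f b *\<^sub>R b)" for f h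
        by (intro sum.cong refl) (simp add: merge_def)
      have 2: "(\<forall>c\<in>C. 0 \<le> merge B C (f, h) c \<and> merge B C (f, h) c \<le> s) \<longleftrightarrow> (\<forall>c\<in>C. 0 \<le> h c \<and> h c \<le> s)" for f h
        using dis by (auto simp: merge_def)
      have "(f, h) \<in> merge B C -` SM \<inter> space (?MB \<Otimes>\<^sub>M ?MC) \<longleftrightarrow> (f, h) \<in> SB \<times> (\<Pi>\<^sub>E c\<in>C. {0..s})" for f h
        by (simp add: SM_def SB_def 1 2 space_pair_measure space_PiM PiE_iff) blast
      then show ?thesis by (intro set_eqI) (metis surj_pair)
    qed
    then show ?thesis
      using SMm measurable_merge[of B C "\<lambda>_. lborel :: real measure"] by (simp add: emeasure_distr)
  qed
  also have "\<dots> = emeasure ?MB SB * emeasure ?MC (\<Pi>\<^sub>E c\<in>C. {0..s})"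
  proof -
    interpret C: sigma_finite_measure ?MC by (rule sigma_finite[OF fin(2)])
    show ?thesis using SBm fin by (intro C.emeasure_pair_measure_Times sets_PiM_I_finite) auto
  qed
  also have "emeasure ?MC (\<Pi>\<^sub>E c\<in>C. {0..s}) = ennreal (s ^ card C)"
    using fin s by (subst emeasure_PiM) (auto simp: ennreal_power)
  also have "emeasure ?MB SB = emeasure (lborel_in E) X"
    unfolding lborel_in_def B_def[symmetric] Let_def SB_def using Xm cmB
    by (subst emeasure_distr) (auto intro!: arg_cong2[where f=emeasure])
  finally show ?thesis
    using s by (simp add: measure_def volume_in_def enn2real_mult mult.commute)
qed

section \<open>Orthogonal projection as a linear map\<close>

lemma orth_proj_props:
  assumes E: "subspace (E :: 'a::euclidean_space set)"
  shows "orth_proj E x \<in> E" "x - orth_proj E x \<in> E\<^sup>\<bottom>"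
    and "\<And>y. y \<in> E \<Longrightarrow> x - y \<in> E\<^sup>\<bottom> \<Longrightarrow> orth_proj E x = y"
proof -
  have EC: "y \<bullet> z = 0" if "y \<in> E" "z \<in> E\<^sup>\<bottom>" for y z
    using that by (auto simp: orthogonal_comp_def orthogonal_def inner_commute)
  have uniq: "y = y'" if "y \<in> E" "x - y \<in> E\<^sup>\<bottom>" "y' \<in> E" "x - y' \<in> E\<^sup>\<bottom>" for y y'
  proof -
    have "(x - y') - (x - y) \<in> E\<^sup>\<bottom>" using that subspace_orthogonal_comp subspace_diff by blast
    then have "y - y' \<in> E\<^sup>\<bottom>" by simp
    moreover have "y - y' \<in> E" using that E subspace_diff by blast
    ultimately have "(y - y') \<bullet> (y - y') = 0" by (rule EC[rotated])
    then show ?thesis by simp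
  qed
  obtain y z where "y \<in> E" "z \<in> E\<^sup>\<bottom>" "x = y + z"
    using subspace_decomp[OF E] by blast
  then have "y \<in> E \<and> x - y \<in> E\<^sup>\<bottom>" by simp
  then have *: "orth_proj E x \<in> E \<and> x - orth_proj E x \<in> E\<^sup>\<bottom>"
    unfolding orth_proj_def by (rule theI) (use uniq \<open>y \<in> E \<and> x - y \<in> E\<^sup>\<bottom>\<close> in blast)
  then show "orth_proj E x \<in> E" "x - orth_proj E x \<in> E\<^sup>\<bottom>" by auto
  show "orth_proj E x = y" if "y \<in> E" "x - y \<in> E\<^sup>\<bottom>" for y using uniq that * by blast
qed

lemma linear_orth_proj:
  assumes E: "subspace (E :: 'a::euclidean_space set)"
  shows "linear (orth_proj E)"
proof (rule linearI)
  note E' = subspace_orthogonal_comp[of E]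
  fix x y :: 'a
  have "(x - orth_proj E x) + (y - orth_proj E y) \<in> E\<^sup>\<bottom>"
    using orth_proj_props[OF E] E' subspace_add by blast
  then show "orth_proj E (x + y) = orth_proj E x + orth_proj E y"
    by (intro orth_proj_props(3)[OF E] subspace_add[OF E] orth_proj_props(1)[OF E]) (simp add: algebra_simps)
next
  note E' = subspace_orthogonal_comp[of E]
  fix x :: 'a and c
  have "c *\<^sub>R (x - orth_proj E x) \<in> E\<^sup>\<bottom>" using orth_proj_props[OF E] E' subspace_scale by blast
  then show "orth_proj E (c *\<^sub>R x) = c *\<^sub>R orth_proj E x"
    by (intro orth_proj_props(3)[OF E] subspace_scale[OF E] orth_proj_props(1)[OF E]) (simp add: algebra_simps)
qed

lemma orth_proj_id: "subspace E \<Longrightarrow> x \<in> E \<Longrightarrow> orth_proj E x = (x :: 'a::euclidean_space)"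
  by (rule orth_proj_props(3)) (auto simp: subspace_0 subspace_orthogonal_comp)

section \<open>Adding segments\<close>

text \<open>The factor n makes this the derivative of |A + tK| at t = 0, which for the unit ball is
  the surface area.\<close>

definition mixed_linear :: "'a::euclidean_space set \<Rightarrow> 'a set \<Rightarrow> real" where
  "mixed_linear A K = real DIM('a) * mixed_volume (replicate (DIM('a) - 1) A @ [K])"

text \<open>The factor n (n - 1) makes this the mixed second derivative of |A + sK + tL| at 0. With
  both normalizations the constant n / (n - 1) of the zonoid inequality becomes 1.\<close>

definition mixed_bilinear :: "'a::euclidean_space set \<Rightarrow> 'a set \<Rightarrow> 'a set \<Rightarrow> real" where
  "mixed_bilinear A K L = real DIM('a) * (real DIM('a) - 1) * mixed_volume (replicate (DIM('a) - 2) A @ [K, L])"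

lemma vol_expands_sum:
  fixes A :: "'a::euclidean_space set" and r :: nat
  assumes "body A" "\<And>i. i < r \<Longrightarrow> body (K i)" "\<And>i. i < r \<Longrightarrow> 0 \<le> x i"
  shows "expands (\<lambda>t. vol (A + (*\<^sub>R) t ` (\<Sum>i<r. (*\<^sub>R) (x i) ` K i))) (vol A)
    (\<Sum>i<r. x i * mixed_linear A (K i)) (1/2 * (\<Sum>i<r. \<Sum>j<r. x i * x j * mixed_bilinear A (K i) (K j)))"
  using mixed_volume_expands[OF is_mixed_volume_mixed_volume assms(1) subset_UNIV assms(2) subset_UNIV assms(3)]
  by (simp only: volume_in_UNIV dim_UNIV mixed_linear_def mixed_bilinear_def)

lemma scale_one [simp]: "(*\<^sub>R) 1 ` K = (K :: 'a::real_vector set)"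
  by simp

lemma vol_expands:
  assumes "body A" "body K"
  shows "expands (\<lambda>t. vol (A + (*\<^sub>R) t ` K)) (vol A) (mixed_linear A K) (1/2 * mixed_bilinear A K K)"
  using vol_expands_sum[of A 1 "\<lambda>_. K" "\<lambda>_. 1"] assms by simp

text \<open>One volume is expanded twice, with the sum as a single body and in its summands; the
  coefficients agree by uniqueness.\<close>

lemma mixed_linear_sum:
  fixes r :: nat
  assumes "body A" "\<And>i. i < r \<Longrightarrow> body (K i)" "\<And>i. i < r \<Longrightarrow> 0 \<le> x i"
  shows "mixed_linear A (\<Sum>i<r. (*\<^sub>R) (x i) ` K i) = (\<Sum>i<r. x i * mixed_linear A (K i))"
    "mixed_bilinear A (\<Sum>i<r. (*\<^sub>R) (x i) ` K i) (\<Sum>i<r. (*\<^sub>R) (x i) ` K i)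
      = (\<Sum>i<r. \<Sum>j<r. x i * x j * mixed_bilinear A (K i) (K j))"
proof -
  have b: "body (\<Sum>i<r. (*\<^sub>R) (x i) ` K i)" using assms by (intro body_sum body_scale) auto
  note u = expands_unique[OF vol_expands[OF assms(1) b] vol_expands_sum[OF assms] refl]
  show "mixed_linear A (\<Sum>i<r. (*\<^sub>R) (x i) ` K i) = (\<Sum>i<r. x i * mixed_linear A (K i))" by (rule u(2))
  show "mixed_bilinear A (\<Sum>i<r. (*\<^sub>R) (x i) ` K i) (\<Sum>i<r. (*\<^sub>R) (x i) ` K i)
      = (\<Sum>i<r. \<Sum>j<r. x i * x j * mixed_bilinear A (K i) (K j))" using u(3) by simp
qed

lemma mixed_linear_add:
  assumes "body A" "body K" "body L" "0 \<le> s" "0 \<le> t"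
  shows "mixed_linear A ((*\<^sub>R) s ` K + (*\<^sub>R) t ` L) = s * mixed_linear A K + t * mixed_linear A L"
  using mixed_linear_sum(1)[of A 2 "\<lambda>i. if i = 0 then K else L" "\<lambda>i. if i = 0 then s else t"] assms
  by (simp add: numeral_2_eq_2)

lemma mixed_bilinear_commute: "mixed_bilinear A K L = mixed_bilinear A L K"
proof -
  have "mixed_volume Ks = mixed_volume Ls" if "mset Ks = mset Ls" for Ks Ls :: "'a set list"
    using is_mixed_volume_mixed_volume[where 'a='a] that unfolding is_mixed_volume_def by blast
  then show ?thesis unfolding mixed_bilinear_def by simp
qed

lemma mixed_bilinear_quadratic:
  assumes "body A" "body K" "body L" "0 \<le> s" "0 \<le> t"
  shows "mixed_bilinear A ((*\<^sub>R) s ` K + (*\<^sub>R) t ` L) ((*\<^sub>R) s ` K + (*\<^sub>R) t ` L)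
    = s\<^sup>2 * mixed_bilinear A K K + 2 * s * t * mixed_bilinear A K L + t\<^sup>2 * mixed_bilinear A L L"
  using mixed_linear_sum(2)[of A 2 "\<lambda>i. if i = 0 then K else L" "\<lambda>i. if i = 0 then s else t"] assms
  by (simp add: numeral_2_eq_2 mixed_bilinear_commute[of A L K] power2_eq_square algebra_simps)

text \<open>Monotonicity of the volume passes to the first derivative, as both expansions start with
  |A|.\<close>

lemma mixed_linear_mono:
  assumes A: "body A" and K: "body K" "body L" "K \<subseteq> L"
  shows "mixed_linear A K \<le> mixed_linear A L"
proof (rule expands_mono[OF vol_expands[OF A K(1)] vol_expands[OF A K(2)]])
  fix t :: real
  show "vol (A + (*\<^sub>R) t ` K) \<le> vol (A + (*\<^sub>R) t ` L)"
    using A K by (intro vol_mono body_plus body_scale set_plus_mono2 scale_mono) auto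
qed

lemma segment_scale: "closed_segment 0 (s *\<^sub>R u) = (*\<^sub>R) s ` closed_segment 0 (u :: 'a::euclidean_space)"
  by (simp add: scale_segment)

lemma mem_segment_scale: "0 \<le> s \<Longrightarrow> x \<in> closed_segment 0 (s *\<^sub>R u) \<longleftrightarrow> (\<exists>t. 0 \<le> t \<and> t \<le> s \<and> x = t *\<^sub>R u)"
  for u :: "'a::euclidean_space"
proof (cases "s = 0")
  case False
  assume "0 \<le> s"
  with False have s: "0 < s" by simp
  show ?thesis
  proof
    assume "x \<in> closed_segment 0 (s *\<^sub>R u)"
    then obtain a where "0 \<le> a" "a \<le> 1" "x = a *\<^sub>R s *\<^sub>R u" by (auto simp: in_segment)
    then show "\<exists>t. 0 \<le> t \<and> t \<le> s \<and> x = t *\<^sub>R u"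
      using s by (intro exI[of _ "a * s"]) (auto simp: mult_left_le_one_le)
  next
    assume "\<exists>t. 0 \<le> t \<and> t \<le> s \<and> x = t *\<^sub>R u"
    then obtain t where "0 \<le> t" "t \<le> s" "x = t *\<^sub>R u" by blast
    then show "x \<in> closed_segment 0 (s *\<^sub>R u)"
      using s unfolding in_segment by (intro exI[of _ "t / s"]) auto
  qed
qed auto

text \<open>A point of A and its projection differ by a vector with coordinates at most \<rho> along
  C. After a shift by - \<rho> along every c, a box longer by 2 \<rho> absorbs the difference, in
  both directions. So the volume of A plus a long box grows like that of a prism over the
  projection.\<close>

lemma prism_squeeze:
  fixes A :: "'a::euclidean_space set"
  assumes E: "subspace E" and C: "orthonormal_basis_of (E\<^sup>\<bottom>) C" and A: "body A"
  obtains R where "0 \<le> R"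
    "\<And>s. 0 \<le> s \<Longrightarrow> s ^ card C * volume_in E (orth_proj E ` A) \<le> vol (A + (\<Sum>c\<in>C. closed_segment 0 ((s + R) *\<^sub>R c)))"
    "\<And>s. 0 \<le> s \<Longrightarrow> vol (A + (\<Sum>c\<in>C. closed_segment 0 (s *\<^sub>R c))) \<le> (s + R) ^ card C * volume_in E (orth_proj E ` A)"
proof -
  let ?P = "orth_proj E" and ?W = "\<lambda>s. \<Sum>c\<in>C. closed_segment 0 (s *\<^sub>R c)"
  have orthC: "pairwise orthogonal C" and nC: "\<And>b. b \<in> C \<Longrightarrow> norm b = 1" and spC: "span C = E\<^sup>\<bottom>"
    using C by (auto simp: orthonormal_basis_of_def)
  have "0 \<notin> C" using nC by force
  with orthC have fin: "finite C" using pairwise_orthogonal_independent independent_imp_finite by blast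
  have PA: "body (?P ` A)" "?P ` A \<subseteq> E"
    using A orth_proj_props(1)[OF E] by (auto intro: body_linear_image linear_orth_proj[OF E])
  have bW: "body (?W s)" for s by (intro body_sum body_segment)
  obtain \<rho> where \<rho>: "0 < \<rho>" "\<And>x. x \<in> A \<Longrightarrow> norm x \<le> \<rho>"
    using compact_imp_bounded[OF bodyD(1)[OF A]] bounded_pos by blast
  have W: "x \<in> ?W s \<longleftrightarrow> (\<exists>t. (\<forall>c\<in>C. 0 \<le> t c \<and> t c \<le> s) \<and> x = (\<Sum>c\<in>C. t c *\<^sub>R c))" if "0 \<le> s" for x s
  proof
    assume "x \<in> ?W s"
    then obtain f where f: "x = sum f C" "\<forall>c\<in>C. f c \<in> closed_segment 0 (s *\<^sub>R c)"
      by (auto simp: set_sum_alt[OF fin])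
    then have "\<forall>c\<in>C. \<exists>t. 0 \<le> t \<and> t \<le> s \<and> f c = t *\<^sub>R c"
      using that by (simp add: mem_segment_scale)
    then obtain t where "\<forall>c\<in>C. 0 \<le> t c \<and> t c \<le> s \<and> f c = t c *\<^sub>R c" by metis
    then show "\<exists>t. (\<forall>c\<in>C. 0 \<le> t c \<and> t c \<le> s) \<and> x = (\<Sum>c\<in>C. t c *\<^sub>R c)"
      unfolding f(1) by (intro exI[of _ t]) auto
  next
    assume "\<exists>t. (\<forall>c\<in>C. 0 \<le> t c \<and> t c \<le> s) \<and> x = (\<Sum>c\<in>C. t c *\<^sub>R c)"
    then obtain t where "\<forall>c\<in>C. 0 \<le> t c \<and> t c \<le> s" "x = (\<Sum>c\<in>C. t c *\<^sub>R c)" by blast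
    then show "x \<in> ?W s"
      unfolding set_sum_alt[OF fin] using that
      by (intro CollectI exI[of _ "\<lambda>c. t c *\<^sub>R c"]) (auto simp: mem_segment_scale)
  qed
  let ?w = "\<Sum>c\<in>C. (- \<rho>) *\<^sub>R c"
  have Px: "x - ?P x = (\<Sum>c\<in>C. (x \<bullet> c) *\<^sub>R c)" for x
  proof -
    have "(x - ?P x) \<bullet> c = x \<bullet> c" if "c \<in> C" for c
    proof -
      have "c \<in> E\<^sup>\<bottom>" using C that by (auto simp: orthonormal_basis_of_def)
      then have "?P x \<bullet> c = 0" using orth_proj_props(1)[OF E, of x]
        by (auto simp: orthogonal_comp_def orthogonal_def)
      then show ?thesis by (simp add: inner_diff_left)
    qed
    moreover have "(\<Sum>c\<in>C. ((x - ?P x) \<bullet> c) *\<^sub>R c) = x - ?P x"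
      using orth_proj_props(2)[OF E, of x] spC by (intro orthonormal_basis_expand orthC nC fin) auto
    ultimately show ?thesis by (simp cong: sum.cong)
  qed
  have xc: "\<bar>x \<bullet> c\<bar> \<le> \<rho>" if "x \<in> A" "c \<in> C" for x c
    using Cauchy_Schwarz_ineq2[of x c] nC[OF that(2)] \<rho>(2)[OF that(1)] by simp
  have sub1: "?P ` A + ?W s \<subseteq> {?w} + (A + ?W (s + 2 * \<rho>))" if s: "0 \<le> s" for s
  proof
    fix z assume "z \<in> ?P ` A + ?W s"
    then obtain x y where xy: "x \<in> A" "y \<in> ?W s" "z = ?P x + y" by (auto elim!: set_plus_elim)
    obtain t where t: "\<forall>c\<in>C. 0 \<le> t c \<and> t c \<le> s" "y = (\<Sum>c\<in>C. t c *\<^sub>R c)" using W[OF s] xy(2) by blast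
    \<comment> \<open>Subtracting x \<bullet> c compensates the passage from the projection back to
      x, and \<rho> restores nonnegativity; the shift \<open>?w\<close> undoes the \<rho>.\<close>
    let ?t = "\<lambda>c. t c - x \<bullet> c + \<rho>"
    have "z = x - (x - ?P x) + y" using xy(3) by simp
    then have z_eq: "z = ?w + (x + (\<Sum>c\<in>C. ?t c *\<^sub>R c))"
      unfolding Px t(2) by (simp add: scaleR_add_left scaleR_diff_left sum.distrib sum_subtractf sum_negf)
    have mem: "(\<Sum>c\<in>C. ?t c *\<^sub>R c) \<in> ?W (s + 2 * \<rho>)"
    proof (subst W)
      show "0 \<le> s + 2 * \<rho>" using s \<rho> by simp
      have "0 \<le> ?t c \<and> ?t c \<le> s + 2 * \<rho>" if "c \<in> C" for c
        using t(1)[rule_format, OF that] xc[OF xy(1) that] by (auto simp: abs_le_iff)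
      then show "\<exists>t. (\<forall>c\<in>C. 0 \<le> t c \<and> t c \<le> s + 2 * \<rho>) \<and> (\<Sum>c\<in>C. ?t c *\<^sub>R c) = (\<Sum>c\<in>C. t c *\<^sub>R c)"
        by (intro exI[of _ ?t]) simp
    qed
    show "z \<in> {?w} + (A + ?W (s + 2 * \<rho>))"
      unfolding z_eq by (intro set_plus_intro singletonI xy(1) mem)
  qed
  have sub2: "A + ?W s \<subseteq> {?w} + (?P ` A + ?W (s + 2 * \<rho>))" if s: "0 \<le> s" for s
  proof
    fix z assume "z \<in> A + ?W s"
    then obtain x y where xy: "x \<in> A" "y \<in> ?W s" "z = x + y" by (auto elim!: set_plus_elim)
    obtain t where t: "\<forall>c\<in>C. 0 \<le> t c \<and> t c \<le> s" "y = (\<Sum>c\<in>C. t c *\<^sub>R c)" using W[OF s] xy(2) by blast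
    let ?t = "\<lambda>c. t c + x \<bullet> c + \<rho>"
    have "z = ?P x + (x - ?P x) + y" using xy(3) by simp
    then have z_eq: "z = ?w + (?P x + (\<Sum>c\<in>C. ?t c *\<^sub>R c))"
      unfolding Px t(2) by (simp add: scaleR_add_left scaleR_diff_left sum.distrib sum_subtractf sum_negf)
    have mem: "(\<Sum>c\<in>C. ?t c *\<^sub>R c) \<in> ?W (s + 2 * \<rho>)"
    proof (subst W)
      show "0 \<le> s + 2 * \<rho>" using s \<rho> by simp
      have "0 \<le> ?t c \<and> ?t c \<le> s + 2 * \<rho>" if "c \<in> C" for c
        using t(1)[rule_format, OF that] xc[OF xy(1) that] by (auto simp: abs_le_iff)
      then show "\<exists>t. (\<forall>c\<in>C. 0 \<le> t c \<and> t c \<le> s + 2 * \<rho>) \<and> (\<Sum>c\<in>C. ?t c *\<^sub>R c) = (\<Sum>c\<in>C. t c *\<^sub>R c)"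
        by (intro exI[of _ ?t]) simp
    qed
    show "z \<in> {?w} + (?P ` A + ?W (s + 2 * \<rho>))"
      unfolding z_eq by (intro set_plus_intro singletonI imageI xy(1) mem)
  qed
  show thesis
  proof (rule that[of "2 * \<rho>"])
    show "0 \<le> 2 * \<rho>" using \<rho> by simp
    fix s :: real assume s: "0 \<le> s"
    have "s ^ card C * volume_in E (?P ` A) = vol (?P ` A + ?W s)"
      by (rule volume_in_prism[OF E C PA s, symmetric])
    also have "\<dots> \<le> vol ({?w} + (A + ?W (s + 2 * \<rho>)))"
      using sub1[OF s] PA(1) A bW by (intro vol_mono body_plus body_singleton)
    also have "\<dots> = vol (A + ?W (s + 2 * \<rho>))" using A bW by (intro vol_translation body_plus)
    finally show "s ^ card C * volume_in E (?P ` A) \<le> vol (A + ?W (s + 2 * \<rho>))" .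
    have "vol (A + ?W s) \<le> vol ({?w} + (?P ` A + ?W (s + 2 * \<rho>)))"
      using sub2[OF s] PA(1) A bW by (intro vol_mono body_plus body_singleton)
    also have "\<dots> = vol (?P ` A + ?W (s + 2 * \<rho>))" using PA bW by (intro vol_translation body_plus)
    also have "\<dots> = (s + 2 * \<rho>) ^ card C * volume_in E (?P ` A)"
      using s \<rho> by (intro volume_in_prism[OF E C PA]) simp
    finally show "vol (A + ?W s) \<le> (s + 2 * \<rho>) ^ card C * volume_in E (?P ` A)" .
  qed
qed

section \<open>Comparing polynomials by their growth\<close>

lemma bounded_poly_const:
  fixes p :: "real poly"
  assumes "\<And>s. 0 \<le> s \<Longrightarrow> \<bar>poly p s\<bar> \<le> B"
  shows "degree p = 0"
proof (rule ccontr)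
  assume "degree p \<noteq> 0"
  then have "filterlim (poly p) at_infinity at_infinity" by (intro filterlim_poly_at_infinity) simp
  then have "\<forall>\<^sub>F x in at_infinity. \<bar>B\<bar> + 1 \<le> norm (poly p x)"
    using filterlim_at_infinity[of 0 "poly p"] by simp
  then obtain r where r: "\<And>x. r \<le> norm x \<Longrightarrow> \<bar>B\<bar> + 1 \<le> norm (poly p x)"
    by (auto simp: eventually_at_infinity)
  have "\<bar>B\<bar> + 1 \<le> \<bar>poly p \<bar>r\<bar>\<bar>" using r[of "\<bar>r\<bar>"] by simp
  then show False using assms[of "\<bar>r\<bar>"] by simp
qed

lemma quadratic_compare:
  fixes a b c :: real
  assumes "\<And>s. 0 \<le> s \<Longrightarrow> a + b * s + c * s\<^sup>2 \<le> a' + b' * s + c' * s\<^sup>2"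
  shows "c \<le> c'"
proof (rule ccontr)
  define D where "D = \<bar>a' - a\<bar> + \<bar>b' - b\<bar>"
  define e where "e = c - c'"
  assume "\<not> c \<le> c'"
  then have e: "0 < e" by (simp add: e_def)
  have D: "0 \<le> D" by (simp add: D_def)
  \<comment> \<open>For s \<ge> 1 the lower terms contribute at most D s, while e s = e + D exceeds
    D.\<close>
  define s where "s = 1 + D / e"
  have s: "1 \<le> s" using e D by (simp add: s_def)
  have "e * s\<^sup>2 \<le> (a' - a) + (b' - b) * s"
    using assms[of s] s by (simp add: e_def algebra_simps)
  also have "\<dots> \<le> \<bar>a' - a\<bar> * s + \<bar>b' - b\<bar> * s"
  proof (intro add_mono)
    have "a' - a \<le> \<bar>a' - a\<bar> * 1" by simp
    also have "\<dots> \<le> \<bar>a' - a\<bar> * s" using s by (intro mult_left_mono) auto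
    finally show "a' - a \<le> \<bar>a' - a\<bar> * s" .
    show "(b' - b) * s \<le> \<bar>b' - b\<bar> * s" using s by (intro mult_right_mono) auto
  qed
  also have "\<dots> = D * s" by (simp add: D_def algebra_simps)
  finally have "e * s * s \<le> D * s" by (simp add: power2_eq_square mult.assoc)
  then have "e * s \<le> D" using s by simp
  moreover have "e * s = e + D" using e by (simp add: s_def algebra_simps)
  ultimately show False using e by simp
qed

lemma linear_compare:
  fixes a b :: real
  assumes "\<And>s. 0 \<le> s \<Longrightarrow> a + b * s \<le> a' + b' * s"
  shows "b \<le> b'"
proof (rule quadratic_compare)
  fix s :: real assume "0 \<le> s"
  from mult_left_mono[OF assms[OF this] this]
  show "0 + a * s + b * s\<^sup>2 \<le> 0 + a' * s + b' * s\<^sup>2" by (simp add: algebra_simps power2_eq_square)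
qed

lemma orthogonal_comp_span: "(span S)\<^sup>\<bottom> = (S :: 'a::euclidean_space set)\<^sup>\<bottom>"
proof
  show "(span S)\<^sup>\<bottom> \<subseteq> S\<^sup>\<bottom>" by (rule orthogonal_comp_anti_mono[OF span_superset])
  show "S\<^sup>\<bottom> \<subseteq> (span S)\<^sup>\<bottom>"
  proof
    fix x assume "x \<in> S\<^sup>\<bottom>"
    then have "orthogonal x y" if "y \<in> S" for y
      using that by (auto simp: orthogonal_comp_def orthogonal_commute)
    then have "orthogonal x y" if "y \<in> span S" for y using orthogonal_to_span[OF that] by blast
    then show "x \<in> (span S)\<^sup>\<bottom>" by (auto simp: orthogonal_comp_def orthogonal_commute)
  qed
qed

lemma orthonormal_basis_line:
  assumes "norm (u :: 'a::euclidean_space) = 1"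
  shows "orthonormal_basis_of (({u}\<^sup>\<bottom>)\<^sup>\<bottom>) {u}"
proof -
  have "({u}\<^sup>\<bottom>)\<^sup>\<bottom> = span {u}"
    unfolding orthogonal_comp_span[of "{u}", symmetric] by (simp add: orthogonal_comp_self)
  then show ?thesis using assms by (auto simp: orthonormal_basis_of_def pairwise_def intro: span_base)
qed

text \<open>The volume is a polynomial in s by \<open>vol_expands\<close>, and by
  \<open>prism_squeeze\<close> it stays within bounded distance of s times the volume of the
  projection. The difference is a bounded polynomial, hence constant.\<close>

lemma segment_volume:
  fixes A :: "'a::euclidean_space set"
  assumes u: "norm u = 1" and A: "body A" and s: "0 \<le> s"
  shows "vol (A + closed_segment 0 (s *\<^sub>R u)) = vol A + s * volume_in ({u}\<^sup>\<bottom>) (orth_proj ({u}\<^sup>\<bottom>) ` A)"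
proof -
  let ?\<pi> = "volume_in ({u}\<^sup>\<bottom>) (orth_proj ({u}\<^sup>\<bottom>) ` A)"
  obtain R where R: "0 \<le> R"
    "\<And>s. 0 \<le> s \<Longrightarrow> s * ?\<pi> \<le> vol (A + closed_segment 0 ((s + R) *\<^sub>R u))"
    "\<And>s. 0 \<le> s \<Longrightarrow> vol (A + closed_segment 0 (s *\<^sub>R u)) \<le> (s + R) * ?\<pi>"
    using prism_squeeze[OF subspace_orthogonal_comp orthonormal_basis_line[OF u] A] by auto
  obtain p where p: "\<And>t. 0 \<le> t \<Longrightarrow> vol (A + closed_segment 0 (t *\<^sub>R u)) = poly p t" "coeff p 0 = vol A"
    using expands_poly_eq[OF vol_expands[OF A body_segment[of 0 u]]] unfolding segment_scale by metis
  have \<pi>: "0 \<le> ?\<pi>" by (simp add: volume_in_def)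
  define q where "q = p - [:0, ?\<pi>:]"
  have "\<bar>poly q t\<bar> \<le> R * ?\<pi>" if t: "0 \<le> t" for t
  proof -
    have up: "poly p t \<le> (t + R) * ?\<pi>" using R(3)[OF t] p(1)[OF t] by simp
    have lo: "(t - R) * ?\<pi> \<le> poly p t"
    proof (cases "R \<le> t")
      case True
      then show ?thesis using R(2)[of "t - R"] p(1)[OF t] by simp
    next
      case False
      then have "(t - R) * ?\<pi> \<le> 0" using \<pi> by (intro mult_nonpos_nonneg) auto
      also have "0 \<le> poly p t" using p(1)[OF t, symmetric] by simp
      finally show ?thesis .
    qed
    show ?thesis using up lo by (simp add: q_def abs_le_iff algebra_simps)
  qed
  then have "degree q = 0" by (rule bounded_poly_const)
  then obtain a where "q = [:a:]" by (rule degree_eq_zeroE)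
  then have pa: "p = [:a, ?\<pi>:]" by (simp add: q_def algebra_simps)
  with p(2) have "a = vol A" by simp
  then show ?thesis using p(1)[OF s] pa by simp
qed

section \<open>First and second differences of the volume along segments\<close>

definition segment_diff :: "'a::euclidean_space set \<Rightarrow> 'a \<Rightarrow> real" where
  "segment_diff A u = vol (A + closed_segment 0 u) - vol A"

definition segment_diff2 :: "'a::euclidean_space set \<Rightarrow> 'a \<Rightarrow> 'a \<Rightarrow> real" where
  "segment_diff2 A u v = vol (A + closed_segment 0 u + closed_segment 0 v)
     - vol (A + closed_segment 0 u) - vol (A + closed_segment 0 v) + vol A"

lemma vol_add_segment:
  fixes A :: "'a::euclidean_space set"
  assumes A: "body A" and s: "0 \<le> s"
  shows "vol (A + closed_segment 0 (s *\<^sub>R u)) = vol A + s * segment_diff A u"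
proof (cases "u = 0")
  case True
  then show ?thesis by (simp add: segment_diff_def)
next
  case False
  let ?e = "(1 / norm u) *\<^sub>R u"
  have e: "norm ?e = 1" using False by simp
  have "vol (A + closed_segment 0 ((s * norm u) *\<^sub>R ?e)) = vol A + (s * norm u) * volume_in ({?e}\<^sup>\<bottom>) (orth_proj ({?e}\<^sup>\<bottom>) ` A)"
    "vol (A + closed_segment 0 (norm u *\<^sub>R ?e)) = vol A + norm u * volume_in ({?e}\<^sup>\<bottom>) (orth_proj ({?e}\<^sup>\<bottom>) ` A)"
    using s by (intro segment_volume[OF e A]; simp)+
  then show ?thesis using False by (simp add: segment_diff_def)
qed

text \<open>The volume is affine in each parameter separately, because A plus one segment is again a
  body to which \<open>vol_add_segment\<close> applies.\<close>

lemma vol_add_segments: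
  fixes A :: "'a::euclidean_space set"
  assumes A: "body A" and s: "0 \<le> s" and t: "0 \<le> t"
  shows "vol (A + closed_segment 0 (s *\<^sub>R u) + closed_segment 0 (t *\<^sub>R v))
    = vol A + s * segment_diff A u + t * segment_diff A v + s * t * segment_diff2 A u v"
proof -
  have AS: "body (A + closed_segment 0 w)" for w by (intro body_plus A body_segment)
  have swap: "A + closed_segment 0 a + closed_segment 0 b = A + closed_segment 0 b + closed_segment 0 a" for a b
    by (simp add: add.assoc add.commute[of "closed_segment 0 a"])
  have "vol (A + closed_segment 0 (s *\<^sub>R u) + closed_segment 0 (t *\<^sub>R v))
      = vol (A + closed_segment 0 (s *\<^sub>R u)) + t * (vol (A + closed_segment 0 (s *\<^sub>R u) + closed_segment 0 v) - vol (A + closed_segment 0 (s *\<^sub>R u)))"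
    using vol_add_segment[OF AS[of "s *\<^sub>R u"] t, of v] by (simp add: segment_diff_def)
  also have "vol (A + closed_segment 0 (s *\<^sub>R u) + closed_segment 0 v)
      = vol (A + closed_segment 0 v) + s * (vol (A + closed_segment 0 v + closed_segment 0 u) - vol (A + closed_segment 0 v))"
    using vol_add_segment[OF AS[of v] s, of u] by (simp add: segment_diff_def swap[of v "s *\<^sub>R u"])
  also have "vol (A + closed_segment 0 (s *\<^sub>R u)) = vol A + s * (vol (A + closed_segment 0 u) - vol A)"
    using vol_add_segment[OF A s, of u] by (simp add: segment_diff_def)
  finally show ?thesis by (simp add: segment_diff_def segment_diff2_def swap[of v u] algebra_simps)
qed

text \<open>Up to a translation, A + [0,su] + [0,v] lies in A + [0,(s + 2|l|)u] + [0,v - lu], as the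
  multiples of u removed by the shear fit into the longer segment. Both volumes are affine in s, so
  their slopes compare.\<close>

lemma segment_diff2_shear_le:
  fixes A :: "'a::euclidean_space set"
  assumes A: "body A"
  shows "segment_diff2 A u v \<le> segment_diff2 A u (v - l *\<^sub>R u)"
proof -
  have "segment_diff A u + segment_diff2 A u v \<le> segment_diff A u + segment_diff2 A u (v - l *\<^sub>R u)"
  proof (rule linear_compare)
  fix s :: real assume s: "0 \<le> s"
  let ?v = "v - l *\<^sub>R u"
  let ?S = "\<lambda>s v. A + closed_segment 0 (s *\<^sub>R u) + closed_segment 0 (1 *\<^sub>R v)"
  have b: "body (?S s v)" for s v by (intro body_plus A body_segment)
  have "?S s v \<subseteq> {- (\<bar>l\<bar> *\<^sub>R u)} + ?S (s + 2 * \<bar>l\<bar>) ?v"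
  proof
    fix z assume "z \<in> ?S s v"
    then obtain x a c where z: "x \<in> A" "a \<in> closed_segment 0 (s *\<^sub>R u)" "c \<in> closed_segment 0 (1 *\<^sub>R v)" "z = x + a + c"
      by (auto elim!: set_plus_elim)
    obtain \<alpha> where \<alpha>: "0 \<le> \<alpha>" "\<alpha> \<le> s" "a = \<alpha> *\<^sub>R u" using z(2) s by (auto simp: mem_segment_scale)
    obtain \<beta> where \<beta>: "0 \<le> \<beta>" "\<beta> \<le> 1" "c = \<beta> *\<^sub>R v"
      using z(3) mem_segment_scale[of 1 c v] by auto
    have "\<bar>\<beta> * l\<bar> \<le> \<bar>l\<bar>" using \<beta> by (simp add: abs_mult mult_left_le_one_le)
    then have "0 \<le> \<alpha> + \<beta> * l + \<bar>l\<bar>" "\<alpha> + \<beta> * l + \<bar>l\<bar> \<le> s + 2 * \<bar>l\<bar>"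
      using \<alpha> by (auto simp: abs_le_iff)
    then have 1: "(\<alpha> + \<beta> * l + \<bar>l\<bar>) *\<^sub>R u \<in> closed_segment 0 ((s + 2 * \<bar>l\<bar>) *\<^sub>R u)"
      using s by (subst mem_segment_scale) auto
    have 2: "\<beta> *\<^sub>R ?v \<in> closed_segment 0 (1 *\<^sub>R ?v)"
      using \<beta> by (subst mem_segment_scale) auto
    have z_eq: "z = - (\<bar>l\<bar> *\<^sub>R u) + (x + (\<alpha> + \<beta> * l + \<bar>l\<bar>) *\<^sub>R u + \<beta> *\<^sub>R ?v)"
      unfolding z(4) \<alpha>(3) \<beta>(3) by (simp add: scaleR_add_left scaleR_diff_right)
    show "z \<in> {- (\<bar>l\<bar> *\<^sub>R u)} + ?S (s + 2 * \<bar>l\<bar>) ?v"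
      unfolding z_eq by (intro set_plus_intro singletonI z(1) 1 2)
  qed
  then have "vol (?S s v) \<le> vol ({- (\<bar>l\<bar> *\<^sub>R u)} + ?S (s + 2 * \<bar>l\<bar>) ?v)"
    by (intro vol_mono body_plus body_singleton A body_segment)
  also have "\<dots> = vol (?S (s + 2 * \<bar>l\<bar>) ?v)" by (intro vol_translation b)
  finally have le: "vol (?S s v) \<le> vol (?S (s + 2 * \<bar>l\<bar>) ?v)" .
  have "0 \<le> s + 2 * \<bar>l\<bar>" using s by simp
  from le show "(vol A + segment_diff A v) + (segment_diff A u + segment_diff2 A u v) * s
      \<le> (vol A + 2 * \<bar>l\<bar> * segment_diff A u + segment_diff A ?v + 2 * \<bar>l\<bar> * segment_diff2 A u ?v) + (segment_diff A u + segment_diff2 A u ?v) * s"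
    unfolding vol_add_segments[OF A s zero_le_one] vol_add_segments[OF A \<open>0 \<le> s + 2 * \<bar>l\<bar>\<close> zero_le_one]
    by (simp add: algebra_simps)
  qed
  then show ?thesis by simp
qed

text \<open>Only the component of v orthogonal to u matters, which will reduce a pair of unit
  vectors to an orthonormal pair.\<close>

lemma segment_diff2_shear:
  fixes A :: "'a::euclidean_space set"
  assumes A: "body A"
  shows "segment_diff2 A u (v - l *\<^sub>R u) = segment_diff2 A u v"
proof (rule antisym)
  show "segment_diff2 A u v \<le> segment_diff2 A u (v - l *\<^sub>R u)" by (rule segment_diff2_shear_le[OF A])
  show "segment_diff2 A u (v - l *\<^sub>R u) \<le> segment_diff2 A u v"
    using segment_diff2_shear_le[OF A, of u "v - l *\<^sub>R u" "- l"] by simp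
qed

lemma segment_diff_scale:
  assumes "body A" "0 \<le> s"
  shows "segment_diff A (s *\<^sub>R u) = s * segment_diff A u"
  using vol_add_segment[OF assms, of u] by (simp add: segment_diff_def)

lemma segment_diff2_scale:
  assumes A: "body A" and s: "0 \<le> s" "0 \<le> t"
  shows "segment_diff2 A (s *\<^sub>R u) (t *\<^sub>R v) = s * t * segment_diff2 A u v"
  using vol_add_segments[OF assms, of u v] vol_add_segment[OF A s(1), of u] vol_add_segment[OF A s(2), of v]
  by (simp add: segment_diff2_def[of A "s *\<^sub>R u"] algebra_simps)

lemma segment_diff_nonneg:
  assumes A: "body A"
  shows "0 \<le> segment_diff A u"
proof -
  have "A \<subseteq> A + closed_segment 0 u"
  proof
    fix x assume "x \<in> A"
    then have "x + 0 \<in> A + closed_segment 0 u" by (intro set_plus_intro) auto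
    then show "x \<in> A + closed_segment 0 u" by simp
  qed
  then show ?thesis
    unfolding segment_diff_def using vol_mono[OF A body_plus[OF A body_segment]] by simp
qed

lemma segment_diff_unit:
  assumes "norm u = 1" "body A"
  shows "segment_diff A u = volume_in ({u}\<^sup>\<bottom>) (orth_proj ({u}\<^sup>\<bottom>) ` A)"
  using segment_volume[OF assms zero_le_one] by (simp add: segment_diff_def)

text \<open>With a square box over u and e, both bounds of \<open>prism_squeeze\<close> are
  quadratic in the side length, and so is the volume between them; the leading coefficients must
  agree.\<close>

lemma segment_diff2_orthonormal:
  fixes A :: "'a::euclidean_space set"
  assumes A: "body A" and u: "norm u = 1" and e: "norm e = 1" and ue: "u \<bullet> e = 0"
  shows "segment_diff2 A u e = volume_in ((span {u, e})\<^sup>\<bottom>) (orth_proj ((span {u, e})\<^sup>\<bottom>) ` A)"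
proof -
  let ?E = "(span {u, e})\<^sup>\<bottom>"
  let ?\<pi> = "volume_in ?E (orth_proj ?E ` A)"
  have ne: "u \<noteq> e" using u ue by (auto simp: norm_eq_1)
  have "?E\<^sup>\<bottom> = span {u, e}" by (simp add: orthogonal_comp_self)
  then have C: "orthonormal_basis_of (?E\<^sup>\<bottom>) {u, e}"
    using u e ue by (auto simp: orthonormal_basis_of_def pairwise_def orthogonal_def inner_commute intro: span_base)
  obtain R where R: "0 \<le> R"
    "\<And>s. 0 \<le> s \<Longrightarrow> s ^ card {u, e} * ?\<pi> \<le> vol (A + (\<Sum>c\<in>{u, e}. closed_segment 0 ((s + R) *\<^sub>R c)))"
    "\<And>s. 0 \<le> s \<Longrightarrow> vol (A + (\<Sum>c\<in>{u, e}. closed_segment 0 (s *\<^sub>R c))) \<le> (s + R) ^ card {u, e} * ?\<pi>"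
    by (rule prism_squeeze[OF subspace_orthogonal_comp C A]) blast
  have vol: "vol (A + (\<Sum>c\<in>{u, e}. closed_segment 0 (s *\<^sub>R c))) = vol A + s * segment_diff A u + s * segment_diff A e + s * s * segment_diff2 A u e"
    if "0 \<le> s" for s
    using vol_add_segments[OF A that that, of u e] ne by (simp add: add.assoc)
  show ?thesis
  proof (rule antisym)
    show "segment_diff2 A u e \<le> ?\<pi>"
    proof (rule quadratic_compare)
      fix s :: real assume s: "0 \<le> s"
      show "vol A + (segment_diff A u + segment_diff A e) * s + segment_diff2 A u e * s\<^sup>2
          \<le> R\<^sup>2 * ?\<pi> + (2 * R * ?\<pi>) * s + ?\<pi> * s\<^sup>2"
        using R(3)[OF s] vol[OF s] ne by (simp add: algebra_simps power2_eq_square)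
    qed
    show "?\<pi> \<le> segment_diff2 A u e"
    proof (rule quadratic_compare)
      fix s :: real assume s: "0 \<le> s"
      then have sR: "0 \<le> s + R" using R(1) by simp
      show "0 + 0 * s + ?\<pi> * s\<^sup>2
          \<le> (vol A + R * (segment_diff A u + segment_diff A e) + R\<^sup>2 * segment_diff2 A u e)
            + (segment_diff A u + segment_diff A e + 2 * R * segment_diff2 A u e) * s + segment_diff2 A u e * s\<^sup>2"
        using R(2)[OF s] vol[OF sR] ne by (simp add: algebra_simps power2_eq_square)
    qed
  qed
qed

lemma segment_diff2_zero: "body A \<Longrightarrow> segment_diff2 A u 0 = 0"
  by (simp add: segment_diff2_def)

text \<open>The component w of v orthogonal to u has length sqrt (1 - (u \<bullet> v)^2), the area
  of the parallelogram on u and v. If w = 0, both sides are 0.\<close>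

lemma segment_diff2_unit:
  fixes A :: "'a::euclidean_space set"
  assumes A: "body A" and u: "norm u = 1" and v: "norm v = 1"
  shows "segment_diff2 A u v = volume_in ((span {u, v})\<^sup>\<bottom>) (orth_proj ((span {u, v})\<^sup>\<bottom>) ` A) * sqrt (1 - (u \<bullet> v)\<^sup>2)"
proof -
  define w where "w = v - (u \<bullet> v) *\<^sub>R u"
  have uu: "u \<bullet> u = 1" and vv: "v \<bullet> v = 1" using u v by (auto simp: norm_eq_1)
  have uw: "u \<bullet> w = 0" by (simp add: w_def inner_diff_right uu)
  have "w \<bullet> w = 1 - (u \<bullet> v)\<^sup>2"
    by (simp add: w_def inner_diff_right inner_diff_left uu vv inner_commute power2_eq_square algebra_simps)
  then have nw: "norm w = sqrt (1 - (u \<bullet> v)\<^sup>2)" by (simp add: norm_eq_sqrt_inner)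
  have uvw: "segment_diff2 A u v = segment_diff2 A u w" unfolding w_def using segment_diff2_shear[OF A, of u v] by simp
  show ?thesis
  proof (cases "w = 0")
    case True
    then show ?thesis using nw uvw segment_diff2_zero[OF A] by simp
  next
    case False
    define e where "e = (1 / norm w) *\<^sub>R w"
    have e: "norm e = 1" "u \<bullet> e = 0" "w = norm w *\<^sub>R e" using False uw by (auto simp: e_def)
    have "segment_diff2 A u w = norm w * segment_diff2 A u e"
      using segment_diff2_scale[OF A, of 1 "norm w" u e] e(3) by simp
    moreover have "span {u, e} = span {u, v}"
    proof (rule span_eq[THEN iffD2], intro conjI subsetI)
      fix x assume "x \<in> {u, e}"
      moreover have "e \<in> span {u, v}"
        unfolding e_def w_def by (intro span_scale span_diff span_base) auto
      ultimately show "x \<in> span {u, v}" by (auto intro: span_base)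
    next
      fix x assume "x \<in> {u, v}"
      moreover have "v = norm w *\<^sub>R e + (u \<bullet> v) *\<^sub>R u" using e(3) by (simp add: w_def)
      then have "v \<in> span {u, e}" by (metis insertI1 insertI2 span_add span_base span_scale)
      ultimately show "x \<in> span {u, e}" by (auto intro: span_base)
    qed
    ultimately show ?thesis using segment_diff2_orthonormal[OF A u e(1,2)] uvw nw by simp
  qed
qed

text \<open>The volumes are known explicitly: affine in t for one segment, so the diagonal
  second-order term is 0, and quadratic for two, where only the cross term remains. Translation
  invariance reduces to segments starting at 0.\<close>

lemma mv_segments:
  fixes A :: "'a::euclidean_space set"
  assumes A: "body A"
  shows "mixed_linear A (closed_segment a b) = segment_diff A (b - a)"
    "mixed_bilinear A (closed_segment a b) (closed_segment c d) = segment_diff2 A (b - a) (d - c)"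
proof -
  have tr: "closed_segment a b = {a} + closed_segment 0 (b - a)" for a b :: 'a
    using closed_segment_translation[of a 0 "b - a"] by (auto simp: set_plus_def image_def)
  let ?K = "closed_segment a b" and ?L = "closed_segment c d"
  have one: "mixed_linear A (closed_segment a b) = segment_diff A (b - a) \<and> mixed_bilinear A (closed_segment a b) (closed_segment a b) = 0"
    for a b :: 'a
  proof -
    have ex: "expands (\<lambda>t. vol A + t * segment_diff A (b - a)) (vol A) (segment_diff A (b - a)) 0"
      unfolding expands_def by (intro exI[of _ 0]) simp
    have "vol (A + (*\<^sub>R) t ` closed_segment a b) = vol A + t * segment_diff A (b - a)" if "t > 0" for t
    proof -
      have "A + (*\<^sub>R) t ` closed_segment a b = {t *\<^sub>R a} + (A + closed_segment 0 (t *\<^sub>R (b - a)))"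
        by (simp add: tr[of a b] scale_plus scale_segment algebra_simps)
      then show ?thesis
        using vol_add_segment[OF A, of t "b - a"] that by (simp add: vol_translation A body_plus body_segment)
    qed
    note u = expands_unique[OF vol_expands[OF A body_segment] ex this]
    show ?thesis using u(2,3) by simp
  qed
  show "mixed_linear A ?K = segment_diff A (b - a)" using one by blast
  have b: "body (?K + ?L)" by (intro body_plus body_segment)
  have ex: "expands (\<lambda>t. vol A + t * (segment_diff A (b - a) + segment_diff A (d - c)) + t\<^sup>2 * segment_diff2 A (b - a) (d - c))
      (vol A) (segment_diff A (b - a) + segment_diff A (d - c)) (segment_diff2 A (b - a) (d - c))"
    unfolding expands_def by (intro exI[of _ 0]) simp
  have "vol (A + (*\<^sub>R) t ` (?K + ?L))
      = vol A + t * (segment_diff A (b - a) + segment_diff A (d - c)) + t\<^sup>2 * segment_diff2 A (b - a) (d - c)" if "t > 0" for t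
  proof -
    let ?M = "A + closed_segment 0 (t *\<^sub>R (b - a)) + closed_segment 0 (t *\<^sub>R (d - c))"
    have M: "body ?M" by (intro body_plus A body_segment)
    have "A + (*\<^sub>R) t ` (?K + ?L) = {t *\<^sub>R a} + ({t *\<^sub>R c} + ?M)"
      by (simp add: tr[of a b] tr[of c d] scale_plus scale_segment algebra_simps)
    then have "vol (A + (*\<^sub>R) t ` (?K + ?L)) = vol ?M"
      using vol_translation[OF M] vol_translation[OF body_plus[OF body_singleton M]] by metis
    also have "\<dots> = vol A + t * (segment_diff A (b - a) + segment_diff A (d - c)) + t\<^sup>2 * segment_diff2 A (b - a) (d - c)"
      using vol_add_segments[OF A, of t t "b - a" "d - c"] that by (simp add: power2_eq_square algebra_simps)
    finally show ?thesis .
  qed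
  from expands_unique(3)[OF vol_expands[OF A b] ex this]
  have "mixed_bilinear A (?K + ?L) (?K + ?L) = 2 * segment_diff2 A (b - a) (d - c)" by simp
  moreover have "mixed_bilinear A (?K + ?L) (?K + ?L) = mixed_bilinear A ?K ?K + 2 * mixed_bilinear A ?K ?L + mixed_bilinear A ?L ?L"
    using mixed_bilinear_quadratic[OF A body_segment[of a b] body_segment[of c d] zero_le_one zero_le_one] by simp
  ultimately show "mixed_bilinear A ?K ?L = segment_diff2 A (b - a) (d - c)" using one by simp
qed

section \<open>Mixed volumes in a hyperplane and surface area\<close>

lemma dim_perp: "norm (u :: 'a::euclidean_space) = 1 \<Longrightarrow> dim ({u}\<^sup>\<bottom>) = DIM('a) - 1"
proof -
  assume "norm u = 1"
  then have "u \<noteq> 0" by auto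
  moreover have "{u}\<^sup>\<bottom> = {x. u \<bullet> x = 0}" by (auto simp: orthogonal_comp_def orthogonal_def)
  ultimately show ?thesis by (simp add: dim_hyperplane)
qed

text \<open>The derivative of |M + t[0,u]| at t = 0 is the volume of the projection of M, which is M
  itself inside the hyperplane. Hence n V([0,u], ...) has the required expansion there, and its
  existence justifies the choice by \<open>SOME\<close>.\<close>

lemma is_mixed_volume_hyperplane:
  fixes u :: "'a::euclidean_space"
  assumes u: "norm u = 1"
  shows "is_mixed_volume ({u}\<^sup>\<bottom>) (mixed_volume_in ({u}\<^sup>\<bottom>))"
proof -
  let ?E = "{u}\<^sup>\<bottom>" and ?n = "DIM('a)" and ?U = "closed_segment 0 u"
  let ?V = "\<lambda>Ks. real ?n * mixed_volume (?U # Ks)"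
  note V = is_mixed_volume_mixed_volume[where 'a='a]
  have symV: "mixed_volume Ks = mixed_volume Ls" if "mset Ks = mset Ls" for Ks Ls :: "'a set list"
    using V that unfolding is_mixed_volume_def by blast
  have emptyV: "mixed_volume Ks = 0" if "{} \<in> set Ks" for Ks :: "'a set list"
    using V that unfolding is_mixed_volume_def by blast
  have "is_mixed_volume ?E ?V"
    unfolding is_mixed_volume_def
  proof (intro conjI allI impI)
    fix Ks Ls :: "'a set list" assume "mset Ks = mset Ls"
    then show "?V Ks = ?V Ls" using symV[of "?U # Ks" "?U # Ls"] by simp
  next
    fix Ks :: "'a set list" assume "{} \<in> set Ks"
    then show "?V Ks = 0" using emptyV[of "?U # Ks"] by simp
  next
    fix r :: nat and K and c :: "nat \<Rightarrow> real"
    assume "\<forall>i<r. compact (K i) \<and> convex (K i) \<and> K i \<noteq> {} \<and> K i \<subseteq> ?E \<and> 0 \<le> c i"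
    then have K: "\<And>i. i < r \<Longrightarrow> body (K i)" "\<And>i. i < r \<Longrightarrow> K i \<subseteq> ?E" and c: "\<And>i. i < r \<Longrightarrow> 0 \<le> c i"
      by (auto simp: body_def)
    let ?M = "\<Sum>i<r. (*\<^sub>R) (c i) ` K i"
    have M: "body ?M" using K by (intro body_sum body_scale) auto
    have ME: "?M \<subseteq> ?E"
    proof
      fix x assume "x \<in> ?M"
      then obtain s where s: "x = sum s {..<r}" "\<forall>i\<in>{..<r}. s i \<in> (*\<^sub>R) (c i) ` K i"
        by (auto simp: set_sum_alt)
      have "s i \<in> ?E" if "i < r" for i
        using s(2) K(2)[OF that] that subspace_scale[OF subspace_orthogonal_comp] by fastforce
      then show "x \<in> ?E" unfolding s(1) by (intro subspace_sum subspace_orthogonal_comp) auto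
    qed
    \<comment> \<open>Index r stands for the segment. Only its coefficient varies with t, so the
      coefficient of t collects the lists in which the segment occurs once.\<close>
    define L where "L i = (if i < r then K i else ?U)" for i
    have sym: "symmetric_fun (\<lambda>js. mixed_volume (map L js))"
      unfolding symmetric_fun_def using symV by (metis mset_map)
    let ?c = "\<lambda>t k. if k \<in> {r} then t * 1 else c k"
    have ex: "expands (\<lambda>t. list_sum ({..<r} \<union> {r}) ?n (\<lambda>js. mixed_volume (map L js)) (?c t))
      (list_sum {..<r} ?n (\<lambda>js. mixed_volume (map L js)) c)
      (real ?n * (\<Sum>i\<in>{r}. 1 * list_sum {..<r} (?n - 1) (\<lambda>js. mixed_volume (map L (i # js))) c))
      (real ?n * (real ?n - 1) / 2 * (\<Sum>i\<in>{r}. \<Sum>i'\<in>{r}. 1 * 1 * list_sum {..<r} (?n - 2) (\<lambda>js. mixed_volume (map L (i # i' # js))) c))"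
      by (rule list_sum_expands[OF _ _ _ sym]) auto
    have ex': "expands (\<lambda>t. vol ?M + t * volume_in ?E (orth_proj ?E ` ?M)) (vol ?M) (volume_in ?E (orth_proj ?E ` ?M)) 0"
      unfolding expands_def by (intro exI[of _ 0]) simp
    have "list_sum ({..<r} \<union> {r}) ?n (\<lambda>js. mixed_volume (map L js)) (?c t)
        = vol ?M + t * volume_in ?E (orth_proj ?E ` ?M)" if t: "t > 0" for t
    proof -
      have "(\<Sum>i<Suc r. (*\<^sub>R) (?c t i) ` L i) = ?M + closed_segment 0 (t *\<^sub>R u)"
        by (simp add: L_def scale_segment)
      moreover have "volume_in UNIV (\<Sum>i<Suc r. (*\<^sub>R) (?c t i) ` L i)
          = (\<Sum>js | length js = dim (UNIV :: 'a set) \<and> set js \<subseteq> {..<Suc r}. mixed_volume (map L js) * prod_list (map (?c t) js))"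
        by (rule is_mixed_volume_expansion[OF V]) (use K c t body_segment in \<open>auto simp: L_def\<close>)
      moreover have "{..<Suc r} = {..<r} \<union> {r}" by auto
      ultimately have "vol (?M + closed_segment 0 (t *\<^sub>R u))
          = list_sum ({..<r} \<union> {r}) ?n (\<lambda>js. mixed_volume (map L js)) (?c t)"
        by (simp only: list_sum_def volume_in_UNIV dim_UNIV)
      then show ?thesis using segment_volume[OF u M, of t] t by simp
    qed
    from expands_unique(2)[OF ex ex' this]
    have "volume_in ?E (orth_proj ?E ` ?M) = real ?n * list_sum {..<r} (?n - 1) (\<lambda>js. mixed_volume (map L (r # js))) c"
      by simp
    moreover have "orth_proj ?E ` ?M = ?M"
    proof -
      have "orth_proj ?E x = x" if "x \<in> ?M" for x
        using that ME by (intro orth_proj_id subspace_orthogonal_comp) auto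
      then show ?thesis by (simp cong: image_cong)
    qed
    moreover have "real ?n * list_sum {..<r} (?n - 1) (\<lambda>js. mixed_volume (map L (r # js))) c
        = (\<Sum>js | length js = dim ?E \<and> set js \<subseteq> {..<r}. ?V (map K js) * prod_list (map c js))"
      unfolding list_sum_def dim_perp[OF u] sum_distrib_left
    proof (intro sum.cong refl)
      fix js assume js: "js \<in> {js. length js = ?n - 1 \<and> set js \<subseteq> {..<r}}"
      then have "map L js = map K js" by (auto simp: L_def)
      then have "map L (r # js) = ?U # map K js" by (simp add: L_def)
      then show "real ?n * (mixed_volume (map L (r # js)) * prod_list (map c js)) = ?V (map K js) * prod_list (map c js)"
        by (simp only: mult.assoc)
    qed
    ultimately show "volume_in ?E ?M
        = (\<Sum>js | length js = dim ?E \<and> set js \<subseteq> {..<r}. ?V (map K js) * prod_list (map c js))" by simp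
  qed
  then show ?thesis
    unfolding mixed_volume_in_def by (rule someI[of "is_mixed_volume ?E"])
qed

lemma surface_area_mv1: "surface_area A = mixed_linear A (cball 0 1)"
  by (simp add: surface_area_in_def mixed_linear_def)

lemma volume_hyperplane_expands:
  fixes u :: "'a::euclidean_space"
  assumes u: "norm u = 1" and X: "body X" "X \<subseteq> {u}\<^sup>\<bottom>"
  obtains c where "expands (\<lambda>t. volume_in ({u}\<^sup>\<bottom>) (X + (*\<^sub>R) t ` (cball 0 1 \<inter> {u}\<^sup>\<bottom>)))
    (volume_in ({u}\<^sup>\<bottom>) X) (surface_area_in ({u}\<^sup>\<bottom>) X) c"
proof -
  have E: "subspace ({u}\<^sup>\<bottom>)" by (rule subspace_orthogonal_comp)
  have "0 \<in> cball 0 1 \<inter> {u}\<^sup>\<bottom>" using subspace_0[OF E] by simp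
  then have "body (cball 0 1 \<inter> {u}\<^sup>\<bottom>)"
    unfolding body_def
    by (intro conjI compact_Int_closed compact_cball closed_subspace[OF E] convex_Int convex_cball
        subspace_imp_convex[OF E]) blast
  from mixed_volume_expands[of "{u}\<^sup>\<bottom>" "mixed_volume_in ({u}\<^sup>\<bottom>)" X 1 "\<lambda>_. cball 0 1 \<inter> {u}\<^sup>\<bottom>" "\<lambda>_. 1",
      OF is_mixed_volume_hyperplane[OF u] X this]
  show thesis by (intro that) (simp add: surface_area_in_def)
qed

lemma orth_proj_cball:
  assumes "subspace (E :: 'a::euclidean_space set)"
  shows "orth_proj E ` cball 0 1 = cball 0 1 \<inter> E"
proof
  show "orth_proj E ` cball 0 1 \<subseteq> cball 0 1 \<inter> E"
  proof
    fix y assume "y \<in> orth_proj E ` cball 0 1"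
    then obtain x where x: "norm x \<le> 1" "y = orth_proj E x" by auto
    have "orthogonal y (x - y)"
      unfolding x(2) using orth_proj_props(1,2)[OF assms, of x] unfolding orthogonal_comp_def by blast
    then have "(norm (y + (x - y)))\<^sup>2 = (norm y)\<^sup>2 + (norm (x - y))\<^sup>2" by (rule norm_add_Pythagorean)
    then have "(norm y)\<^sup>2 \<le> (norm x)\<^sup>2" by simp
    then have "norm y \<le> 1" using power2_le_imp_le[of "norm y" "norm x"] x(1) by simp
    moreover have "y \<in> E" unfolding x(2) by (rule orth_proj_props(1)[OF assms])
    ultimately show "y \<in> cball 0 1 \<inter> E" by simp
  qed
  show "cball 0 1 \<inter> E \<subseteq> orth_proj E ` cball 0 1"
  proof
    fix y assume y: "y \<in> cball 0 1 \<inter> E"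
    then have "orth_proj E y = y" by (intro orth_proj_id[OF assms]) simp
    with y show "y \<in> orth_proj E ` cball 0 1" by (metis IntD1 imageI)
  qed
qed

text \<open>Apply \<open>segment_volume\<close> to A + tB with B the unit ball: its projection is
  that of A plus t times the unit ball of the hyperplane. Comparing the coefficients of t turns
  volumes into surface areas.\<close>

lemma surface_area_add_segment:
  fixes A :: "'a::euclidean_space set"
  assumes u: "norm u = 1" and A: "body A" and s: "0 \<le> s"
  shows "surface_area (A + closed_segment 0 (s *\<^sub>R u))
    = surface_area A + s * surface_area_in ({u}\<^sup>\<bottom>) (orth_proj ({u}\<^sup>\<bottom>) ` A)"
proof -
  let ?E = "{u}\<^sup>\<bottom>" and ?B = "cball (0::'a) 1" and ?S = "closed_segment 0 (s *\<^sub>R u)"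
  have lin: "linear (orth_proj ?E)" by (intro linear_orth_proj subspace_orthogonal_comp)
  have B: "body ?B" by (rule body_cball) simp
  have P: "body (orth_proj ?E ` A)" "orth_proj ?E ` A \<subseteq> ?E"
    using A lin orth_proj_props(1)[OF subspace_orthogonal_comp] by (auto intro: body_linear_image)
  obtain c where c: "expands (\<lambda>t. volume_in ?E (orth_proj ?E ` A + (*\<^sub>R) t ` (?B \<inter> ?E)))
      (volume_in ?E (orth_proj ?E ` A)) (surface_area_in ?E (orth_proj ?E ` A)) c"
    using volume_hyperplane_expands[OF u P] .
  have AS: "body (A + ?S)" by (intro body_plus A body_segment)
  have ex: "expands (\<lambda>t. vol (A + (*\<^sub>R) t ` ?B) + s * volume_in ?E (orth_proj ?E ` A + (*\<^sub>R) t ` (?B \<inter> ?E)))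
      (vol A + s * volume_in ?E (orth_proj ?E ` A)) (mixed_linear A ?B + s * surface_area_in ?E (orth_proj ?E ` A))
      (1/2 * mixed_bilinear A ?B ?B + s * c)"
    by (intro expands_add expands_cmult c vol_expands A B)
  have "vol (A + ?S + (*\<^sub>R) t ` ?B)
      = vol (A + (*\<^sub>R) t ` ?B) + s * volume_in ?E (orth_proj ?E ` A + (*\<^sub>R) t ` (?B \<inter> ?E))" for t
  proof -
    have "A + ?S + (*\<^sub>R) t ` ?B = (A + (*\<^sub>R) t ` ?B) + ?S" by (simp add: ac_simps)
    moreover have "body (A + (*\<^sub>R) t ` ?B)" by (intro body_plus A body_scale B)
    moreover have "orth_proj ?E ` (A + (*\<^sub>R) t ` ?B) = orth_proj ?E ` A + (*\<^sub>R) t ` (?B \<inter> ?E)"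
      unfolding linear_image_plus[OF lin] linear_image_scale[OF lin] orth_proj_cball[OF subspace_orthogonal_comp] ..
    ultimately show ?thesis using segment_volume[OF u _ s] by simp
  qed
  from expands_unique(2)[OF vol_expands[OF AS B] ex this]
  show ?thesis by (simp add: surface_area_mv1)
qed

section \<open>Zonotopes and zonoids\<close>

lemma sum_lessThan_add: "(\<Sum>i<r + m. f i) = (\<Sum>i<r. f i) + (\<Sum>j<m. f (r + j) :: 'b::comm_monoid_add)" for r m :: nat
  by (induction m) (simp_all add: add.assoc)

lemma zonotope_body: "zonotope Z \<Longrightarrow> body Z"
  by (auto simp: zonotope_def intro!: body_sum body_segment)

lemma zonotope_segment: "zonotope (closed_segment a b)"
  unfolding zonotope_def by (intro exI[of _ 1] exI[of _ "\<lambda>_. a"] exI[of _ "\<lambda>_. b"]) simp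

lemma zonotope_plus: "zonotope Y \<Longrightarrow> zonotope Z \<Longrightarrow> zonotope (Y + Z)"
proof -
  assume "zonotope Y" "zonotope Z"
  then obtain r a b m c d where Y: "Y = (\<Sum>i<r::nat. closed_segment (a i) (b i))"
    and Z: "Z = (\<Sum>i<m::nat. closed_segment (c i) (d i))" by (auto simp: zonotope_def)
  have "Y + Z = (\<Sum>i<r + m. closed_segment (if i < r then a i else c (i - r)) (if i < r then b i else d (i - r)))"
    unfolding sum_lessThan_add Y Z by simp
  then show ?thesis unfolding zonotope_def by (intro exI)
qed

lemma zonotope_scale: "zonotope Z \<Longrightarrow> zonotope ((*\<^sub>R) c ` Z)"
proof -
  assume "zonotope Z"
  then obtain r a b where "Z = (\<Sum>i<r::nat. closed_segment (a i) (b i))" by (auto simp: zonotope_def)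
  then have "(*\<^sub>R) c ` Z = (\<Sum>i<r. closed_segment (c *\<^sub>R a i) (c *\<^sub>R b i))"
    by (simp add: scale_sum scale_segment)
  then show ?thesis unfolding zonotope_def by (intro exI)
qed

lemma hausdorff_dist_subset:
  fixes A B :: "'a::euclidean_space set"
  assumes A: "compact A" "A \<noteq> {}" and B: "compact B" "B \<noteq> {}"
  shows "0 \<le> hausdorff_dist A B" "A \<subseteq> B + cball 0 (hausdorff_dist A B)" "B \<subseteq> A + cball 0 (hausdorff_dist A B)"
proof -
  have le: "infdist a B \<le> (SUP a\<in>A. infdist a B)" if "a \<in> A" "compact A" for a and A B :: "'a set"
  proof (rule cSUP_upper[OF that(1)])
    show "bdd_above ((\<lambda>a. infdist a B) ` A)"
      by (intro bounded_imp_bdd_above compact_imp_bounded compact_continuous_image that continuous_intros)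
  qed
  have sub: "A \<subseteq> B + cball 0 d" if le: "\<And>a. a \<in> A \<Longrightarrow> infdist a B \<le> d" and cB: "compact B" "B \<noteq> {}" for A B :: "'a set" and d
  proof
    fix a assume "a \<in> A"
    obtain b where b: "b \<in> B" "infdist a B = dist a b"
      using infdist_attains_inf[OF compact_imp_closed[OF cB(1)] cB(2)] by blast
    then have "a - b \<in> cball 0 d" using le[OF \<open>a \<in> A\<close>] by (simp add: dist_norm norm_minus_commute)
    with b(1) have "b + (a - b) \<in> B + cball 0 d" by (rule set_plus_intro)
    then show "a \<in> B + cball 0 d" by simp
  qed
  have 1: "infdist a B \<le> hausdorff_dist A B" if "a \<in> A" for a
    using le[OF that A(1), of B] by (simp add: hausdorff_dist_def)
  have 2: "infdist b A \<le> hausdorff_dist A B" if "b \<in> B" for b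
    using le[OF that B(1), of A] by (simp add: hausdorff_dist_def)
  show "A \<subseteq> B + cball 0 (hausdorff_dist A B)" by (rule sub[OF 1 B])
  show "B \<subseteq> A + cball 0 (hausdorff_dist A B)" by (rule sub[OF 2 A])
  obtain a where "a \<in> A" using A(2) by blast
  then show "0 \<le> hausdorff_dist A B" using 1[of a] infdist_nonneg[of a B] by linarith
qed

lemma zonoid_approx:
  fixes Z :: "'a::euclidean_space set"
  assumes "zonoid Z"
  obtains Y e where "\<And>k::nat. zonotope (Y k)" "\<And>k. 0 \<le> e k" "e \<longlonglongrightarrow> 0"
    "\<And>k. Z \<subseteq> Y k + cball 0 (e k)" "\<And>k. Y k \<subseteq> Z + cball 0 (e k)"
proof -
  obtain Y where Y: "\<And>k::nat. zonotope (Y k)" "(\<lambda>k. hausdorff_dist (Y k) Z) \<longlonglongrightarrow> 0" "compact Z" "Z \<noteq> {}"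
    using assms by (auto simp: zonoid_def)
  note Yb = zonotope_body[OF Y(1)]
  note h = hausdorff_dist_subset[OF bodyD(1,3)[OF Yb] Y(3,4)]
  show thesis by (rule that[OF Y(1) h(1) Y(2) h(3) h(2)])
qed

text \<open>Convexity is inherited from the zonotopes: a convex combination of points of Z is within
  2 e k of Z for every k, and Z is closed.\<close>

lemma zonoid_body:
  fixes Z :: "'a::euclidean_space set"
  assumes Z: "zonoid Z"
  shows "body Z"
proof -
  have c: "compact Z" "Z \<noteq> {}" using Z by (auto simp: zonoid_def)
  obtain Y e where Y: "\<And>k::nat. zonotope (Y k)" "\<And>k. 0 \<le> e k" "e \<longlonglongrightarrow> 0"
    "\<And>k. Z \<subseteq> Y k + cball 0 (e k)" "\<And>k. Y k \<subseteq> Z + cball 0 (e k)"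
    using zonoid_approx[OF Z] by metis
  have "convex Z"
  proof (rule convexI)
    fix x y and u v :: real assume xy: "x \<in> Z" "y \<in> Z" "0 \<le> u" "0 \<le> v" "u + v = 1"
    let ?z = "u *\<^sub>R x + v *\<^sub>R y"
    have "infdist ?z Z \<le> 2 * e k" for k
    proof -
      have "convex (Y k + cball 0 (e k))" using zonotope_body[OF Y(1)] by (simp add: bodyD convex_set_plus)
      then have "?z \<in> Y k + cball 0 (e k)" using Y(4)[of k] xy by (intro convexD) auto
      then have "?z \<in> Z + cball 0 (e k) + cball 0 (e k)"
        using set_plus_mono2[OF Y(5)[of k] order_refl[of "cball 0 (e k)"]] by blast
      then obtain p q s where "p \<in> Z" "q \<in> cball 0 (e k)" "s \<in> cball 0 (e k)" "?z = p + q + s"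
        by (auto elim!: set_plus_elim)
      then have "p \<in> Z" "dist ?z p \<le> 2 * e k"
        using norm_triangle_ineq[of q s] by (auto simp: dist_norm)
      then show ?thesis by (meson infdist_le order_trans)
    qed
    moreover have "(\<lambda>k. 2 * e k) \<longlonglongrightarrow> 0" using tendsto_mult_right_zero[OF Y(3)] .
    ultimately have "infdist ?z Z \<le> 0" using LIMSEQ_le_const by blast
    then have "infdist ?z Z = 0" using infdist_nonneg[of ?z Z] by simp
    then show "?z \<in> Z" using in_closed_iff_infdist_zero[OF compact_imp_closed[OF c(1)] c(2)] by blast
  qed
  with c show ?thesis by (simp add: body_def)
qed

text \<open>
  Up to a constant factor, the Euclidean norm is the average of \<open>\<bar>x \<bullet> u\<bar>\<close> over the unit ball; the
  Riemann sums of this integral are support functions of zonotopes close to the ball.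
\<close>

definition ball_avg :: "'a::euclidean_space \<Rightarrow> real" where
  "ball_avg x = (\<integral>u. indicator (cball 0 1) u * \<bar>x \<bullet> u\<bar> \<partial>lborel)"

lemma ball_avg_integrable:
  "integrable lborel (\<lambda>u. indicator (cball 0 1) u * \<bar>x \<bullet> u\<bar> :: real)" for x :: "'a::euclidean_space"
proof -
  have "continuous_on (cball 0 1) (\<lambda>u. \<bar>x \<bullet> u\<bar>)" by (intro continuous_intros)
  from borel_integrable_compact[OF compact_cball this] show ?thesis by simp
qed

lemma ball_avg_orthogonal:
  fixes T :: "'a::euclidean_space \<Rightarrow> 'a"
  assumes T: "orthogonal_transformation T"
  shows "ball_avg (T x) = ball_avg x"
proof -
  have lin: "linear T" using T by (rule orthogonal_transformation_linear)
  have [measurable]: "T \<in> borel_measurable borel"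
    by (intro borel_measurable_continuous_onI linear_continuous_on) (simp add: lin linear_linear)
  have "ball_avg (T x) = (\<integral>u. indicator (cball 0 1) u * \<bar>T x \<bullet> u\<bar> \<partial>distr lborel borel T)"
    unfolding ball_avg_def distr_orthogonal_lborel[OF T] ..
  also have "\<dots> = (\<integral>u. indicator (cball 0 1) (T u) * \<bar>T x \<bullet> T u\<bar> \<partial>lborel)"
    by (intro integral_distr) (auto intro!: borel_measurable_times borel_measurable_indicator)
  also have "\<dots> = ball_avg x"
    unfolding ball_avg_def using T
    by (intro Bochner_Integration.integral_cong refl)
      (auto simp: indicator_def orthogonal_transformation_norm orthogonal_transformation_def)
  finally show ?thesis .
qed

text \<open>For distinct x and y, the reflection in the hyperplane orthogonal to x - y.\<close>

lemma orthogonal_transformation_swap: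
  fixes x y :: "'a::euclidean_space"
  assumes "norm x = norm y"
  obtains T where "orthogonal_transformation T" "T x = y"
proof (cases "x = y")
  case True
  then show thesis using that[of "\<lambda>z. z"] by (simp add: orthogonal_transformation_id)
next
  case False
  define d where "d = x - y"
  have d: "d \<bullet> d \<noteq> 0" using False by (simp add: d_def)
  define k where "k = 2 / (d \<bullet> d)"
  have k: "k * (d \<bullet> d) = 2" using d by (simp add: k_def)
  let ?T = "\<lambda>z. z - (k * (z \<bullet> d)) *\<^sub>R d"
  have "linear ?T"
  proof (rule linearI)
    fix v w :: 'a and c
    show "?T (v + w) = ?T v + ?T w" by (simp add: inner_add_left distrib_left scaleR_add_left)
    have "k * ((c *\<^sub>R v) \<bullet> d) = c * (k * (v \<bullet> d))" by simp
    then show "?T (c *\<^sub>R v) = c *\<^sub>R ?T v" by (simp only: scaleR_diff_right scaleR_scaleR)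
  qed
  moreover have "?T v \<bullet> ?T w = v \<bullet> w" for v w
  proof -
    have "?T v \<bullet> ?T w = v \<bullet> w - 2 * (k * (v \<bullet> d) * (w \<bullet> d)) + k * (v \<bullet> d) * (w \<bullet> d) * (k * (d \<bullet> d))"
      by (simp add: inner_diff_left inner_diff_right inner_commute[of d v] inner_commute[of d w] algebra_simps)
    then show ?thesis unfolding k by simp
  qed
  ultimately have "orthogonal_transformation ?T" by (simp add: orthogonal_transformation_def)
  moreover have "?T x = y"
  proof -
    have "x \<bullet> x = y \<bullet> y" using assms by (simp add: norm_eq)
    then have "2 * (x \<bullet> d) = d \<bullet> d"
      by (simp add: d_def inner_diff_left inner_diff_right inner_commute)
    then have "k * (2 * (x \<bullet> d)) = 2" using k by (simp only:)
    then have "k * (x \<bullet> d) = 1" by simp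
    then show ?thesis by (simp add: d_def)
  qed
  ultimately show thesis by (rule that)
qed

text \<open>Rotation invariance leaves a function of the norm only, and homogeneity makes it
  linear.\<close>

lemma ball_avg_eq:
  obtains c where "0 < c" "\<And>x::'a::euclidean_space. ball_avg x = c * norm x"
proof -
  obtain e :: 'a where e: "norm e = 1" using vector_choose_size[of 1] by auto
  define c where "c = ball_avg e"
  have "ball_avg x = c * norm x" for x :: 'a
  proof -
    have "norm (norm x *\<^sub>R e) = norm x" using e by simp
    then obtain T where T: "orthogonal_transformation T" "T (norm x *\<^sub>R e) = x"
      using orthogonal_transformation_swap by blast
    have "ball_avg x = ball_avg (norm x *\<^sub>R e)" using ball_avg_orthogonal[OF T(1), of "norm x *\<^sub>R e"] T(2) by simp
    also have "\<dots> = (\<integral>u. norm x * (indicator (cball 0 1) u * \<bar>e \<bullet> u\<bar>) \<partial>lborel)"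
      unfolding ball_avg_def by (simp add: abs_mult mult.left_commute)
    also have "\<dots> = norm x * ball_avg e" unfolding ball_avg_def by simp
    finally show ?thesis by (simp add: c_def)
  qed
  moreover have "0 < c"
  proof -
    \<comment> \<open>This ball lies in the unit ball, and \<bar>e \<bullet> u\<bar> \<ge> 1/4 on
      it, which bounds the average from below.\<close>
    let ?b = "ball ((1/2) *\<^sub>R e) (1/4)"
    have "1/4 * vol ?b = (\<integral>u. 1/4 * indicator ?b u \<partial>lborel)" by simp
    also have "\<dots> \<le> ball_avg e"
      unfolding ball_avg_def
    proof (rule integral_mono)
      show "integrable lborel (\<lambda>u. 1/4 * indicator ?b u :: real)"
        using emeasure_lborel_ball_finite[of "(1/2) *\<^sub>R e" "1/4"] by (intro integrable_mult_right integrable_real_indicator) auto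
      show "integrable lborel (\<lambda>u. indicator (cball 0 1) u * \<bar>e \<bullet> u\<bar> :: real)" by (rule ball_avg_integrable)
      fix u
      show "1/4 * indicator ?b u \<le> (indicator (cball 0 1) u * \<bar>e \<bullet> u\<bar> :: real)"
      proof (cases "u \<in> ?b")
        case True
        then have n: "norm (u - (1/2) *\<^sub>R e) < 1/4" by (simp add: dist_norm norm_minus_commute)
        have "norm u \<le> norm (u - (1/2) *\<^sub>R e) + norm ((1/2) *\<^sub>R e)"
          using norm_triangle_ineq[of "u - (1/2) *\<^sub>R e" "(1/2) *\<^sub>R e"] by simp
        then have "norm u \<le> 1" using n e by simp
        moreover have "\<bar>e \<bullet> (u - (1/2) *\<^sub>R e)\<bar> \<le> 1/4"
          using Cauchy_Schwarz_ineq2[of e "u - (1/2) *\<^sub>R e"] n e by simp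
        then have "\<bar>e \<bullet> u - 1/2\<bar> \<le> 1/4" using e by (simp add: inner_diff_right norm_eq_1)
        then have "1/4 \<le> \<bar>e \<bullet> u\<bar>" by linarith
        ultimately show ?thesis using True by simp
      qed simp
    qed
    finally have "1/4 * vol ?b \<le> c" by (simp add: c_def)
    moreover have "0 < vol ?b" using content_ball_pos[of "1/4" "(1/2) *\<^sub>R e"] by simp
    ultimately show ?thesis by linarith
  qed
  ultimately show thesis by (rule that[rotated])
qed

section \<open>Zonotopes close to the Euclidean ball\<close>

lemma finite_partition:
  fixes K :: "'a::euclidean_space set"
  assumes K: "compact K" and d: "0 < d"
  obtains r :: nat and n D where "\<And>i. i < r \<Longrightarrow> D i \<in> sets borel" "(\<Union>i<r. D i) = K"
    "disjoint_family_on D {..<r}" "\<And>i u. i < r \<Longrightarrow> u \<in> D i \<Longrightarrow> dist (n i) u < d"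
proof -
  obtain N where N: "finite N" "N \<subseteq> K" "K \<subseteq> (\<Union>x\<in>N. ball x d)"
    using compactE_image[OF K, of K "\<lambda>x. ball x d"] d by (metis UN_I centre_in_ball open_ball subsetI)
  obtain n where n: "bij_betw n {..<card N} N"
    using finite_same_card_bij[of "{..<card N}" N] N(1) by auto
  define D where "D i = K \<inter> ball (n i) d - (\<Union>j<i. ball (n j) d)" for i
  show thesis
  proof (rule that)
    show "D i \<in> sets borel" if "i < card N" for i
      unfolding D_def using compact_imp_closed[OF K] by (intro sets.Diff sets.Int sets.finite_UN) auto
    show "(\<Union>i<card N. D i) = K"
    proof
      show "K \<subseteq> (\<Union>i<card N. D i)"
      proof
        fix x assume x: "x \<in> K"
        then obtain y where "y \<in> N" "x \<in> ball y d" using N(3) by auto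
        moreover have "N = n ` {..<card N}" using n by (simp add: bij_betw_def)
        ultimately obtain i where i: "i < card N" "x \<in> ball (n i) d" by (metis imageE lessThan_iff)
        define m where "m = (LEAST i. x \<in> ball (n i) d)"
        have "x \<in> ball (n m) d" "m \<le> i" unfolding m_def using i(2) by (rule LeastI, rule Least_le)
        moreover have "x \<notin> ball (n j) d" if "j < m" for j using not_less_Least[OF that[unfolded m_def]] .
        ultimately have "x \<in> D m" "m < card N" using x i(1) by (auto simp: D_def)
        then show "x \<in> (\<Union>i<card N. D i)" by blast
      qed
    qed (auto simp: D_def)
    show "disjoint_family_on D {..<card N}"
      unfolding disjoint_family_on_def
    proof (intro ballI impI)
      fix i j :: nat assume "i \<noteq> j"
      then consider "i < j" | "j < i" by linarith
      then show "D i \<inter> D j = {}" by cases (auto simp: D_def)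
    qed
    show "dist (n i) u < d" if "i < card N" "u \<in> D i" for i u using that by (simp add: D_def)
  qed
qed

text \<open>The support function of a sum of centred segments is the sum of the \<bar>x \<bullet> w
  i\<bar>, attained by choosing the sign of each w i.\<close>

lemma support_zonotope:
  fixes w :: "nat \<Rightarrow> 'a::euclidean_space"
  defines "Z \<equiv> \<lambda>r. \<Sum>i<r. closed_segment (- w i) (w i)"
  shows "z \<in> Z r \<Longrightarrow> x \<bullet> z \<le> (\<Sum>i<r. \<bar>x \<bullet> w i\<bar>)" "\<exists>z\<in>Z r. x \<bullet> z = (\<Sum>i<r. \<bar>x \<bullet> w i\<bar>)"
proof -
  show "x \<bullet> z \<le> (\<Sum>i<r. \<bar>x \<bullet> w i\<bar>)" if "z \<in> Z r"
  proof -
    obtain s where s: "z = sum s {..<r}" "\<forall>i\<in>{..<r}. s i \<in> closed_segment (- w i) (w i)"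
      using \<open>z \<in> Z r\<close> by (auto simp: Z_def set_sum_alt)
    have "x \<bullet> s i \<le> \<bar>x \<bullet> w i\<bar>" if i: "i < r" for i
    proof -
      obtain t where t: "0 \<le> t" "t \<le> 1" "s i = (1 - t) *\<^sub>R (- w i) + t *\<^sub>R w i"
        using s(2) i unfolding in_segment by blast
      have "x \<bullet> s i = (2 * t - 1) * (x \<bullet> w i)" by (simp add: t(3) inner_add_right algebra_simps)
      also have "\<dots> \<le> \<bar>2 * t - 1\<bar> * \<bar>x \<bullet> w i\<bar>" by (metis abs_ge_self abs_mult)
      also have "\<dots> \<le> 1 * \<bar>x \<bullet> w i\<bar>" using t by (intro mult_right_mono) (auto simp: abs_le_iff)
      finally show ?thesis by simp
    qed
    then show ?thesis unfolding s(1) inner_sum_right by (intro sum_mono) simp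
  qed
  show "\<exists>z\<in>Z r. x \<bullet> z = (\<Sum>i<r. \<bar>x \<bullet> w i\<bar>)"
  proof
    let ?s = "\<lambda>i. if 0 \<le> x \<bullet> w i then w i else - w i"
    show "sum ?s {..<r} \<in> Z r"
      unfolding Z_def set_sum_alt[OF finite_lessThan] by (intro CollectI exI[of _ ?s]) auto
    show "x \<bullet> sum ?s {..<r} = (\<Sum>i<r. \<bar>x \<bullet> w i\<bar>)"
      unfolding inner_sum_right by (intro sum.cong) auto
  qed
qed

text \<open>The segments have directions n i and lengths proportional to the volumes of the pieces D
  i, so the support function g is a Riemann sum for \<open>ball_avg\<close>, which is c times the
  norm. A relative error \<eta> in the support function puts the zonotope between two concentric
  balls.\<close>

lemma zonotope_approx_ball:
  assumes "0 < \<epsilon>"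
  obtains Z :: "'a::euclidean_space set" where "zonotope Z" "cball 0 1 \<subseteq> Z" "Z \<subseteq> cball 0 (1 + \<epsilon>)"
proof -
  let ?K = "cball (0::'a) 1"
  obtain c where c: "0 < c" "\<And>x::'a. ball_avg x = c * norm x" using ball_avg_eq by blast
  have V: "0 < vol ?K" using content_cball_pos[of 1 "0::'a"] by simp
  \<comment> \<open>Chosen so that (1 + \<eta>) / (1 - \<eta>) = 1 + \<epsilon>, the ratio of the
    outer to the inner radius.\<close>
  define \<eta> where "\<eta> = \<epsilon> / (2 + \<epsilon>)"
  have \<eta>: "0 < \<eta>" "\<eta> < 1" using assms by (auto simp: \<eta>_def)
  \<comment> \<open>Replacing u by n i on the piece D i changes \<bar>x \<bullet> u\<bar> by at most
    d times the norm of x; integrated over the ball this gives c \<eta> times the norm.\<close>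
  define d where "d = c * \<eta> / vol ?K"
  have d: "0 < d" "d * vol ?K = c * \<eta>" using c \<eta> V by (auto simp: d_def)
  obtain r :: nat and n D where D: "\<And>i. i < r \<Longrightarrow> D i \<in> sets borel" "(\<Union>i<r. D i) = ?K"
    "disjoint_family_on D {..<r}" "\<And>i u. i < r \<Longrightarrow> u \<in> D i \<Longrightarrow> dist (n i) u < d"
    by (rule finite_partition[OF compact_cball d(1)]) blast
  define m where "m i = vol (D i)" for i
  define g where "g x = (\<Sum>i<r. m i * \<bar>x \<bullet> n i\<bar>)" for x :: 'a
  have ind: "(\<Sum>i<r. indicator (D i) u) = (indicator ?K u :: real)" for u
  proof -
    have "(indicator (\<Union>i<r. D i) u :: real) = (\<Sum>i<r. indicator (D i) u)"
      by (rule indicator_UN_disjoint) (use D(3) in auto)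
    then show ?thesis unfolding D(2) by simp
  qed
  have fin: "emeasure lborel (D i) < \<infinity>" if "i < r" for i
  proof -
    have "emeasure lborel (D i) \<le> emeasure lborel ?K" using D(2) that by (intro emeasure_mono) auto
    also have "\<dots> < \<infinity>" by (rule emeasure_compact_finite) simp
    finally show ?thesis .
  qed
  have int: "integrable lborel (\<lambda>u. indicator (D i) u * a :: real)" if "i < r" for i a
    using D(1)[OF that] fin[OF that] by (intro integrable_mult_left integrable_real_indicator) auto
  have g: "\<bar>ball_avg x - g x\<bar> \<le> c * \<eta> * norm x" for x
  proof -
    have "g x = (\<Sum>i<r. \<integral>u. indicator (D i) u * \<bar>x \<bullet> n i\<bar> \<partial>lborel)"
      unfolding g_def m_def by (intro sum.cong refl) simp
    also have "\<dots> = (\<integral>u. (\<Sum>i<r. indicator (D i) u * \<bar>x \<bullet> n i\<bar>) \<partial>lborel)"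
      by (rule Bochner_Integration.integral_sum[symmetric]) (rule int, simp)
    finally have gi: "g x = \<dots>" .
    have "integrable lborel (\<lambda>u. \<Sum>i<r. indicator (D i) u * \<bar>x \<bullet> n i\<bar>)"
      by (rule Bochner_Integration.integrable_sum) (rule int, simp)
    then have "ball_avg x - g x = (\<integral>u. indicator ?K u * \<bar>x \<bullet> u\<bar> - (\<Sum>i<r. indicator (D i) u * \<bar>x \<bullet> n i\<bar>) \<partial>lborel)"
      unfolding gi ball_avg_def by (rule Bochner_Integration.integral_diff[OF ball_avg_integrable, symmetric])
    also have "\<bar>\<dots>\<bar> \<le> (\<integral>u. \<bar>indicator ?K u * \<bar>x \<bullet> u\<bar> - (\<Sum>i<r. indicator (D i) u * \<bar>x \<bullet> n i\<bar>)\<bar> \<partial>lborel)"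
      by (rule integral_abs_bound)
    also have "\<dots> \<le> (\<integral>u. indicator ?K u * (d * norm x) \<partial>lborel)"
    proof (rule integral_mono)
      show "integrable lborel (\<lambda>u. \<bar>indicator ?K u * \<bar>x \<bullet> u\<bar> - (\<Sum>i<r. indicator (D i) u * \<bar>x \<bullet> n i\<bar>)\<bar>)"
        by (intro integrable_abs Bochner_Integration.integrable_diff ball_avg_integrable Bochner_Integration.integrable_sum int) simp
      show "integrable lborel (\<lambda>u. indicator ?K u * (d * norm x))"
        using emeasure_compact_finite[of ?K] by (intro integrable_mult_left integrable_real_indicator) auto
      fix u
      have "indicator ?K u * \<bar>x \<bullet> u\<bar> - (\<Sum>i<r. indicator (D i) u * \<bar>x \<bullet> n i\<bar>)
          = (\<Sum>i<r. indicator (D i) u * (\<bar>x \<bullet> u\<bar> - \<bar>x \<bullet> n i\<bar>))"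
        unfolding ind[symmetric] sum_distrib_right sum_subtractf[symmetric] right_diff_distrib ..
      also have "\<bar>\<dots>\<bar> \<le> (\<Sum>i<r. \<bar>indicator (D i) u * (\<bar>x \<bullet> u\<bar> - \<bar>x \<bullet> n i\<bar>)\<bar>)" by (rule sum_abs)
      also have "\<dots> \<le> (\<Sum>i<r. indicator (D i) u * (d * norm x))"
      proof (intro sum_mono)
        fix i assume i: "i \<in> {..<r}"
        show "\<bar>indicator (D i) u * (\<bar>x \<bullet> u\<bar> - \<bar>x \<bullet> n i\<bar>)\<bar> \<le> indicator (D i) u * (d * norm x)"
        proof (cases "u \<in> D i")
          case True
          have "\<bar>\<bar>x \<bullet> u\<bar> - \<bar>x \<bullet> n i\<bar>\<bar> \<le> \<bar>x \<bullet> (u - n i)\<bar>" by (simp add: inner_diff_right)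
          also have "\<dots> \<le> norm x * norm (u - n i)" by (rule Cauchy_Schwarz_ineq2)
          also have "\<dots> \<le> norm x * d"
            using D(4)[of i u] i True by (intro mult_left_mono) (auto simp: dist_norm norm_minus_commute)
          finally show ?thesis using True by (simp add: mult.commute)
        qed simp
      qed
      also have "\<dots> = indicator ?K u * (d * norm x)" by (simp only: sum_distrib_right[symmetric] ind)
      finally show "\<bar>indicator ?K u * \<bar>x \<bullet> u\<bar> - (\<Sum>i<r. indicator (D i) u * \<bar>x \<bullet> n i\<bar>)\<bar>
          \<le> indicator ?K u * (d * norm x)" .
    qed
    also have "\<dots> = c * \<eta> * norm x" using d(2) by (simp add: mult.commute mult.left_commute)
    finally show ?thesis .
  qed
  have up: "g x \<le> c * (1 + \<eta>) * norm x" and lo: "c * (1 - \<eta>) * norm x \<le> g x" for x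
    using g[of x] unfolding c(2) by (auto simp: abs_le_iff algebra_simps)
  define w where "w i = m i *\<^sub>R n i" for i
  have m0: "0 \<le> m i" for i by (simp add: m_def)
  have gw: "(\<Sum>i<r. \<bar>x \<bullet> w i\<bar>) = g x" for x
    unfolding g_def w_def by (intro sum.cong refl) (simp add: abs_mult m0)
  let ?Z = "\<Sum>i<r. closed_segment (- w i) (w i)"
  note sup = support_zonotope[where w = w and r = r, unfolded gw]
  have zZ: "zonotope ?Z" unfolding zonotope_def by (intro exI) (rule refl)
  \<comment> \<open>A point outside is separated from the zonotope by some a; then the support
    function in direction - a would be less than c (1 - \<eta>) times the norm of a.\<close>
  have sub: "cball 0 (c * (1 - \<eta>)) \<subseteq> ?Z"
  proof
    fix y :: 'a assume y: "y \<in> cball 0 (c * (1 - \<eta>))"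
    show "y \<in> ?Z"
    proof (rule ccontr)
      assume "y \<notin> ?Z"
      moreover have "body ?Z" by (rule zonotope_body[OF zZ])
      ultimately obtain a b where ab: "a \<bullet> y < b" "\<forall>x\<in>?Z. b < a \<bullet> x"
        using separating_hyperplane_closed_point[of ?Z y] by (auto simp: body_def compact_imp_closed)
      obtain z where z: "z \<in> ?Z" "(- a) \<bullet> z = g (- a)" using sup(2)[of "- a"] by blast
      have "c * (1 - \<eta>) * norm a \<le> g (- a)" using lo[of "- a"] by simp
      also have "\<dots> < (- a) \<bullet> y" using ab z by fastforce
      also have "\<dots> \<le> norm a * norm y" using norm_cauchy_schwarz[of "- a" y] by simp
      also have "\<dots> \<le> norm a * (c * (1 - \<eta>))" using y by (intro mult_left_mono) auto
      finally show False by (simp add: mult.commute)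
    qed
  qed
  have sup': "?Z \<subseteq> cball 0 (c * (1 + \<eta>))"
  proof
    fix z assume z: "z \<in> ?Z"
    have "norm z * norm z \<le> c * (1 + \<eta>) * norm z"
      using sup(1)[OF z, of z] up[of z] by (simp add: norm_eq_sqrt_inner)
    then have "norm z \<le> c * (1 + \<eta>)" using c \<eta> by (cases "z = 0") auto
    then show "z \<in> cball 0 (c * (1 + \<eta>))" by simp
  qed
  define k where "k = 1 / (c * (1 - \<eta>))"
  have k: "0 < k" "k * (c * (1 - \<eta>)) = 1" using c \<eta> by (auto simp: k_def)
  have "k * (c * (1 + \<eta>)) = 1 + \<epsilon>"
  proof -
    have "k * (c * (1 + \<eta>)) = (1 + \<eta>) / (1 - \<eta>)" using c by (simp add: k_def)
    also have "\<dots> = 1 + \<epsilon>" using assms by (simp add: \<eta>_def field_simps)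
    finally show ?thesis .
  qed
  show thesis
  proof
    show "zonotope ((*\<^sub>R) k ` ?Z)" by (rule zonotope_scale[OF zZ])
    have "cball 0 1 = (*\<^sub>R) k ` (cball 0 (c * (1 - \<eta>)) :: 'a set)" using k c \<eta> by (simp add: scale_cball)
    then show "cball 0 1 \<subseteq> (*\<^sub>R) k ` ?Z" using scale_mono[OF sub, of k] by simp
    have "(*\<^sub>R) k ` (cball 0 (c * (1 + \<eta>)) :: 'a set) = cball 0 (1 + \<epsilon>)"
      using k c \<eta> \<open>k * (c * (1 + \<eta>)) = 1 + \<epsilon>\<close> by (simp add: scale_cball)
    then show "(*\<^sub>R) k ` ?Z \<subseteq> cball 0 (1 + \<epsilon>)" using scale_mono[OF sup', of k] by simp
  qed
qed

section \<open>The inequality for zonoids\<close>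

text \<open>The expansions give only the values of the form on pairs of equal bodies, so additivity
  in one argument is extracted by polarization from the expansion for K, K' and L together.\<close>

lemma mixed_bilinear_add_left:
  assumes A: "body A" and K: "body K" "body K'" "body L"
  shows "mixed_bilinear A (K + K') L = mixed_bilinear A K L + mixed_bilinear A K' L"
proof -
  have q: "mixed_bilinear A (K + L) (K + L) = mixed_bilinear A K K + 2 * mixed_bilinear A K L + mixed_bilinear A L L" if "body K" "body L" for K L
    using mixed_bilinear_quadratic[OF A that zero_le_one zero_le_one] by simp
  let ?K = "\<lambda>i::nat. if i = 0 then K else if i = 1 then K' else L"
  have "(\<Sum>i<3. (*\<^sub>R) 1 ` ?K i) = K + K' + L" by (simp add: eval_nat_numeral)
  moreover have "(\<Sum>i<3. \<Sum>j<3. 1 * 1 * mixed_bilinear A (?K i) (?K j))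
      = mixed_bilinear A K K + mixed_bilinear A K' K' + mixed_bilinear A L L + 2 * mixed_bilinear A K K' + 2 * mixed_bilinear A K L + 2 * mixed_bilinear A K' L"
    by (simp add: eval_nat_numeral mixed_bilinear_commute[of A K' K] mixed_bilinear_commute[of A L K] mixed_bilinear_commute[of A L K'])
  ultimately have "mixed_bilinear A (K + K' + L) (K + K' + L)
      = mixed_bilinear A K K + mixed_bilinear A K' K' + mixed_bilinear A L L + 2 * mixed_bilinear A K K' + 2 * mixed_bilinear A K L + 2 * mixed_bilinear A K' L"
    using mixed_linear_sum(2)[of A 3 ?K "\<lambda>_. 1"] A K by simp
  then show ?thesis using q[OF body_plus[OF K(1,2)] K(3)] q[OF K(1,2)] by simp
qed

lemma mixed_bilinear_zero_left: "body A \<Longrightarrow> body L \<Longrightarrow> mixed_bilinear A {0} L = 0"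
  using mixed_bilinear_add_left[of A "{0}" "{0}" L] by (simp add: body_zero)

lemma mixed_bilinear_sum_left:
  fixes r :: nat
  assumes A: "body A" and K: "\<And>i. i < r \<Longrightarrow> body (K i)" and L: "body L"
  shows "mixed_bilinear A (\<Sum>i<r. K i) L = (\<Sum>i<r. mixed_bilinear A (K i) L)"
  using K
proof (induction r)
  case 0
  then show ?case by (simp add: mixed_bilinear_zero_left A L)
next
  case (Suc r)
  have "body (\<Sum>i<r. K i)" "body (K r)" using Suc.prems by (auto intro: body_sum)
  then show ?case using Suc by (simp add: mixed_bilinear_add_left[OF A _ _ L])
qed

lemma mixed_linear_sum_plain:
  fixes r :: nat
  assumes "body A" "\<And>i. i < r \<Longrightarrow> body (K i)"
  shows "mixed_linear A (\<Sum>i<r. K i) = (\<Sum>i<r. mixed_linear A (K i))"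
  using mixed_linear_sum(1)[of A r K "\<lambda>_. 1"] assms by simp

text \<open>Both sides split into sums over pairs of segments, the right one because a product of
  sums is the double sum of the products.\<close>

lemma zonotope_inequality:
  assumes A: "body A" and seg: "\<And>u v. vol A * segment_diff2 A u v \<le> segment_diff A u * segment_diff A v"
    and Z: "zonotope Y" "zonotope Z"
  shows "vol A * mixed_bilinear A Y Z \<le> mixed_linear A Y * mixed_linear A Z"
proof -
  obtain r a b m c d where Y: "Y = (\<Sum>i<r::nat. closed_segment (a i) (b i))"
    and Z': "Z = (\<Sum>i<m::nat. closed_segment (c i) (d i))" using Z by (auto simp: zonotope_def)
  have "mixed_bilinear A Y Z = (\<Sum>i<r. mixed_bilinear A (closed_segment (a i) (b i)) Z)"
    unfolding Y by (rule mixed_bilinear_sum_left[OF A body_segment zonotope_body[OF Z(2)]])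
  also have "\<dots> = (\<Sum>i<r. \<Sum>j<m. segment_diff2 A (b i - a i) (d j - c j))"
  proof (intro sum.cong refl)
    fix i
    have "mixed_bilinear A (closed_segment (a i) (b i)) Z = mixed_bilinear A Z (closed_segment (a i) (b i))" by (rule mixed_bilinear_commute)
    also have "\<dots> = (\<Sum>j<m. mixed_bilinear A (closed_segment (c j) (d j)) (closed_segment (a i) (b i)))"
      unfolding Z' by (rule mixed_bilinear_sum_left[OF A body_segment body_segment])
    also have "\<dots> = (\<Sum>j<m. segment_diff2 A (b i - a i) (d j - c j))"
      by (intro sum.cong refl) (subst mixed_bilinear_commute, rule mv_segments(2)[OF A])
    finally show "mixed_bilinear A (closed_segment (a i) (b i)) Z = (\<Sum>j<m. segment_diff2 A (b i - a i) (d j - c j))" .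
  qed
  finally have "vol A * mixed_bilinear A Y Z = (\<Sum>i<r. \<Sum>j<m. vol A * segment_diff2 A (b i - a i) (d j - c j))"
    by (simp add: sum_distrib_left)
  also have "\<dots> \<le> (\<Sum>i<r. \<Sum>j<m. segment_diff A (b i - a i) * segment_diff A (d j - c j))"
    by (intro sum_mono seg)
  also have "\<dots> = (\<Sum>i<r. segment_diff A (b i - a i)) * (\<Sum>j<m. segment_diff A (d j - c j))"
    by (simp add: sum_product)
  also have "\<dots> = mixed_linear A Y * mixed_linear A Z"
    unfolding Y Z' by (simp add: mixed_linear_sum_plain[OF A body_segment] mv_segments(1)[OF A])
  finally show ?thesis .
qed

lemma mixed_volume_outer_tendsto:
  fixes Ks :: "'a::euclidean_space set list"
  assumes Ks: "length Ks = DIM('a)" "\<And>i. i < DIM('a) \<Longrightarrow> body (Ks ! i)"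
    and L: "\<And>k. length (L k) = DIM('a)" "\<And>k i. i < DIM('a) \<Longrightarrow> body (L k ! i)"
    and sub: "\<And>k i. i < DIM('a) \<Longrightarrow> Ks ! i \<subseteq> L k ! i"
      "\<And>k i. i < DIM('a) \<Longrightarrow> L k ! i \<subseteq> Ks ! i + cball 0 (e k)"
    and e: "\<And>k. 0 \<le> e k" "e \<longlonglongrightarrow> 0"
  shows "(\<lambda>k. mixed_volume (L k)) \<longlonglongrightarrow> mixed_volume Ks"
  using polarized_volume_outer_tendsto[OF assms]
    mixed_volume_eq_pol[OF is_mixed_volume_mixed_volume Ks] mixed_volume_eq_pol[OF is_mixed_volume_mixed_volume L]
  by simp

text \<open>Mixed volumes were shown continuous along outer approximations. Adding e k times a fixed
  zonotope between the unit ball and twice that ball makes each approximant contain Z, at the cost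
  of an error 3 e k.\<close>

lemma zonoid_outer_approx:
  fixes Z :: "'a::euclidean_space set"
  assumes Z: "zonoid Z"
  obtains Y e where "\<And>k::nat. zonotope (Y k)" "\<And>k. 0 \<le> e k" "e \<longlonglongrightarrow> 0"
    "\<And>k. Z \<subseteq> Y k" "\<And>k. Y k \<subseteq> Z + cball 0 (e k)"
proof -
  obtain Y e where Y: "\<And>k::nat. zonotope (Y k)" "\<And>k. 0 \<le> e k" "e \<longlonglongrightarrow> 0"
    "\<And>k. Z \<subseteq> Y k + cball 0 (e k)" "\<And>k. Y k \<subseteq> Z + cball 0 (e k)"
    using zonoid_approx[OF Z] by metis
  obtain W :: "'a set" where W: "zonotope W" "cball 0 1 \<subseteq> W" "W \<subseteq> cball 0 (1 + 1)"
    by (rule zonotope_approx_ball[OF zero_less_one])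
  show thesis
  proof
    fix k
    show "zonotope (Y k + (*\<^sub>R) (e k) ` W)" by (intro zonotope_plus zonotope_scale Y W)
    show "0 \<le> 3 * e k" using Y(2) by simp
    have "cball 0 (e k) \<subseteq> (*\<^sub>R) (e k) ` W"
      using scale_mono[OF W(2), of "e k"] Y(2)[of k] by (simp add: scale_cball)
    then show "Z \<subseteq> Y k + (*\<^sub>R) (e k) ` W"
      using set_plus_mono2[OF order_refl[of "Y k"]] Y(4)[of k] by (meson order_trans)
    have "(*\<^sub>R) (e k) ` W \<subseteq> cball 0 (2 * e k)"
      using scale_mono[OF W(3), of "e k"] Y(2)[of k] by (simp add: scale_cball mult.commute)
    then have "Y k + (*\<^sub>R) (e k) ` W \<subseteq> (Z + cball 0 (e k)) + cball 0 (2 * e k)"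
      by (intro set_plus_mono2 Y(5))
    also have "\<dots> = Z + cball 0 (3 * e k)"
      using Y(2)[of k] by (simp add: add.assoc cball_plus_cball)
    finally show "Y k + (*\<^sub>R) (e k) ` W \<subseteq> Z + cball 0 (3 * e k)" .
  next
    show "(\<lambda>k. 3 * e k) \<longlonglongrightarrow> 0" using tendsto_mult_right_zero[OF Y(3)] .
  qed
qed

lemma zonoid_inequality:
  fixes A :: "'a::euclidean_space set"
  assumes n: "2 \<le> DIM('a)" and A: "body A" and seg: "\<And>u v. vol A * segment_diff2 A u v \<le> segment_diff A u * segment_diff A v"
    and Z: "zonoid Z1" "zonoid Z2"
  shows "vol A * mixed_bilinear A Z1 Z2 \<le> mixed_linear A Z1 * mixed_linear A Z2"
proof -
  obtain Y1 e1 where Y1: "\<And>k::nat. zonotope (Y1 k)" "\<And>k. 0 \<le> e1 k" "e1 \<longlonglongrightarrow> 0"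
    "\<And>k. Z1 \<subseteq> Y1 k" "\<And>k. Y1 k \<subseteq> Z1 + cball 0 (e1 k)" using zonoid_outer_approx[OF Z(1)] by metis
  obtain Y2 e2 where Y2: "\<And>k::nat. zonotope (Y2 k)" "\<And>k. 0 \<le> e2 k" "e2 \<longlonglongrightarrow> 0"
    "\<And>k. Z2 \<subseteq> Y2 k" "\<And>k. Y2 k \<subseteq> Z2 + cball 0 (e2 k)" using zonoid_outer_approx[OF Z(2)] by metis
  let ?n = "DIM('a)"
  have B: "body Z1" "body Z2" "body (Y1 k)" "body (Y2 k)" for k
    using zonoid_body Z zonotope_body Y1(1) Y2(1) by auto
  have triv: "K \<subseteq> K + cball 0 e" if "0 \<le> e" for K :: "'a set" and e
  proof
    fix x assume "x \<in> K"
    then have "x + 0 \<in> K + cball 0 e" using that by (intro set_plus_intro) auto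
    then show "x \<in> K + cball 0 e" by simp
  qed
  have mono: "K + cball 0 e \<subseteq> K + cball 0 e'" if "e \<le> e'" for K :: "'a set" and e e' :: real
    using that by (intro set_plus_mono2 subset_cball order_refl)
  have len1: "length (replicate (?n - 1) A @ [K]) = ?n" for K using n by simp
  have nth1: "(replicate (?n - 1) A @ [K]) ! i = (if i < ?n - 1 then A else K)" if "i < ?n" for K i
    using that by (auto simp: nth_append)
  \<comment> \<open>Here n \<ge> 2 enters: with a truncated difference the list would be too
    long.\<close>
  have len2: "length (replicate (?n - 2) A @ [K, L]) = ?n" for K L using n by simp
  have nth2: "(replicate (?n - 2) A @ [K, L]) ! i = (if i < ?n - 2 then A else if i = ?n - 2 then K else L)"
    if "i < ?n" for K L i
  proof -
    have "i < ?n - 2 \<or> i = ?n - 2 \<or> i = Suc (?n - 2)" using that n by linarith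
    then show ?thesis by (auto simp: nth_append)
  qed
  have lim1: "(\<lambda>k. mixed_linear A (Y k)) \<longlonglongrightarrow> mixed_linear A Z"
    if "body Z" "\<And>k. body (Y k)" "\<And>k. Z \<subseteq> Y k" "\<And>k. Y k \<subseteq> Z + cball 0 (e k)" "\<And>k. 0 \<le> e k" "e \<longlonglongrightarrow> 0"
    for Y and Z :: "'a set" and e :: "nat \<Rightarrow> real"
    unfolding mixed_linear_def
    by (intro tendsto_mult tendsto_const mixed_volume_outer_tendsto[where e = e] len1 that(5,6))
      (simp_all only: nth1, use that A triv in auto)
  have lim2: "(\<lambda>k. mixed_bilinear A (Y1 k) (Y2 k)) \<longlonglongrightarrow> mixed_bilinear A Z1 Z2"
  proof -
    \<comment> \<open>The continuity statement takes one error bound for all entries of the list, so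
      the two errors are added.\<close>
    have e: "0 \<le> e1 k + e2 k" "e1 k \<le> e1 k + e2 k" "e2 k \<le> e1 k + e2 k" for k using Y1(2) Y2(2) by auto
    have s: "Y1 k \<subseteq> Z1 + cball 0 (e1 k + e2 k)" "Y2 k \<subseteq> Z2 + cball 0 (e1 k + e2 k)" for k
      using order_trans[OF Y1(5) mono[OF e(2)]] order_trans[OF Y2(5) mono[OF e(3)]] by auto
    have "(\<lambda>k. e1 k + e2 k) \<longlonglongrightarrow> 0" using tendsto_add[OF Y1(3) Y2(3)] by simp
    then show ?thesis
      unfolding mixed_bilinear_def
      by (intro tendsto_mult tendsto_const mixed_volume_outer_tendsto[where e = "\<lambda>k. e1 k + e2 k"] len2 e(1))
        (simp_all only: nth2, use B A triv[OF e(1)] Y1(4) Y2(4) s in auto)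
  qed
  have "(\<lambda>k. vol A * mixed_bilinear A (Y1 k) (Y2 k)) \<longlonglongrightarrow> vol A * mixed_bilinear A Z1 Z2"
    by (intro tendsto_mult tendsto_const lim2)
  moreover have "(\<lambda>k. mixed_linear A (Y1 k) * mixed_linear A (Y2 k)) \<longlonglongrightarrow> mixed_linear A Z1 * mixed_linear A Z2"
    by (intro tendsto_mult lim1[OF B(1) B(3) Y1(4,5,2,3)] lim1[OF B(2) B(4) Y2(4,5,2,3)])
  moreover have "vol A * mixed_bilinear A (Y1 k) (Y2 k) \<le> mixed_linear A (Y1 k) * mixed_linear A (Y2 k)" for k
    by (rule zonotope_inequality[OF A seg Y1(1) Y2(1)])
  ultimately show ?thesis using LIMSEQ_le by blast
qed

section \<open>Surface area inequalities and segments\<close>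

lemma le_limit:
  fixes x y z :: real
  assumes "\<And>e. 0 < e \<Longrightarrow> x \<le> y + e * z"
  shows "x \<le> y"
proof (rule tendsto_lowerbound)
  show "((\<lambda>e. y + e * z) \<longlongrightarrow> y) (at_right 0)"
  proof -
    have "((\<lambda>e. y + e * z) \<longlongrightarrow> y + 0 * z) (at_right 0)" by (intro tendsto_intros)
    then show ?thesis by simp
  qed
  show "\<forall>\<^sub>F e in at_right 0. x \<le> y + e * z"
    using eventually_at_right_less[of "0::real"] by eventually_elim (use assms in auto)
qed simp

text \<open>Adding |A| times \<open>segment_diff A v\<close> to both sides, the hypothesis compares
  the derivatives of the volume along [0,v] at A + [0,u] and at A. This form is additive in the
  segment, so it holds for a zonotope Z with B \<subseteq> Z \<subseteq> (1 + e) B, and monotonicity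
  passes it to the ball B.\<close>

lemma segments_imp_surface:
  fixes A :: "'a::euclidean_space set"
  assumes A: "body A" and seg: "\<And>v. vol A * segment_diff2 A u v \<le> segment_diff A u * segment_diff A v"
  shows "vol A * surface_area (A + closed_segment 0 u) \<le> surface_area A * vol (A + closed_segment 0 u)"
proof -
  let ?Au = "A + closed_segment 0 u" and ?B = "cball (0::'a) 1"
  have Au: "body ?Au" by (intro body_plus A body_segment)
  have B: "body ?B" by (rule body_cball) simp
  have volAu: "vol ?Au = vol A + segment_diff A u" by (simp add: segment_diff_def)
  have segment_diff: "vol A * segment_diff ?Au v \<le> vol ?Au * segment_diff A v" for v
    using seg[of v] unfolding volAu by (simp add: segment_diff_def segment_diff2_def algebra_simps)
  have "vol A * mixed_linear ?Au ?B \<le> vol ?Au * mixed_linear A ?B + e * (vol ?Au * mixed_linear A ?B)" if e: "0 < e" for e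
  proof -
    obtain Z :: "'a set" where Z: "zonotope Z" "?B \<subseteq> Z" "Z \<subseteq> cball 0 (1 + e)"
      using zonotope_approx_ball[OF e] by blast
    obtain r a b where Zs: "Z = (\<Sum>i<r::nat. closed_segment (a i) (b i))" using Z(1) by (auto simp: zonotope_def)
    have mv1Z: "mixed_linear X Z = (\<Sum>i<r. segment_diff X (b i - a i))" if "body X" for X
      unfolding Zs by (simp add: mixed_linear_sum_plain[OF that body_segment] mv_segments(1)[OF that])
    have "vol A * mixed_linear ?Au ?B \<le> vol A * mixed_linear ?Au Z"
      using Z by (intro mult_left_mono mixed_linear_mono Au B zonotope_body) auto
    also have "\<dots> = (\<Sum>i<r. vol A * segment_diff ?Au (b i - a i))" by (simp add: mv1Z[OF Au] sum_distrib_left)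
    also have "\<dots> \<le> (\<Sum>i<r. vol ?Au * segment_diff A (b i - a i))" by (intro sum_mono segment_diff)
    also have "\<dots> = vol ?Au * mixed_linear A Z" by (simp add: mv1Z[OF A] sum_distrib_left)
    also have "\<dots> \<le> vol ?Au * mixed_linear A (cball 0 (1 + e))"
      using Z e by (intro mult_left_mono mixed_linear_mono A zonotope_body body_cball) auto
    also have "mixed_linear A (cball 0 (1 + e)) = (1 + e) * mixed_linear A ?B"
      using mixed_linear_add[OF A B B, of 1 e] e by (simp add: scale_cball cball_plus_cball algebra_simps)
    finally show ?thesis by (simp add: algebra_simps)
  qed
  then have "vol A * mixed_linear ?Au ?B \<le> vol ?Au * mixed_linear A ?B" by (rule le_limit)
  then show ?thesis by (simp add: surface_area_mv1 mult.commute)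
qed

lemma mixed_linear_linear_image:
  fixes T :: "'a::euclidean_space \<Rightarrow> 'a"
  assumes A: "body A" and K: "body K" and lin: "linear T"
    and k: "\<And>S. S \<in> sets borel \<Longrightarrow> vol (T ` S) = k * vol S"
  shows "mixed_linear (T ` A) (T ` K) = k * mixed_linear A K"
proof (rule expands_unique(2)[OF vol_expands expands_cmult[OF vol_expands[OF A K]]])
  show "body (T ` A)" "body (T ` K)" using A K lin by (auto intro: body_linear_image)
  fix t :: real
  have "T ` A + (*\<^sub>R) t ` T ` K = T ` (A + (*\<^sub>R) t ` K)"
    by (simp only: linear_image_plus[OF lin] linear_image_scale[OF lin])
  then show "vol (T ` A + (*\<^sub>R) t ` T ` K) = k * vol (A + (*\<^sub>R) t ` K)"
    using k[of "A + (*\<^sub>R) t ` K"] A K by (simp add: body_borel body_plus body_scale)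
qed

text \<open>
  The ball is the image of thin ellipsoids around the segment \<open>[-v, v]\<close> under linear maps, so that
  surface area inequalities for all linear images of \<open>A\<close> bound mixed volumes with segments.
\<close>

lemma surface_imp_segments:
  fixes A :: "'a::euclidean_space set"
  assumes A: "body A"
    and surf: "\<And>T :: 'a \<Rightarrow> 'a. linear T \<Longrightarrow> vol (T ` A) * surface_area (T ` A + closed_segment 0 (T u))
      \<le> surface_area (T ` A) * vol (T ` A + closed_segment 0 (T u))"
  shows "vol A * segment_diff2 A u v \<le> segment_diff A u * segment_diff A v"
proof (cases "v = 0")
  case True
  then show ?thesis by (simp add: segment_diff2_zero[OF A] segment_diff_def)
next
  case False
  let ?Au = "A + closed_segment 0 u" and ?B = "cball (0::'a) 1" and ?S = "closed_segment (- v) v"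
  have Au: "body ?Au" by (intro body_plus A body_segment)
  have B: "body ?B" by (rule body_cball) simp
  define e where "e = (1 / norm v) *\<^sub>R v"
  have ne: "norm e = 1" using False by (simp add: e_def)
  then have e: "e \<bullet> e = 1" "v = norm v *\<^sub>R e" "norm e = 1" using False by (simp_all add: e_def[symmetric] norm_eq_1) (simp add: e_def)
  have "vol A * (2 * segment_diff ?Au v) \<le> 2 * segment_diff A v * vol ?Au + d * (mixed_linear A ?B * vol ?Au)" if d: "0 < d" for d
  proof -
    \<comment> \<open>L maps e to v and contracts the complement of e by d, so the image of the ball
      B is an ellipsoid between [-v,v] and [-v,v] + d B. The inverse T turns it back into the
      ball.\<close>
    define L where "L x = (x \<bullet> e) *\<^sub>R v + d *\<^sub>R (x - (x \<bullet> e) *\<^sub>R e)" for x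
    have linL: "linear L"
      by (rule linearI) (simp_all add: L_def inner_add_left scaleR_add_left scaleR_add_right scaleR_diff_right mult.left_commute)
    have injL: "inj L"
    proof (subst linear_injective_0[OF linL], intro allI impI)
      fix x assume Lx: "L x = 0"
      have "L x \<bullet> e = (x \<bullet> e) * norm v"
        using e(1) arg_cong[OF e(2), of "\<lambda>y. y \<bullet> e"] by (simp add: L_def inner_add_left inner_diff_left)
      then have "x \<bullet> e = 0" using Lx False by simp
      then show "x = 0" using Lx d by (simp add: L_def)
    qed
    obtain T where T: "linear T" "\<And>x. T (L x) = x" "\<And>x. L (T x) = x"
      using linear_injective_isomorphism[OF linL injL] by auto
    have injT: "inj T" by (rule inj_on_inverseI[of _ L]) (rule T(3))
    obtain k where k: "0 < k" "\<And>S. S \<in> sets borel \<Longrightarrow> T ` S \<in> sets borel \<and> vol (T ` S) = k * vol S"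
      using lborel_linear_image[OF T(1) injT] by metis
    have LB: "body (L ` ?B)" by (intro body_linear_image B linL)
    have TLB: "T ` L ` ?B = ?B" by (auto simp: image_image T(2))
    have mvT: "mixed_linear (T ` X) ?B = k * mixed_linear X (L ` ?B)" if "body X" for X
      using mixed_linear_linear_image[OF that LB T(1), of k] k(2) by (simp add: TLB)
    have TAu: "T ` A + closed_segment 0 (T u) = T ` ?Au"
      using closed_segment_linear_image[OF T(1), of 0 u] linear_0[OF T(1)] by (simp add: linear_image_plus[OF T(1)])
    have "k * vol A * (k * mixed_linear ?Au (L ` ?B)) \<le> k * mixed_linear A (L ` ?B) * (k * vol ?Au)"
      using surf[OF T(1)] k(2)[OF body_borel[OF A]] k(2)[OF body_borel[OF Au]]
      unfolding TAu surface_area_mv1 mvT[OF A] mvT[OF Au] by simp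
    \<comment> \<open>Each side picks up k twice, once from a volume and once from a mixed volume,
      so the factor cancels.\<close>
    then have "(k * k) * (vol A * mixed_linear ?Au (L ` ?B)) \<le> (k * k) * (mixed_linear A (L ` ?B) * vol ?Au)"
      by (simp add: mult_ac)
    then have main: "vol A * mixed_linear ?Au (L ` ?B) \<le> mixed_linear A (L ` ?B) * vol ?Au" using k(1) by simp
    have sub: "?S \<subseteq> L ` ?B"
    proof -
      have "L e = v" by (simp add: L_def e(1))
      then have "L (- e) = - v" by (simp add: linear_neg[OF linL])
      then have "v \<in> L ` ?B" "- v \<in> L ` ?B"
        using \<open>L e = v\<close> e(3) by (metis imageI mem_cball_0 norm_minus_cancel order_refl)+
      then show ?thesis using bodyD(2)[OF LB] by (simp add: closed_segment_subset)
    qed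
    have sup: "L ` ?B \<subseteq> (*\<^sub>R) 1 ` ?S + (*\<^sub>R) d ` ?B"
    proof
      fix y assume "y \<in> L ` ?B"
      then obtain x where x: "norm x \<le> 1" "y = L x" by auto
      have xe: "\<bar>x \<bullet> e\<bar> \<le> 1" using Cauchy_Schwarz_ineq2[of x e] x(1) e(3) by simp
      have "(x \<bullet> e) *\<^sub>R v \<in> ?S"
        unfolding in_segment using xe
        by (intro exI[of _ "(1 + x \<bullet> e) / 2"]) (auto simp: abs_le_iff algebra_simps scaleR_add_left[symmetric])
      moreover have "x - (x \<bullet> e) *\<^sub>R e \<in> ?B"
      proof -
        have "(norm (x - (x \<bullet> e) *\<^sub>R e))\<^sup>2 = (norm x)\<^sup>2 - (x \<bullet> e)\<^sup>2"
          unfolding power2_norm_eq_inner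
          by (simp add: inner_diff_left inner_diff_right e(1) inner_commute[of e x] power2_eq_square)
        then have "(norm (x - (x \<bullet> e) *\<^sub>R e))\<^sup>2 \<le> (norm x)\<^sup>2" by simp
        then have "norm (x - (x \<bullet> e) *\<^sub>R e) \<le> norm x" by (rule power2_le_imp_le) simp
        then show ?thesis using x(1) by simp
      qed
      ultimately show "y \<in> (*\<^sub>R) 1 ` ?S + (*\<^sub>R) d ` ?B"
        unfolding x(2) L_def scale_one by (intro set_plus_intro imageI)
    qed
    \<comment> \<open>The segment [-v,v] is a translate of [0,2v]; the factor 2 cancels at the
      end.\<close>
    have segS: "mixed_linear X ?S = 2 * segment_diff X v" if "body X" for X
      using mv_segments(1)[OF that, of "- v" v] segment_diff_scale[OF that, of 2 v] by (simp add: scaleR_2)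
    have "vol A * (2 * segment_diff ?Au v) \<le> vol A * mixed_linear ?Au (L ` ?B)"
      unfolding segS[OF Au, symmetric] by (intro mult_left_mono mixed_linear_mono Au body_segment LB sub) simp
    also have "\<dots> \<le> mixed_linear A (L ` ?B) * vol ?Au" by (rule main)
    also have "\<dots> \<le> mixed_linear A ((*\<^sub>R) 1 ` ?S + (*\<^sub>R) d ` ?B) * vol ?Au"
      by (intro mult_right_mono mixed_linear_mono A LB body_plus body_scale body_segment B sup) simp
    also have "mixed_linear A ((*\<^sub>R) 1 ` ?S + (*\<^sub>R) d ` ?B) = 1 * mixed_linear A ?S + d * mixed_linear A ?B"
      using d by (intro mixed_linear_add A body_segment B) auto
    finally show ?thesis unfolding segS[OF A] by (simp add: algebra_simps)
  qed
  then have "vol A * (2 * segment_diff ?Au v) \<le> 2 * segment_diff A v * vol ?Au" by (rule le_limit)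
  then show ?thesis by (simp add: segment_diff_def segment_diff2_def algebra_simps)
qed

text \<open>The leading coefficient may be 0. Then the discriminant condition holds trivially, and
  the polynomial is linear, a nonzero constant or 0, each of which counts as real-rooted.\<close>

lemma real_rooted_quadratic:
  fixes a b c :: real
  shows "real_rooted [:c, b, a:] \<longleftrightarrow> 4 * (a * c) \<le> b\<^sup>2"
proof
  assume rr: "real_rooted [:c, b, a:]"
  show "4 * (a * c) \<le> b\<^sup>2"
  proof (rule ccontr)
    assume "\<not> 4 * (a * c) \<le> b\<^sup>2"
    then have D: "0 < 4 * (a * c) - b\<^sup>2" by simp
    then have a: "a \<noteq> 0" by (auto simp: not_less)
    define y where "y = sqrt (4 * (a * c) - b\<^sup>2)"
    have y: "y\<^sup>2 = 4 * (a * c) - b\<^sup>2" "y \<noteq> 0" using D by (auto simp: y_def)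
    \<comment> \<open>X + iY is the root from the quadratic formula; it is not real when the
      discriminant is negative.\<close>
    define X where "X = - b / (2 * a)"
    define Y where "Y = y / (2 * a)"
    let ?z = "Complex X Y"
    have b: "b = - 2 * a * X" and yY: "y = 2 * a * Y" using a by (simp_all add: X_def Y_def)
    have "4 * (a * (c - a * X\<^sup>2 - a * Y\<^sup>2)) = 0"
      using y(1) unfolding yY b by (simp add: algebra_simps power2_eq_square)
    then have c: "c = a * X\<^sup>2 + a * Y\<^sup>2" using a by simp
    have "poly (map_poly complex_of_real [:c, b, a:]) ?z = of_real c + ?z * (of_real b + ?z * of_real a)"
      by (simp add: map_poly_pCons)
    also have "\<dots> = 0"
      unfolding b c by (simp add: complex_eq_iff power2_eq_square algebra_simps)
    finally have "?z \<in> \<real>" using rr a by (auto simp: real_rooted_def)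
    then show False using a y(2) by (simp add: complex_is_Real_iff Y_def)
  qed
next
  assume D: "4 * (a * c) \<le> b\<^sup>2"
  show "real_rooted [:c, b, a:]"
    unfolding real_rooted_def disj_imp
  proof (intro allI impI)
    fix z assume ne: "[:c, b, a:] \<noteq> 0" and z: "poly (map_poly complex_of_real [:c, b, a:]) z = 0"
    define x where "x = Re z"
    define y where "y = Im z"
    have "of_real c + z * (of_real b + z * of_real a) = 0"
      using z by (simp add: map_poly_pCons)
    then have re: "c + (x * (b + x * a) - y * (y * a)) = 0" and im: "x * (y * a) + y * (b + x * a) = 0"
      by (simp_all add: complex_eq_iff x_def y_def)
    show "z \<in> \<real>"
    proof (rule ccontr)
      assume "z \<notin> \<real>"
      then have y: "y \<noteq> 0" by (simp add: complex_is_Real_iff y_def)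
      have "y * (2 * a * x + b) = 0" using im by (simp add: algebra_simps)
      then have b: "b = - 2 * a * x" using y by simp
      have "c = a * x\<^sup>2 + a * y\<^sup>2" using re unfolding b by (simp add: algebra_simps power2_eq_square)
      then have "4 * (a * c) - b\<^sup>2 = 4 * (a * y)\<^sup>2" unfolding b by (simp add: algebra_simps power2_eq_square)
      with D have "(a * y)\<^sup>2 \<le> 0" by linarith
      then have "a = 0" using y by simp
      with b \<open>c = a * x\<^sup>2 + a * y\<^sup>2\<close> ne show False by simp
    qed
  qed
qed

text \<open>The choice s = b, r = a gives equality between arithmetic and geometric mean of s a and
  r b. If a or b is 0 and m were positive, the left-hand side would be unbounded in the matching
  scale while the right-hand side stays fixed.\<close>

lemma discriminant_scaled:
  fixes a b m :: real
  assumes ab: "0 \<le> a" "0 \<le> b" and D: "\<And>s r. 0 < s \<Longrightarrow> 0 < r \<Longrightarrow> 4 * (s * r * m) \<le> (s * a + r * b)\<^sup>2"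
  shows "m \<le> a * b"
proof (cases "m \<le> 0")
  case True
  then show ?thesis using mult_nonneg_nonneg[OF ab] by linarith
next
  case False
  have zero: False if "\<And>s. 0 < s \<Longrightarrow> 4 * (s * m) \<le> d\<^sup>2" for d
  proof -
    \<comment> \<open>The scale s = (d^2 + 1) / m makes the left-hand side exceed d^2.\<close>
    have "4 * ((d\<^sup>2 + 1) / m * m) \<le> d\<^sup>2" using False by (intro that) (simp add: add_nonneg_pos)
    then have "4 * (d\<^sup>2 + 1) \<le> d\<^sup>2" using False by simp
    moreover have "\<not> 4 * (x + 1) \<le> x" if "0 \<le> x" for x :: real using that by simp
    ultimately show False using zero_le_power2[of d] by blast
  qed
  have a: "a \<noteq> 0"
  proof
    assume "a = 0"
    then show False using D[of _ 1] by (intro zero[of b]) simp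
  qed
  have b: "b \<noteq> 0"
  proof
    assume "b = 0"
    then show False using D[of 1] by (intro zero[of a]) simp
  qed
  have p: "0 < a" "0 < b" using a b ab by auto
  have "4 * (b * a * m) \<le> (b * a + a * b)\<^sup>2" by (rule D[OF p(2,1)])
  also have "\<dots> = 4 * (b * a * (a * b))" by (simp add: power2_eq_square algebra_simps)
  finally show ?thesis using p by simp
qed

section \<open>The six statements for a fixed body\<close>

lemma closed_segment_zonoid: "zonoid (closed_segment a b)"
  unfolding zonoid_def
proof (intro conjI exI[of _ "\<lambda>_. closed_segment a b"] allI)
  have "infdist x (closed_segment a b) = 0" if "x \<in> closed_segment a b" for x
    using that by simp
  then have "(SUP x\<in>closed_segment a b. infdist x (closed_segment a b)) = (SUP x\<in>closed_segment a b. 0)"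
    by (intro SUP_cong) auto
  also have "\<dots> = (0::real)" by (rule cSUP_const) simp
  finally have "hausdorff_dist (closed_segment a b) (closed_segment a b) = 0" by (simp add: hausdorff_dist_def)
  then show "(\<lambda>k. hausdorff_dist (closed_segment a b) (closed_segment a b)) \<longlonglongrightarrow> 0" by simp
qed (simp_all add: zonotope_segment)

text \<open>Every statement of the theorem is equivalent to \<open>segment_inequality\<close> for all \<open>A\<close> in the class.\<close>

definition segment_inequality :: "'a::euclidean_space set \<Rightarrow> bool" where
  "segment_inequality A \<longleftrightarrow> (\<forall>u v. vol A * segment_diff2 A u v \<le> segment_diff A u * segment_diff A v)"

text \<open>With w for the volume, a and b for the first differences and c for the second one, this
  is (w + a + b + c) w \<le> (w + a) (w + b), where all terms cancel except w c and a b.\<close>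

lemma volume_inequality_iff:
  "vol (A + closed_segment 0 u + closed_segment 0 v) * vol A
    \<le> vol (A + closed_segment 0 u) * vol (A + closed_segment 0 v)
    \<longleftrightarrow> vol A * segment_diff2 A u v \<le> segment_diff A u * segment_diff A v"
  by (simp add: segment_diff_def segment_diff2_def algebra_simps)

text \<open>For u = s e with a unit vector e, both sides of the first inequality are affine in s
  with the same constant term, so only their slopes are compared.\<close>

lemma surface_inequality_iff:
  fixes A :: "'a::euclidean_space set"
  assumes A: "body A"
  shows "(\<forall>u. vol A * surface_area (A + closed_segment 0 u) \<le> surface_area A * vol (A + closed_segment 0 u))
    \<longleftrightarrow> (\<forall>u\<in>sphere 0 1. vol A * surface_area_in ({u}\<^sup>\<bottom>) (orth_proj ({u}\<^sup>\<bottom>) ` A)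
         \<le> surface_area A * volume_in ({u}\<^sup>\<bottom>) (orth_proj ({u}\<^sup>\<bottom>) ` A))"
    (is "(\<forall>u. ?L u) \<longleftrightarrow> (\<forall>u\<in>_. ?R u)")
proof -
  have LR: "?L (s *\<^sub>R e) \<longleftrightarrow> ?R e" if e: "norm e = 1" and s: "0 < s" for e s
  proof -
    have "?L (s *\<^sub>R e) \<longleftrightarrow> s * (vol A * surface_area_in ({e}\<^sup>\<bottom>) (orth_proj ({e}\<^sup>\<bottom>) ` A))
        \<le> s * (surface_area A * volume_in ({e}\<^sup>\<bottom>) (orth_proj ({e}\<^sup>\<bottom>) ` A))"
      using s by (simp add: surface_area_add_segment[OF e A] segment_volume[OF e A] algebra_simps)
    then show ?thesis using s by simp
  qed
  show ?thesis
  proof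
    assume L: "\<forall>u. ?L u"
    show "\<forall>u\<in>sphere 0 1. ?R u"
    proof
      fix u :: 'a assume "u \<in> sphere 0 1"
      then show "?R u" using LR[of u 1] L[rule_format, of u] by simp
    qed
  next
    assume R: "\<forall>u\<in>sphere 0 1. ?R u"
    show "\<forall>u. ?L u"
    proof
      fix u :: 'a
      show "?L u"
      proof (cases "u = 0")
        case True
        then show ?thesis by (simp add: mult.commute)
      next
        case False
        then have "?R ((1 / norm u) *\<^sub>R u)" by (intro R[rule_format]) simp
        then show ?thesis using LR[of "(1 / norm u) *\<^sub>R u" "norm u"] False by simp
      qed
    qed
  qed
qed

text \<open>On unit vectors both forms coincide; homogeneity in u and in v separately extends the
  segment inequality to all vectors.\<close>

lemma projection_inequality_iff:
  fixes A :: "'a::euclidean_space set"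
  assumes A: "body A"
  shows "(\<forall>u\<in>sphere 0 1. \<forall>v\<in>sphere 0 1.
       vol A * volume_in ((span {u, v})\<^sup>\<bottom>) (orth_proj ((span {u, v})\<^sup>\<bottom>) ` A) * sqrt (1 - (u \<bullet> v)\<^sup>2)
         \<le> volume_in ({u}\<^sup>\<bottom>) (orth_proj ({u}\<^sup>\<bottom>) ` A) * volume_in ({v}\<^sup>\<bottom>) (orth_proj ({v}\<^sup>\<bottom>) ` A))
    \<longleftrightarrow> segment_inequality A"
    (is "(\<forall>u\<in>_. \<forall>v\<in>_. ?R u v) \<longleftrightarrow> _")
proof -
  let ?L = "\<lambda>u v. vol A * segment_diff2 A u v \<le> segment_diff A u * segment_diff A v"
  have LR: "?L u v \<longleftrightarrow> ?R u v" if "norm u = 1" "norm v = 1" for u v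
    by (simp only: segment_diff2_unit[OF A that] segment_diff_unit[OF that(1) A] segment_diff_unit[OF that(2) A] mult.assoc)
  have scale: "?L (s *\<^sub>R u) (t *\<^sub>R v)" if "?L u v" "0 \<le> s" "0 \<le> t" for s t u v
    using mult_left_mono[OF that(1) mult_nonneg_nonneg[OF that(2,3)]] that(2,3)
    by (simp add: segment_diff2_scale[OF A] segment_diff_scale[OF A] mult_ac)
  show ?thesis
  proof
    assume R: "\<forall>u\<in>sphere 0 1. \<forall>v\<in>sphere 0 1. ?R u v"
    show "segment_inequality A"
      unfolding segment_inequality_def
    proof (intro allI)
      fix u v :: 'a
      consider "u = 0" | "v = 0" | "u \<noteq> 0" "v \<noteq> 0" by blast
      then show "?L u v"
      proof cases
        case 1
        then show ?thesis using segment_diff2_scale[OF A, of 0 1 u v] segment_diff_nonneg[OF A] by simp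
      next
        case 2
        then show ?thesis using segment_diff2_zero[OF A] segment_diff_nonneg[OF A] by simp
      next
        case 3
        let ?u = "(1 / norm u) *\<^sub>R u" and ?v = "(1 / norm v) *\<^sub>R v"
        have "norm ?u = 1" "norm ?v = 1" using 3 by auto
        then have "?L ?u ?v" using R LR by simp
        from scale[OF this, of "norm u" "norm v"] show ?thesis using 3 by simp
      qed
    qed
  next
    assume "segment_inequality A"
    then show "\<forall>u\<in>sphere 0 1. \<forall>v\<in>sphere 0 1. ?R u v"
      using LR unfolding segment_inequality_def by simp
  qed
qed

text \<open>Multiplying by n (n - 1), which is positive since n \<ge> 2, absorbs the constant; one
  direction then holds because segments are zonoids.\<close>

lemma zonoid_inequality_iff:
  fixes A :: "'a::euclidean_space set"
  assumes n: "2 \<le> DIM('a)" and A: "body A"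
  shows "(\<forall>Z1 Z2. zonoid Z1 \<longrightarrow> zonoid Z2 \<longrightarrow>
       vol A * mixed_volume (replicate (DIM('a) - 2) A @ [Z1, Z2])
         \<le> real DIM('a) / (real DIM('a) - 1) * mixed_volume (replicate (DIM('a) - 1) A @ [Z1])
           * mixed_volume (replicate (DIM('a) - 1) A @ [Z2]))
    \<longleftrightarrow> segment_inequality A"
    (is "(\<forall>Z1 Z2. _ \<longrightarrow> _ \<longrightarrow> ?R Z1 Z2) \<longleftrightarrow> _")
proof -
  have R: "?R Z1 Z2 \<longleftrightarrow> vol A * mixed_bilinear A Z1 Z2 \<le> mixed_linear A Z1 * mixed_linear A Z2" for Z1 Z2
  proof -
    let ?n = "real DIM('a)"
    have n': "0 < ?n * (?n - 1)" "?n - 1 \<noteq> 0" using n by auto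
    let ?w = "mixed_volume (replicate (DIM('a) - 2) A @ [Z1, Z2])"
    let ?x = "mixed_volume (replicate (DIM('a) - 1) A @ [Z1])" and ?y = "mixed_volume (replicate (DIM('a) - 1) A @ [Z2])"
    have "vol A * mixed_bilinear A Z1 Z2 = (?n * (?n - 1)) * (vol A * ?w)" by (simp add: mixed_bilinear_def)
    moreover have "mixed_linear A Z1 * mixed_linear A Z2 = (?n * (?n - 1)) * (?n / (?n - 1) * ?x * ?y)"
      using n'(2) by (simp add: mixed_linear_def)
    ultimately show ?thesis using n'(1) by (simp only: mult_le_cancel_left_pos)
  qed
  show ?thesis
  proof
    assume *: "\<forall>Z1 Z2. zonoid Z1 \<longrightarrow> zonoid Z2 \<longrightarrow> ?R Z1 Z2"
    show "segment_inequality A"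
      unfolding segment_inequality_def
    proof (intro allI)
      fix u v :: 'a
      have "?R (closed_segment 0 u) (closed_segment 0 v)"
        using * closed_segment_zonoid by blast
      then show "vol A * segment_diff2 A u v \<le> segment_diff A u * segment_diff A v"
        unfolding R by (simp add: mv_segments[OF A])
    qed
  next
    assume "segment_inequality A"
    then have "vol A * segment_diff2 A u v \<le> segment_diff A u * segment_diff A v" for u v by (simp add: segment_inequality_def)
    from zonoid_inequality[OF n A this] show "\<forall>Z1 Z2. zonoid Z1 \<longrightarrow> zonoid Z2 \<longrightarrow> ?R Z1 Z2"
      unfolding R by blast
  qed
qed

text \<open>For a single pair u, v the discriminant condition bounds |A| times the second difference
  only by the squared arithmetic mean of the first differences; imposed on all positive multiples of
  u and v, it sharpens to their product.\<close>

lemma real_rooted_iff: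
  fixes A :: "'a::euclidean_space set"
  assumes A: "body A"
  shows "(\<forall>u v. \<exists>p. real_rooted p \<and>
       (\<forall>t>0. vol (A + (*\<^sub>R) t ` (closed_segment 0 u + closed_segment 0 v)) = poly p t))
    \<longleftrightarrow> segment_inequality A"
    (is "(\<forall>u v. ?R u v) \<longleftrightarrow> _")
proof -
  have R: "?R u v \<longleftrightarrow> 4 * (segment_diff2 A u v * vol A) \<le> (segment_diff A u + segment_diff A v)\<^sup>2" for u v
  proof -
    let ?q = "[:vol A, segment_diff A u + segment_diff A v, segment_diff2 A u v:]"
    have q: "vol (A + (*\<^sub>R) t ` (closed_segment 0 u + closed_segment 0 v)) = poly ?q t" if "0 < t" for t
      using vol_add_segments[OF A, of t t u v] that
      by (simp add: scale_plus scale_segment add.assoc algebra_simps)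
    have "?R u v \<longleftrightarrow> real_rooted ?q"
    proof
      assume "?R u v"
      then obtain p where p: "real_rooted p"
        "\<forall>t>0. vol (A + (*\<^sub>R) t ` (closed_segment 0 u + closed_segment 0 v)) = poly p t" by blast
      have "p = ?q" by (rule poly_eq_on_nonneg) (use p(2) q in simp)
      with p(1) show "real_rooted ?q" by simp
    next
      assume "real_rooted ?q"
      with q show "?R u v" by blast
    qed
    then show ?thesis by (simp only: real_rooted_quadratic)
  qed
  show ?thesis
  proof
    assume *: "\<forall>u v. ?R u v"
    show "segment_inequality A"
      unfolding segment_inequality_def
    proof (intro allI)
      fix u v :: 'a
      show "vol A * segment_diff2 A u v \<le> segment_diff A u * segment_diff A v"
      proof (rule discriminant_scaled)
        show "0 \<le> segment_diff A u" "0 \<le> segment_diff A v" by (rule segment_diff_nonneg[OF A])+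
        fix s r :: real assume sr: "0 < s" "0 < r"
        have "4 * (segment_diff2 A (s *\<^sub>R u) (r *\<^sub>R v) * vol A) \<le> (segment_diff A (s *\<^sub>R u) + segment_diff A (r *\<^sub>R v))\<^sup>2"
          using * R by blast
        then show "4 * (s * r * (vol A * segment_diff2 A u v)) \<le> (s * segment_diff A u + r * segment_diff A v)\<^sup>2"
          using sr by (simp add: segment_diff2_scale[OF A] segment_diff_scale[OF A] mult_ac)
      qed
    qed
  next
    assume si: "segment_inequality A"
    show "\<forall>u v. ?R u v"
      unfolding R
    proof (intro allI)
      fix u v :: 'a
      have "4 * (segment_diff2 A u v * vol A) \<le> 4 * (segment_diff A u * segment_diff A v)"
        using si by (simp add: segment_inequality_def mult.commute)
      also have "\<dots> \<le> (segment_diff A u + segment_diff A v)\<^sup>2"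
        using zero_le_power2[of "segment_diff A u - segment_diff A v"] by (simp add: power2_eq_square algebra_simps)
      finally show "4 * (segment_diff2 A u v * vol A) \<le> (segment_diff A u + segment_diff A v)\<^sup>2" .
    qed
  qed
qed

lemma mixed_volume_empty: "{} \<in> set Ks \<Longrightarrow> mixed_volume Ks = (0::real)" for Ks :: "'a::euclidean_space set list"
  using is_mixed_volume_mixed_volume[where 'a='a] unfolding is_mixed_volume_def by blast

theorem theorem3p9:
  fixes \<L> :: "(real ^ 'n) set set"
  assumes "2 \<le> CARD('n)"
    and "\<And>A. A \<in> \<L> \<Longrightarrow> compact A \<and> convex A"
    and "\<And>A f. A \<in> \<L> \<Longrightarrow> linear f \<Longrightarrow> f ` A \<in> \<L>"
  shows "all_equivalent
    [\<forall>A\<in>\<L>. \<forall>u.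
       measure lborel A * surface_area (A + closed_segment 0 u)
         \<le> surface_area A * measure lborel (A + closed_segment 0 u),
     \<forall>A\<in>\<L>. \<forall>u\<in>sphere 0 1.
       measure lborel A * surface_area_in ({u}\<^sup>\<bottom>) (orth_proj ({u}\<^sup>\<bottom>) ` A)
         \<le> surface_area A * volume_in ({u}\<^sup>\<bottom>) (orth_proj ({u}\<^sup>\<bottom>) ` A),
     \<forall>A\<in>\<L>. \<forall>u\<in>sphere 0 1. \<forall>v\<in>sphere 0 1.
       measure lborel A
           * volume_in ((span {u, v})\<^sup>\<bottom>) (orth_proj ((span {u, v})\<^sup>\<bottom>) ` A)
           * sqrt (1 - (u \<bullet> v)\<^sup>2)
         \<le> volume_in ({u}\<^sup>\<bottom>) (orth_proj ({u}\<^sup>\<bottom>) ` A)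
           * volume_in ({v}\<^sup>\<bottom>) (orth_proj ({v}\<^sup>\<bottom>) ` A),
     \<forall>A\<in>\<L>. \<forall>u v.
       measure lborel (A + closed_segment 0 u + closed_segment 0 v) * measure lborel A
         \<le> measure lborel (A + closed_segment 0 u) * measure lborel (A + closed_segment 0 v),
     \<forall>A\<in>\<L>. \<forall>Z\<^sub>1 Z\<^sub>2. zonoid Z\<^sub>1 \<longrightarrow> zonoid Z\<^sub>2 \<longrightarrow>
       measure lborel A * mixed_volume (replicate (CARD('n) - 2) A @ [Z\<^sub>1, Z\<^sub>2])
         \<le> real CARD('n) / (real CARD('n) - 1)
           * mixed_volume (replicate (CARD('n) - 1) A @ [Z\<^sub>1])
           * mixed_volume (replicate (CARD('n) - 1) A @ [Z\<^sub>2]),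
     \<forall>A\<in>\<L>. \<forall>u v. \<exists>p. real_rooted p \<and>
       (\<forall>t>0. measure lborel (A + (*\<^sub>R) t ` (closed_segment 0 u + closed_segment 0 v)) = poly p t)]"
proof -
  let ?S1 = "\<lambda>A u. vol A * surface_area (A + closed_segment 0 u) \<le> surface_area A * vol (A + closed_segment 0 u)"
  have n: "2 \<le> DIM(real ^ 'n)" using assms(1) by simp
  have body: "body A" if "A \<in> \<L>" "A \<noteq> {}" for A
    using assms(2)[OF that(1)] that(2) by (simp add: body_def)
  have imageL: "f ` A \<in> \<L>" if "A \<in> \<L>" "linear f" for A f using assms(3) that .
  \<comment> \<open>The class may contain the empty set, for which every statement holds trivially;
    the comparison takes place on the nonempty members.\<close>
  define C where "C \<longleftrightarrow> (\<forall>A\<in>\<L>. A \<noteq> {} \<longrightarrow> segment_inequality A)"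
  have red: "(\<forall>A\<in>\<L>. P A) \<longleftrightarrow> C"
    if "P {}" "\<And>A. A \<in> \<L> \<Longrightarrow> body A \<Longrightarrow> P A \<longleftrightarrow> segment_inequality A" for P
    unfolding C_def using that body by metis
  \<comment> \<open>This equivalence is not proved member by member: the segment inequality for A is
    deduced from the surface inequality for all linear images of A, and here the stability of the
    class enters.\<close>
  have surface: "(\<forall>A\<in>\<L>. \<forall>u. ?S1 A u) \<longleftrightarrow> C"
  proof
    assume *: "\<forall>A\<in>\<L>. \<forall>u. ?S1 A u"
    show C
      unfolding C_def segment_inequality_def
    proof (intro ballI impI allI)
      fix A u v assume A: "A \<in> \<L>" "A \<noteq> {}"
      show "vol A * segment_diff2 A u v \<le> segment_diff A u * segment_diff A v"
        by (rule surface_imp_segments[OF body[OF A]]) (use * imageL[OF A(1)] in blast)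
    qed
  next
    assume C
    show "\<forall>A\<in>\<L>. \<forall>u. ?S1 A u"
    proof (intro ballI allI)
      fix A u assume A: "A \<in> \<L>"
      show "?S1 A u"
      proof (cases "A = {}")
        case True
        then show ?thesis by simp
      next
        case False
        then show ?thesis
          using \<open>C\<close> A unfolding C_def segment_inequality_def
          by (intro segments_imp_surface body[OF A]) blast+
      qed
    qed
  qed
  \<comment> \<open>For each member the projected form is equivalent to the surface inequality, so
    it is reduced to that one rather than directly to C.\<close>
  have 2: "(\<forall>A\<in>\<L>. \<forall>u\<in>sphere 0 1.
       vol A * surface_area_in ({u}\<^sup>\<bottom>) (orth_proj ({u}\<^sup>\<bottom>) ` A)
         \<le> surface_area A * volume_in ({u}\<^sup>\<bottom>) (orth_proj ({u}\<^sup>\<bottom>) ` A)) \<longleftrightarrow> C"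
    unfolding surface[symmetric]
  proof (intro ball_cong refl)
    fix A assume A: "A \<in> \<L>"
    show "(\<forall>u\<in>sphere 0 1. vol A * surface_area_in ({u}\<^sup>\<bottom>) (orth_proj ({u}\<^sup>\<bottom>) ` A)
         \<le> surface_area A * volume_in ({u}\<^sup>\<bottom>) (orth_proj ({u}\<^sup>\<bottom>) ` A)) \<longleftrightarrow> (\<forall>u. ?S1 A u)"
    proof (cases "A = {}")
      case True
      then show ?thesis by (simp add: volume_in_def)
    next
      case False
      show ?thesis by (rule surface_inequality_iff[OF body[OF A False], symmetric])
    qed
  qed
  have 3: "(\<forall>A\<in>\<L>. \<forall>u\<in>sphere 0 1. \<forall>v\<in>sphere 0 1.
       vol A * volume_in ((span {u, v})\<^sup>\<bottom>) (orth_proj ((span {u, v})\<^sup>\<bottom>) ` A) * sqrt (1 - (u \<bullet> v)\<^sup>2)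
         \<le> volume_in ({u}\<^sup>\<bottom>) (orth_proj ({u}\<^sup>\<bottom>) ` A) * volume_in ({v}\<^sup>\<bottom>) (orth_proj ({v}\<^sup>\<bottom>) ` A)) \<longleftrightarrow> C"
    by (rule red) (simp_all add: volume_in_def[of _ "{}"] projection_inequality_iff)
  have 4: "(\<forall>A\<in>\<L>. \<forall>u v. vol (A + closed_segment 0 u + closed_segment 0 v) * vol A
         \<le> vol (A + closed_segment 0 u) * vol (A + closed_segment 0 v)) \<longleftrightarrow> C"
    by (rule red) (simp, simp only: volume_inequality_iff segment_inequality_def)
  have 5: "(\<forall>A\<in>\<L>. \<forall>Z1 Z2. zonoid Z1 \<longrightarrow> zonoid Z2 \<longrightarrow>
       vol A * mixed_volume (replicate (CARD('n) - 2) A @ [Z1, Z2])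
         \<le> real CARD('n) / (real CARD('n) - 1) * mixed_volume (replicate (CARD('n) - 1) A @ [Z1])
           * mixed_volume (replicate (CARD('n) - 1) A @ [Z2])) \<longleftrightarrow> C"
  proof (rule red)
    \<comment> \<open>Since n \<ge> 2, the empty set occurs at least once in the list.\<close>
    have "mixed_volume (replicate (CARD('n) - 1) {} @ [Z]) = 0" for Z :: "(real ^ 'n) set"
      using assms(1) by (intro mixed_volume_empty) auto
    then show "\<forall>Z1 Z2 :: (real ^ 'n) set. zonoid Z1 \<longrightarrow> zonoid Z2 \<longrightarrow>
       vol {} * mixed_volume (replicate (CARD('n) - 2) {} @ [Z1, Z2])
         \<le> real CARD('n) / (real CARD('n) - 1) * mixed_volume (replicate (CARD('n) - 1) {} @ [Z1])
           * mixed_volume (replicate (CARD('n) - 1) {} @ [Z2])" by simp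
  next
    fix A :: "(real ^ 'n) set" assume "body A"
    from zonoid_inequality_iff[OF n this]
    show "(\<forall>Z1 Z2. zonoid Z1 \<longrightarrow> zonoid Z2 \<longrightarrow>
       vol A * mixed_volume (replicate (CARD('n) - 2) A @ [Z1, Z2])
         \<le> real CARD('n) / (real CARD('n) - 1) * mixed_volume (replicate (CARD('n) - 1) A @ [Z1])
           * mixed_volume (replicate (CARD('n) - 1) A @ [Z2])) \<longleftrightarrow> segment_inequality A"
      by (simp only: DIM_cart DIM_real mult_1_right)
  qed
  have 6: "(\<forall>A\<in>\<L>. \<forall>u v. \<exists>p. real_rooted p \<and>
       (\<forall>t>0. vol (A + (*\<^sub>R) t ` (closed_segment 0 u + closed_segment 0 v)) = poly p t)) \<longleftrightarrow> C"
  proof (rule red)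
    \<comment> \<open>For the empty set the volume is 0 for all t, and the zero polynomial counts as
      real-rooted.\<close>
    show "\<forall>u v :: real ^ 'n. \<exists>p. real_rooted p \<and>
       (\<forall>t>0. vol ({} + (*\<^sub>R) t ` (closed_segment 0 u + closed_segment 0 v)) = poly p t)"
      by (intro allI exI[of _ 0]) (simp add: real_rooted_def)
  qed (rule real_rooted_iff)
  show ?thesis
    unfolding surface 2 3 4 5 6 by (simp add: all_equivalent_def)
qed

end
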